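(* Let $R$ be a ring Morita equivalent to a commutative domain. Then every finitely generated Baer right $R$-module $M$ with finite triangulating dimension $\tau\mathrm{dim}(M)<\infty$ is either torsion or (isomorphic to) a finite direct sum of uniform right ideals of $R$.
   Context: Rings have a unit element and modules are right unitary modules. $M$ is Baer if for every non-empty subset $X\subseteq \mathrm{End}_R(M)$ the submodule $\bigcap_{f\in X}\ker f$ is a direct summand of $M$. The triangulating dimension is $\tau\mathrm{dim}(M)=\sup\{k\in\mathbb{N} : M=\bigoplus_{i=1}^k M_i \text{ with } M_i\neq 0 \text{ and } \mathrm{Hom}_R(M_i,M_j)=0 \text{ for all } i<j\}$. Torsion means singular: every element of $M$ has essential right annihilator in $R$ (for a commutative domain this is the usual notion of torsion module). A right ideal is uniform if it is nonzero and any two of its nonzero submodules intersect non-trivially. *)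

theory Defs
  imports
    "HOL-Algebra.Ideal"
    "HOL-Library.Equipollence"
    "HOL-Library.Extended_Nat"
    "HOL-Library.FuncSet"
begin

section \<open>Right modules over a ring that need not be commutative\<close>

text \<open>
  The library's \<open>module\<close> locale assumes a commutative ring of scalars.  As there, a module is a ring
  record of which only the additive part is used; the fields \<open>mult\<close> and \<open>one\<close> carry no meaning.
\<close>

record ('a, 'b) rmodule = "'b ring" +
  rsmult :: "['b, 'a] \<Rightarrow> 'b" (infixl \<open>\<cdot>\<index>\<close> 70)

locale right_module = R?: ring R + M?: abelian_group M for R (structure) and M (structure) +
  assumes rsmult_closed [simp, intro]:
      "\<lbrakk> x \<in> carrier M; r \<in> carrier R \<rbrakk> \<Longrightarrow> x \<cdot>\<^bsub>M\<^esub> r \<in> carrier M"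
    and rsmult_r_distr:
      "\<lbrakk> x \<in> carrier M; r \<in> carrier R; s \<in> carrier R \<rbrakk> \<Longrightarrow>
       x \<cdot>\<^bsub>M\<^esub> (r \<oplus>\<^bsub>R\<^esub> s) = x \<cdot>\<^bsub>M\<^esub> r \<oplus>\<^bsub>M\<^esub> x \<cdot>\<^bsub>M\<^esub> s"
    and rsmult_l_distr:
      "\<lbrakk> x \<in> carrier M; y \<in> carrier M; r \<in> carrier R \<rbrakk> \<Longrightarrow>
       (x \<oplus>\<^bsub>M\<^esub> y) \<cdot>\<^bsub>M\<^esub> r = x \<cdot>\<^bsub>M\<^esub> r \<oplus>\<^bsub>M\<^esub> y \<cdot>\<^bsub>M\<^esub> r"
    and rsmult_assoc:
      "\<lbrakk> x \<in> carrier M; r \<in> carrier R; s \<in> carrier R \<rbrakk> \<Longrightarrow>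
       x \<cdot>\<^bsub>M\<^esub> (r \<otimes>\<^bsub>R\<^esub> s) = (x \<cdot>\<^bsub>M\<^esub> r) \<cdot>\<^bsub>M\<^esub> s"
    and rsmult_one [simp]:
      "x \<in> carrier M \<Longrightarrow> x \<cdot>\<^bsub>M\<^esub> \<one>\<^bsub>R\<^esub> = x"

definition rsubmodule :: "('a, 'c) ring_scheme \<Rightarrow> ('a, 'b) rmodule \<Rightarrow> 'b set \<Rightarrow> bool" where
  "rsubmodule R M N \<longleftrightarrow>
     additive_subgroup N M \<and> (\<forall>x\<in>N. \<forall>r\<in>carrier R. x \<cdot>\<^bsub>M\<^esub> r \<in> N)"

definition fin_gen :: "('a, 'c) ring_scheme \<Rightarrow> ('a, 'b) rmodule \<Rightarrow> bool" where
  "fin_gen R M \<longleftrightarrow>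
     (\<exists>A. finite A \<and> A \<subseteq> carrier M \<and> \<Inter> {N. rsubmodule R M N \<and> A \<subseteq> N} = carrier M)"

text \<open>
  Homomorphisms are taken to be undefined outside the source, so that equality of homomorphisms
  is equality on the source, as is needed for hom-sets of a category.
\<close>

definition rmod_hom ::
    "('a, 'c) ring_scheme \<Rightarrow> ('a, 'b) rmodule \<Rightarrow> ('a, 'd) rmodule \<Rightarrow> ('b \<Rightarrow> 'd) set" where
  "rmod_hom R M N = {f \<in> carrier M \<rightarrow>\<^sub>E carrier N.
     (\<forall>x\<in>carrier M. \<forall>y\<in>carrier M. f (x \<oplus>\<^bsub>M\<^esub> y) = f x \<oplus>\<^bsub>N\<^esub> f y) \<and>
     (\<forall>x\<in>carrier M. \<forall>r\<in>carrier R. f (x \<cdot>\<^bsub>M\<^esub> r) = f x \<cdot>\<^bsub>N\<^esub> r)}"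

definition rmod_iso ::
    "('a, 'c) ring_scheme \<Rightarrow> ('a, 'b) rmodule \<Rightarrow> ('a, 'd) rmodule \<Rightarrow> ('b \<Rightarrow> 'd) set" where
  "rmod_iso R M N = {f \<in> rmod_hom R M N. bij_betw f (carrier M) (carrier N)}"

definition rmod_ker :: "('a, 'b) rmodule \<Rightarrow> ('a, 'd) rmodule \<Rightarrow> ('b \<Rightarrow> 'd) \<Rightarrow> 'b set" where
  "rmod_ker M N f = {x \<in> carrier M. f x = \<zero>\<^bsub>N\<^esub>}"

abbreviation submod :: "('a, 'b) rmodule \<Rightarrow> 'b set \<Rightarrow> ('a, 'b) rmodule" where
  "submod M N \<equiv> M\<lparr>carrier := N\<rparr>"

text \<open>External direct sum; it coincides with the direct product as it is only used for finite \<open>I\<close>.\<close>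

definition rmod_dsum :: "'i set \<Rightarrow> ('i \<Rightarrow> ('a, 'b) rmodule) \<Rightarrow> ('a, 'i \<Rightarrow> 'b) rmodule" where
  "rmod_dsum I N = \<lparr>carrier = (\<Pi>\<^sub>E i\<in>I. carrier (N i)), mult = undefined, one = undefined,
     zero = (\<lambda>i\<in>I. \<zero>\<^bsub>N i\<^esub>), add = (\<lambda>x y. \<lambda>i\<in>I. x i \<oplus>\<^bsub>N i\<^esub> y i),
     rsmult = (\<lambda>x r. \<lambda>i\<in>I. x i \<cdot>\<^bsub>N i\<^esub> r)\<rparr>"


section \<open>Baer modules and triangulating dimension\<close>

definition direct_summand :: "('a, 'c) ring_scheme \<Rightarrow> ('a, 'b) rmodule \<Rightarrow> 'b set \<Rightarrow> bool" where
  "direct_summand R M K \<longleftrightarrow> rsubmodule R M K \<and>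
     (\<exists>L. rsubmodule R M L \<and> K \<inter> L = {\<zero>\<^bsub>M\<^esub>} \<and> K <+>\<^bsub>M\<^esub> L = carrier M)"

definition baer_module :: "('a, 'c) ring_scheme \<Rightarrow> ('a, 'b) rmodule \<Rightarrow> bool" where
  "baer_module R M \<longleftrightarrow>
     (\<forall>X. X \<noteq> {} \<and> X \<subseteq> rmod_hom R M M \<longrightarrow> direct_summand R M (\<Inter>f\<in>X. rmod_ker M M f))"

definition internal_dsum ::
    "('a, 'c) ring_scheme \<Rightarrow> ('a, 'b) rmodule \<Rightarrow> 'i set \<Rightarrow> ('i \<Rightarrow> 'b set) \<Rightarrow> bool" where
  "internal_dsum R M I N \<longleftrightarrow> finite I \<and> (\<forall>i\<in>I. rsubmodule R M (N i)) \<and>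
     bij_betw (\<lambda>x. finsum M x I) (\<Pi>\<^sub>E i\<in>I. N i) (carrier M)"

definition triangular_dsum ::
    "('a, 'c) ring_scheme \<Rightarrow> ('a, 'b) rmodule \<Rightarrow> nat \<Rightarrow> (nat \<Rightarrow> 'b set) \<Rightarrow> bool" where
  "triangular_dsum R M k N \<longleftrightarrow> internal_dsum R M {1..k} N \<and>
     (\<forall>i\<in>{1..k}. N i \<noteq> {\<zero>\<^bsub>M\<^esub>}) \<and>
     (\<forall>i\<in>{1..k}. \<forall>j\<in>{1..k}. i < j \<longrightarrow>
        rmod_hom R (submod M (N i)) (submod M (N j)) = {\<lambda>x\<in>N i. \<zero>\<^bsub>M\<^esub>})"

definition tau_dim :: "('a, 'c) ring_scheme \<Rightarrow> ('a, 'b) rmodule \<Rightarrow> enat" where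
  "tau_dim R M = Sup {enat k | k. \<exists>N. triangular_dsum R M k N}"


section \<open>Right ideals, uniform and torsion modules\<close>

definition reg_rmodule :: "('a, 'c) ring_scheme \<Rightarrow> ('a, 'a) rmodule" where
  "reg_rmodule R = \<lparr>carrier = carrier R, mult = mult R, one = one R,
     zero = zero R, add = add R, rsmult = mult R\<rparr>"

abbreviation right_ideal :: "('a, 'c) ring_scheme \<Rightarrow> 'a set \<Rightarrow> bool" where
  "right_ideal R I \<equiv> rsubmodule R (reg_rmodule R) I"

abbreviation right_ideal_module :: "('a, 'c) ring_scheme \<Rightarrow> 'a set \<Rightarrow> ('a, 'a) rmodule" where
  "right_ideal_module R I \<equiv> submod (reg_rmodule R) I"

definition uniform_module :: "('a, 'c) ring_scheme \<Rightarrow> ('a, 'b) rmodule \<Rightarrow> bool" where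
  "uniform_module R M \<longleftrightarrow> carrier M \<noteq> {\<zero>\<^bsub>M\<^esub>} \<and>
     (\<forall>A B. rsubmodule R M A \<and> A \<noteq> {\<zero>\<^bsub>M\<^esub>} \<and> rsubmodule R M B \<and> B \<noteq> {\<zero>\<^bsub>M\<^esub>} \<longrightarrow>
        A \<inter> B \<noteq> {\<zero>\<^bsub>M\<^esub>})"

definition essential_submodule :: "('a, 'c) ring_scheme \<Rightarrow> ('a, 'b) rmodule \<Rightarrow> 'b set \<Rightarrow> bool" where
  "essential_submodule R M E \<longleftrightarrow> rsubmodule R M E \<and>
     (\<forall>A. rsubmodule R M A \<and> A \<noteq> {\<zero>\<^bsub>M\<^esub>} \<longrightarrow> E \<inter> A \<noteq> {\<zero>\<^bsub>M\<^esub>})"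

definition right_ann :: "('a, 'c) ring_scheme \<Rightarrow> ('a, 'b) rmodule \<Rightarrow> 'b \<Rightarrow> 'a set" where
  "right_ann R M x = {r \<in> carrier R. x \<cdot>\<^bsub>M\<^esub> r = \<zero>\<^bsub>M\<^esub>}"

definition torsion_rmodule :: "('a, 'c) ring_scheme \<Rightarrow> ('a, 'b) rmodule \<Rightarrow> bool" where
  "torsion_rmodule R M \<longleftrightarrow>
     (\<forall>x\<in>carrier M. essential_submodule R (reg_rmodule R) (right_ann R M x))"


section \<open>Morita equivalence\<close>

text \<open>
  Two rings are Morita equivalent if their categories of right modules are equivalent.  The modules
  considered are those whose carriers are sets of elements of a type \<open>'u\<close>, which plays the role of
  the universe.
\<close>

locale rmod_functor =
  fixes R :: "('a, 'c) ring_scheme" and S :: "('b, 'd) ring_scheme"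
    and Fo :: "('a, 'u) rmodule \<Rightarrow> ('b, 'u) rmodule"
    and Fm :: "('a, 'u) rmodule \<Rightarrow> ('a, 'u) rmodule \<Rightarrow> ('u \<Rightarrow> 'u) \<Rightarrow> ('u \<Rightarrow> 'u)"
  assumes obj: "right_module R X \<Longrightarrow> right_module S (Fo X)"
    and mor: "\<lbrakk> right_module R X; right_module R Y; f \<in> rmod_hom R X Y \<rbrakk> \<Longrightarrow>
      Fm X Y f \<in> rmod_hom S (Fo X) (Fo Y)"
    and ident: "right_module R X \<Longrightarrow>
      Fm X X (\<lambda>x\<in>carrier X. x) = (\<lambda>x\<in>carrier (Fo X). x)"
    and comp: "\<lbrakk> right_module R X; right_module R Y; right_module R Z;
        f \<in> rmod_hom R X Y; g \<in> rmod_hom R Y Z \<rbrakk> \<Longrightarrow>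
      Fm X Z (compose (carrier X) g f) = compose (carrier (Fo X)) (Fm Y Z g) (Fm X Y f)"

text \<open>The identity functor is naturally isomorphic to the endofunctor \<open>(Ho, Hm)\<close> via \<open>eta\<close>.\<close>

definition nat_iso_id ::
    "('a, 'c) ring_scheme \<Rightarrow> (('a, 'u) rmodule \<Rightarrow> ('a, 'u) rmodule) \<Rightarrow>
     (('a, 'u) rmodule \<Rightarrow> ('a, 'u) rmodule \<Rightarrow> ('u \<Rightarrow> 'u) \<Rightarrow> ('u \<Rightarrow> 'u)) \<Rightarrow>
     (('a, 'u) rmodule \<Rightarrow> 'u \<Rightarrow> 'u) \<Rightarrow> bool" where
  "nat_iso_id R Ho Hm eta \<longleftrightarrow>
     (\<forall>X. right_module R X \<longrightarrow> eta X \<in> rmod_iso R X (Ho X)) \<and>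
     (\<forall>X Y f. right_module R X \<and> right_module R Y \<and> f \<in> rmod_hom R X Y \<longrightarrow>
        compose (carrier X) (eta Y) f = compose (carrier X) (Hm X Y f) (eta X))"

text \<open>
  The conditions on \<open>'u\<close> ensure that the universe is large enough for the equivalence of categories
  to mean what it should (over a one-element type there are only zero modules).  If they hold, all
  countably generated modules over either ring have isomorphic copies in the universe, and the
  module categories over \<open>'u\<close> are equivalent iff there is a progenerator over one ring whose
  endomorphism ring is the other one; so the notion does not depend on the choice of \<open>'u\<close>.
\<close>

definition morita_equivalent ::
    "'u itself \<Rightarrow> ('a, 'c) ring_scheme \<Rightarrow> ('b, 'd) ring_scheme \<Rightarrow> bool" where
  "morita_equivalent (_ :: 'u itself) R S \<longleftrightarrow>
     infinite (UNIV :: 'u set) \<and> carrier R \<lesssim> (UNIV :: 'u set) \<and> carrier S \<lesssim> (UNIV :: 'u set) \<and>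
     (\<exists>(Fo :: ('a, 'u) rmodule \<Rightarrow> ('b, 'u) rmodule) Fm
       (Go :: ('b, 'u) rmodule \<Rightarrow> ('a, 'u) rmodule) Gm eta eps.
        rmod_functor R S Fo Fm \<and> rmod_functor S R Go Gm \<and>
        nat_iso_id R (\<lambda>X. Go (Fo X)) (\<lambda>X Y f. Gm (Fo X) (Fo Y) (Fm X Y f)) eta \<and>
        nat_iso_id S (\<lambda>X. Fo (Go X)) (\<lambda>X Y f. Fm (Go X) (Go Y) (Gm X Y f)) eps)"

end

theory Submission
  imports Defs "HOL-Algebra.Subrings"
begin

text \<open>
  A Morita equivalence sends the regular module of the domain to a right \<open>R\<close>-module \<open>Q\<close> that
  generates the category and whose endomorphisms commute and have no zero divisors; they turn out to
  be the scalings by the centre of \<open>R\<close>, so the centre is a domain over which \<open>R\<close> is torsion-free.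

  Let \<open>M\<close> be finitely generated and Baer, with torsion part \<open>T\<close> over the centre.  Kernels of central
  scalings are summands, so \<open>T\<close> is reduced: \<open>t z z = 0\<close> implies \<open>t z = 0\<close>.  If \<open>T \<noteq> M\<close> and \<open>T \<noteq> 0\<close>,
  then Gaussian elimination with values in the reduced module \<open>T\<close> produces a nonzero homomorphism
  \<open>g\<close> from \<open>M\<close> to \<open>T\<close> that vanishes on \<open>T\<close>.  But \<open>ker g\<close> is a summand containing \<open>T\<close>, and its
  complement embeds in \<open>T\<close> while meeting it trivially, a contradiction.

  If \<open>M\<close> is torsion-free and nonzero, the same elimination gives a nonzero \<open>\<phi> : M \<rightarrow> Q\<close>.  Composing
  with an embedding of \<open>Q\<close> into \<open>M\<close> shows that \<open>ker \<phi>\<close> is a summand; the complement is isomorphic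
  to a submodule of the uniform module \<open>Q\<close>, which embeds in \<open>R\<close>.  The procedure continues with
  \<open>ker \<phi>\<close>, which up to torsion needs one generator (homomorphism from \<open>Q\<close>) less.
\<close>

section \<open>Modules and homomorphisms\<close>

text \<open>The functors act only on modules with carriers in \<open>'u\<close>, whereas
  \<open>M\<close> has carrier type \<open>'m\<close>. So \<open>M\<close> itself is never
  transported: all information comes from \<open>Q\<close> and the finitely many \<open>f l\<close>,
  \<open>q l\<close> with sum of \<open>f l (q l)\<close> equal to one. The main device is that, for
  fixed \<open>x\<close> in \<open>Q\<close>, sending \<open>y\<close> to \<open>x\<close> times
  \<open>f l y\<close> is an endomorphism of \<open>Q\<close>, hence multiplication by a central
  scalar. This replaces elements of \<open>Q\<close> by elements of a commutative domain. The kernel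
  of a presentation of \<open>M\<close> need not be finitely generated, so the linear systems have
  finitely many unknowns but an arbitrary set of relations. Passing to a field of fractions would
  kill the target when this target is the torsion part; hence the elimination clears denominators,
  and reducedness is the cancellation property that it uses. Torsion is measured by central elements
  because these act on every module by endomorphisms, to which the Baer condition applies. The
  comparison with singularity is made in one direction: torsion over the centre implies
  singular.\<close>

context right_module
begin

lemma rsmult_zero_left [simp]:
  assumes "r \<in> carrier R" shows "\<zero>\<^bsub>M\<^esub> \<cdot>\<^bsub>M\<^esub> r = \<zero>\<^bsub>M\<^esub>"
proof -
  have "\<zero>\<^bsub>M\<^esub> \<cdot>\<^bsub>M\<^esub> r = \<zero>\<^bsub>M\<^esub> \<cdot>\<^bsub>M\<^esub> r \<oplus>\<^bsub>M\<^esub> \<zero>\<^bsub>M\<^esub> \<cdot>\<^bsub>M\<^esub> r"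
    using rsmult_l_distr[of "\<zero>\<^bsub>M\<^esub>" "\<zero>\<^bsub>M\<^esub>" r] assms by simp
  then show ?thesis
    using M.add.l_cancel_one'[of "\<zero>\<^bsub>M\<^esub> \<cdot>\<^bsub>M\<^esub> r" "\<zero>\<^bsub>M\<^esub> \<cdot>\<^bsub>M\<^esub> r"] assms by simp
qed

lemma rsmult_zero_right [simp]:
  assumes "x \<in> carrier M" shows "x \<cdot>\<^bsub>M\<^esub> \<zero>\<^bsub>R\<^esub> = \<zero>\<^bsub>M\<^esub>"
proof -
  have "x \<cdot>\<^bsub>M\<^esub> \<zero>\<^bsub>R\<^esub> = x \<cdot>\<^bsub>M\<^esub> \<zero>\<^bsub>R\<^esub> \<oplus>\<^bsub>M\<^esub> x \<cdot>\<^bsub>M\<^esub> \<zero>\<^bsub>R\<^esub>"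
    using rsmult_r_distr[of x "\<zero>\<^bsub>R\<^esub>" "\<zero>\<^bsub>R\<^esub>"] assms by simp
  then show ?thesis
    using M.add.l_cancel_one'[of "x \<cdot>\<^bsub>M\<^esub> \<zero>\<^bsub>R\<^esub>" "x \<cdot>\<^bsub>M\<^esub> \<zero>\<^bsub>R\<^esub>"] assms by simp
qed

lemma rsmult_minus_left:
  assumes "x \<in> carrier M" "r \<in> carrier R"
  shows "(\<ominus>\<^bsub>M\<^esub> x) \<cdot>\<^bsub>M\<^esub> r = \<ominus>\<^bsub>M\<^esub> (x \<cdot>\<^bsub>M\<^esub> r)"
proof (rule M.minus_equality[symmetric])
  show "(\<ominus>\<^bsub>M\<^esub> x) \<cdot>\<^bsub>M\<^esub> r \<oplus>\<^bsub>M\<^esub> x \<cdot>\<^bsub>M\<^esub> r = \<zero>\<^bsub>M\<^esub>"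
    using rsmult_l_distr[of "\<ominus>\<^bsub>M\<^esub> x" x r] assms by (simp add: M.l_neg)
qed (use assms in auto)

lemma rsmult_minus_right:
  assumes "x \<in> carrier M" "r \<in> carrier R"
  shows "x \<cdot>\<^bsub>M\<^esub> (\<ominus>\<^bsub>R\<^esub> r) = \<ominus>\<^bsub>M\<^esub> (x \<cdot>\<^bsub>M\<^esub> r)"
proof (rule M.minus_equality[symmetric])
  show "x \<cdot>\<^bsub>M\<^esub> (\<ominus>\<^bsub>R\<^esub> r) \<oplus>\<^bsub>M\<^esub> x \<cdot>\<^bsub>M\<^esub> r = \<zero>\<^bsub>M\<^esub>"
    using rsmult_r_distr[of x "\<ominus>\<^bsub>R\<^esub> r" r] assms by (simp add: R.l_neg)
qed (use assms in auto)

lemma finsum_rsmult: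
  assumes "finite I" "f \<in> I \<rightarrow> carrier M" "r \<in> carrier R"
  shows "finsum M f I \<cdot>\<^bsub>M\<^esub> r = finsum M (\<lambda>i. f i \<cdot>\<^bsub>M\<^esub> r) I"
  using assms
proof (induction I rule: finite_induct)
  case (insert i I)
  then show ?case by (simp add: rsmult_l_distr Pi_def)
qed simp

lemma rsmult_finsum:
  assumes "finite I" "f \<in> I \<rightarrow> carrier R" "x \<in> carrier M"
  shows "x \<cdot>\<^bsub>M\<^esub> finsum R f I = finsum M (\<lambda>i. x \<cdot>\<^bsub>M\<^esub> f i) I"
  using assms
proof (induction I rule: finite_induct)
  case (insert i I)
  then show ?case by (simp add: rsmult_r_distr Pi_def)
qed simp

end

text \<open>\<open>right_module\<close> allows extensions of the record \<open>M\<close>, \<open>rsubmodule\<close> does not.\<close>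

locale rmod = right_module R M for R (structure) and M :: "('a, 'b) rmodule" (structure)

lemma reg_rmodule_simps [simp]:
  "carrier (reg_rmodule R) = carrier R" "zero (reg_rmodule R) = zero R"
  "add (reg_rmodule R) = add R" "rsmult (reg_rmodule R) = mult R"
  by (simp_all add: reg_rmodule_def)

lemma right_moduleI:
  assumes "ring R" "abelian_group M"
    and "\<And>x r. \<lbrakk>x \<in> carrier M; r \<in> carrier R\<rbrakk> \<Longrightarrow> x \<cdot>\<^bsub>M\<^esub> r \<in> carrier M"
    and "\<And>x r s. \<lbrakk>x \<in> carrier M; r \<in> carrier R; s \<in> carrier R\<rbrakk> \<Longrightarrow>
       x \<cdot>\<^bsub>M\<^esub> (r \<oplus>\<^bsub>R\<^esub> s) = x \<cdot>\<^bsub>M\<^esub> r \<oplus>\<^bsub>M\<^esub> x \<cdot>\<^bsub>M\<^esub> s"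
    and "\<And>x y r. \<lbrakk>x \<in> carrier M; y \<in> carrier M; r \<in> carrier R\<rbrakk> \<Longrightarrow>
       (x \<oplus>\<^bsub>M\<^esub> y) \<cdot>\<^bsub>M\<^esub> r = x \<cdot>\<^bsub>M\<^esub> r \<oplus>\<^bsub>M\<^esub> y \<cdot>\<^bsub>M\<^esub> r"
    and "\<And>x r s. \<lbrakk>x \<in> carrier M; r \<in> carrier R; s \<in> carrier R\<rbrakk> \<Longrightarrow>
       x \<cdot>\<^bsub>M\<^esub> (r \<otimes>\<^bsub>R\<^esub> s) = (x \<cdot>\<^bsub>M\<^esub> r) \<cdot>\<^bsub>M\<^esub> s"
    and "\<And>x. x \<in> carrier M \<Longrightarrow> x \<cdot>\<^bsub>M\<^esub> \<one>\<^bsub>R\<^esub> = x"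
  shows "right_module R M"
  using assms unfolding right_module_def right_module_axioms_def by blast

lemma right_module_reg:
  assumes "ring R" shows "right_module R (reg_rmodule R)"
proof -
  interpret ring R by fact
  show ?thesis
  proof (rule right_moduleI)
    show "abelian_group (reg_rmodule R)"
    proof (rule abelian_groupI, goal_cases)
      case (6 x)
      then show ?case using l_neg[of x] by (auto intro!: bexI[of _ "\<ominus>\<^bsub>R\<^esub> x"])
    qed (simp_all, simp_all add: a_assoc, metis a_comm)
  qed (simp_all add: l_distr r_distr m_assoc ring_axioms)
qed

section \<open>Submodules\<close>

lemma rsubmoduleD:
  assumes "rsubmodule R M N"
  shows "N \<subseteq> carrier M" "\<zero>\<^bsub>M\<^esub> \<in> N"
    "\<And>x y. \<lbrakk>x \<in> N; y \<in> N\<rbrakk> \<Longrightarrow> x \<oplus>\<^bsub>M\<^esub> y \<in> N"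
    "\<And>x r. \<lbrakk>x \<in> N; r \<in> carrier R\<rbrakk> \<Longrightarrow> x \<cdot>\<^bsub>M\<^esub> r \<in> N"
proof -
  have N: "additive_subgroup N M" using assms by (simp add: rsubmodule_def)
  show "N \<subseteq> carrier M" by (rule additive_subgroup.a_subset[OF N])
  show "\<zero>\<^bsub>M\<^esub> \<in> N" by (rule additive_subgroup.zero_closed[OF N])
  show "\<And>x y. \<lbrakk>x \<in> N; y \<in> N\<rbrakk> \<Longrightarrow> x \<oplus>\<^bsub>M\<^esub> y \<in> N" by (rule additive_subgroup.a_closed[OF N])
  show "\<And>x r. \<lbrakk>x \<in> N; r \<in> carrier R\<rbrakk> \<Longrightarrow> x \<cdot>\<^bsub>M\<^esub> r \<in> N" using assms by (simp add: rsubmodule_def)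
qed

lemma (in rmod) rsubmodule_minus:
  assumes "rsubmodule R M N" "x \<in> N" shows "\<ominus>\<^bsub>M\<^esub> x \<in> N"
proof -
  have "x \<in> carrier M" using assms rsubmoduleD(1) by blast
  then have "\<ominus>\<^bsub>M\<^esub> x = x \<cdot>\<^bsub>M\<^esub> (\<ominus>\<^bsub>R\<^esub> \<one>\<^bsub>R\<^esub>)" by (simp add: rsmult_minus_right)
  then show ?thesis using rsubmoduleD(4)[OF assms, of "\<ominus>\<^bsub>R\<^esub> \<one>\<^bsub>R\<^esub>"] by simp
qed

lemma (in rmod) rsubmoduleI:
  assumes "N \<subseteq> carrier M" "\<zero>\<^bsub>M\<^esub> \<in> N"
    and add: "\<And>x y. \<lbrakk>x \<in> N; y \<in> N\<rbrakk> \<Longrightarrow> x \<oplus>\<^bsub>M\<^esub> y \<in> N"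
    and smult: "\<And>x r. \<lbrakk>x \<in> N; r \<in> carrier R\<rbrakk> \<Longrightarrow> x \<cdot>\<^bsub>M\<^esub> r \<in> N"
  shows "rsubmodule R M N"
proof -
  have minus: "\<ominus>\<^bsub>M\<^esub> x \<in> N" if "x \<in> N" for x
  proof -
    have "\<ominus>\<^bsub>M\<^esub> x = x \<cdot>\<^bsub>M\<^esub> (\<ominus>\<^bsub>R\<^esub> \<one>\<^bsub>R\<^esub>)" using that assms(1) by (auto simp: rsmult_minus_right)
    then show ?thesis using smult[OF that, of "\<ominus>\<^bsub>R\<^esub> \<one>\<^bsub>R\<^esub>"] by simp
  qed
  have "subgroup N (add_monoid M)"
    by (rule M.add.subgroupI) (use assms(1,2) add minus in auto)
  then show ?thesis using smult unfolding rsubmodule_def additive_subgroup_def by blast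
qed

lemma (in rmod) rsubmodule_finsum:
  assumes N: "rsubmodule R M N" and "finite I" and "\<And>i. i \<in> I \<Longrightarrow> f i \<in> N"
  shows "finsum M f I \<in> N"
  using assms(2,3)
proof (induction I rule: finite_induct)
  case (insert i I)
  then show ?case
    using rsubmoduleD[OF N] by (subst M.finsum_insert) auto
qed (use rsubmoduleD[OF N] in auto)

lemma (in rmod) right_module_submod:
  assumes N: "rsubmodule R M N" shows "right_module R (submod M N)"
proof (rule right_moduleI)
  note D = rsubmoduleD[OF N]
  have "\<ominus>\<^bsub>M\<^esub> x \<in> N \<and> \<ominus>\<^bsub>M\<^esub> x \<oplus>\<^bsub>M\<^esub> x = \<zero>\<^bsub>M\<^esub>" if "x \<in> N" for x
    using rsubmodule_minus[OF N that] D(1) that M.l_neg by blast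
  then have inv: "\<exists>y\<in>N. y \<oplus>\<^bsub>M\<^esub> x = \<zero>\<^bsub>M\<^esub>" if "x \<in> N" for x
    using that by blast
  have sub: "x \<in> carrier M" if "x \<in> N" for x using D(1) that by blast
  show "abelian_group (submod M N)"
  proof (rule abelian_groupI, goal_cases)
    case (3 x y z) then show ?case using M.a_assoc[of x y z] sub by simp
  next
    case (4 x y) then show ?case using M.a_comm[of x y] sub by simp
  next
    case (6 x) then show ?case using inv[of x] by simp
  qed (simp_all add: D(2,3) sub)
qed (use rsubmoduleD[OF N] in \<open>simp_all add: rsmult_r_distr rsmult_l_distr rsmult_assoc subset_iff R.ring_axioms\<close>)

lemma (in rmod) rsubmodule_submod_iff:
  assumes N: "rsubmodule R M N"
  shows "rsubmodule R (submod M N) A \<longleftrightarrow> rsubmodule R M A \<and> A \<subseteq> N"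
proof -
  interpret N: rmod R "submod M N" by (rule rmod.intro[OF right_module_submod[OF N]])
  show ?thesis
  proof
    assume A: "rsubmodule R (submod M N) A"
    show "rsubmodule R M A \<and> A \<subseteq> N"
      using rsubmoduleD[OF A] rsubmoduleD(1)[OF N] by (auto intro!: rsubmoduleI)
  next
    assume "rsubmodule R M A \<and> A \<subseteq> N"
    then show "rsubmodule R (submod M N) A"
      using rsubmoduleD[of R M A] by (auto intro!: N.rsubmoduleI)
  qed
qed

section \<open>Homomorphisms, images and kernels\<close>

lemma rmod_homI:
  assumes "f \<in> carrier M \<rightarrow>\<^sub>E carrier N"
    and "\<And>x y. \<lbrakk>x \<in> carrier M; y \<in> carrier M\<rbrakk> \<Longrightarrow> f (x \<oplus>\<^bsub>M\<^esub> y) = f x \<oplus>\<^bsub>N\<^esub> f y"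
    and "\<And>x r. \<lbrakk>x \<in> carrier M; r \<in> carrier R\<rbrakk> \<Longrightarrow> f (x \<cdot>\<^bsub>M\<^esub> r) = f x \<cdot>\<^bsub>N\<^esub> r"
  shows "f \<in> rmod_hom R M N"
  using assms by (simp add: rmod_hom_def)

lemma rmod_homD:
  assumes "f \<in> rmod_hom R M N"
  shows "f \<in> carrier M \<rightarrow>\<^sub>E carrier N"
    "\<And>x. x \<in> carrier M \<Longrightarrow> f x \<in> carrier N"
    "\<And>x y. \<lbrakk>x \<in> carrier M; y \<in> carrier M\<rbrakk> \<Longrightarrow> f (x \<oplus>\<^bsub>M\<^esub> y) = f x \<oplus>\<^bsub>N\<^esub> f y"
    "\<And>x r. \<lbrakk>x \<in> carrier M; r \<in> carrier R\<rbrakk> \<Longrightarrow> f (x \<cdot>\<^bsub>M\<^esub> r) = f x \<cdot>\<^bsub>N\<^esub> r"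
  using assms by (auto simp: rmod_hom_def)

lemma rmod_hom_eqI:
  assumes "f \<in> rmod_hom R M N" "g \<in> rmod_hom R M N'" "\<And>x. x \<in> carrier M \<Longrightarrow> f x = g x"
  shows "f = g"
proof (rule extensionalityI)
  show "f \<in> extensional (carrier M)" "g \<in> extensional (carrier M)"
    using rmod_homD(1)[OF assms(1)] rmod_homD(1)[OF assms(2)] by (simp_all add: PiE_def)
qed (rule assms(3))

lemma rmod_hom_zero:
  assumes "right_module R M" "right_module R N" "f \<in> rmod_hom R M N"
  shows "f \<zero>\<^bsub>M\<^esub> = \<zero>\<^bsub>N\<^esub>"
proof -
  interpret M: rmod R M by (rule rmod.intro) fact
  interpret N: rmod R N by (rule rmod.intro) fact
  show ?thesis
    using rmod_homD(2,4)[OF assms(3), of "\<zero>\<^bsub>M\<^esub>"] rmod_homD(4)[OF assms(3), of "\<zero>\<^bsub>M\<^esub>" "\<zero>\<^bsub>R\<^esub>"]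
    by simp
qed

lemma rmod_hom_minus:
  assumes "right_module R M" "right_module R N" "f \<in> rmod_hom R M N" "x \<in> carrier M"
  shows "f (\<ominus>\<^bsub>M\<^esub> x) = \<ominus>\<^bsub>N\<^esub> f x"
proof -
  interpret M: rmod R M by (rule rmod.intro) fact
  interpret N: rmod R N by (rule rmod.intro) fact
  have "f (x \<cdot>\<^bsub>M\<^esub> (\<ominus>\<^bsub>R\<^esub> \<one>\<^bsub>R\<^esub>)) = f x \<cdot>\<^bsub>N\<^esub> (\<ominus>\<^bsub>R\<^esub> \<one>\<^bsub>R\<^esub>)"
    using rmod_homD(4)[OF assms(3,4)] by simp
  then show ?thesis
    using assms(4) rmod_homD(2)[OF assms(3,4)]
    by (simp add: M.rsmult_minus_right N.rsmult_minus_right)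
qed

lemma rmod_hom_finsum:
  assumes "right_module R M" "right_module R N" and f: "f \<in> rmod_hom R M N"
    and "finite I" "x \<in> I \<rightarrow> carrier M"
  shows "f (finsum M x I) = finsum N (\<lambda>i. f (x i)) I"
proof -
  interpret M: rmod R M by (rule rmod.intro) fact
  interpret N: rmod R N by (rule rmod.intro) fact
  show ?thesis
    using assms(4,5)
  proof (induction I rule: finite_induct)
    case (insert i I)
    then show ?case
      by (simp add: Pi_def rmod_homD[OF f] M.M.finsum_closed)
  qed (simp add: rmod_hom_zero[OF assms(1-3)])
qed

lemma rmod_hom_compose:
  assumes "right_module R X" "f \<in> rmod_hom R X Y" "g \<in> rmod_hom R Y Z"
  shows "compose (carrier X) g f \<in> rmod_hom R X Z"
proof -
  interpret X: rmod R X by (rule rmod.intro) fact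
  show ?thesis
    by (rule rmod_homI) (auto simp: compose_def rmod_homD[OF assms(2)] rmod_homD[OF assms(3)])
qed

lemma rmod_hom_zero_map:
  assumes "right_module R X" "right_module R Y"
  shows "(\<lambda>x\<in>carrier X. \<zero>\<^bsub>Y\<^esub>) \<in> rmod_hom R X Y"
proof -
  interpret X: rmod R X by (rule rmod.intro) fact
  interpret Y: rmod R Y by (rule rmod.intro) fact
  show ?thesis by (rule rmod_homI) auto
qed

lemma rmod_hom_id:
  assumes "right_module R X"
  shows "(\<lambda>x\<in>carrier X. x) \<in> rmod_hom R X X"
proof -
  interpret X: rmod R X by (rule rmod.intro) fact
  show ?thesis by (rule rmod_homI) auto
qed

lemma (in rmod) rmod_hom_element:
  assumes "x \<in> carrier M"
  shows "(\<lambda>r\<in>carrier R. x \<cdot>\<^bsub>M\<^esub> r) \<in> rmod_hom R (reg_rmodule R) M"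
  using assms by (intro rmod_homI) (auto simp: rsmult_r_distr rsmult_assoc)

text \<open>With \<open>M\<close> and \<open>X\<close> both equal to \<open>Q\<close>, these are the
  endomorphisms from which all central scalars of the later arguments arise.\<close>

lemma (in rmod) rmod_hom_element_comp:
  assumes "x \<in> carrier M" "f \<in> rmod_hom R X (reg_rmodule R)" "right_module R X"
  shows "(\<lambda>y\<in>carrier X. x \<cdot>\<^bsub>M\<^esub> f y) \<in> rmod_hom R X M"
proof -
  interpret X: rmod R X by (rule rmod.intro) fact
  show ?thesis
    using assms rmod_homD[OF assms(2)] by (intro rmod_homI) (auto simp: rsmult_r_distr rsmult_assoc)
qed

lemma rmod_hom_into_submod_iff:
  assumes "K \<subseteq> carrier N"
  shows "f \<in> rmod_hom R M (submod N K) \<longleftrightarrow> f \<in> rmod_hom R M N \<and> f ` carrier M \<subseteq> K"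
  using assms by (auto simp: rmod_hom_def PiE_iff)

lemma rsubmodule_image:
  assumes "right_module R M" "right_module R N" "f \<in> rmod_hom R M N" "rsubmodule R M A"
  shows "rsubmodule R N (f ` A)"
proof -
  interpret N: rmod R N by (rule rmod.intro) fact
  note A = rsubmoduleD[OF assms(4)] and f = rmod_homD[OF assms(3)]
  show ?thesis
  proof (rule N.rsubmoduleI)
    show "\<zero>\<^bsub>N\<^esub> \<in> f ` A" using A(2) rmod_hom_zero[OF assms(1-3)] by (metis image_eqI)
    show "x \<oplus>\<^bsub>N\<^esub> y \<in> f ` A" if xy: "x \<in> f ` A" "y \<in> f ` A" for x y
    proof -
      obtain a b where "a \<in> A" "x = f a" "b \<in> A" "y = f b" using xy by blast
      then show ?thesis
        using subsetD[OF A(1)] A(3) f(3)[of a b] by (auto intro!: image_eqI[of _ _ "a \<oplus>\<^bsub>M\<^esub> b"])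
    qed
    show "x \<cdot>\<^bsub>N\<^esub> r \<in> f ` A" if x: "x \<in> f ` A" "r \<in> carrier R" for x r
    proof -
      obtain a where "a \<in> A" "x = f a" using x by blast
      then show ?thesis
        using subsetD[OF A(1)] A(4) f(4)[of a r] x(2)
        by (auto intro!: image_eqI[of _ _ "a \<cdot>\<^bsub>M\<^esub> r"])
    qed
  qed (use A f in auto)
qed

lemma rsubmodule_vimage:
  assumes "right_module R M" "right_module R N" "f \<in> rmod_hom R M N" "rsubmodule R N B"
  shows "rsubmodule R M {x \<in> carrier M. f x \<in> B}"
proof -
  interpret M: rmod R M by (rule rmod.intro) fact
  note B = rsubmoduleD[OF assms(4)] and f = rmod_homD[OF assms(3)]
  show ?thesis
    using B rmod_hom_zero[OF assms(1-3)] by (intro M.rsubmoduleI) (auto simp: f)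
qed

lemma (in rmod) rsubmodule_zero: "rsubmodule R M {\<zero>\<^bsub>M\<^esub>}"
  by (rule rsubmoduleI) auto

lemma (in rmod) rsubmodule_carrier: "rsubmodule R M (carrier M)"
  by (rule rsubmoduleI) auto

lemma rsubmodule_ker:
  assumes "right_module R M" "right_module R N" "f \<in> rmod_hom R M N"
  shows "rsubmodule R M (rmod_ker M N f)"
  using rsubmodule_vimage[OF assms rmod.rsubmodule_zero[OF rmod.intro[OF assms(2)]]]
  by (simp add: rmod_ker_def)

lemma rmod_hom_inj_onI:
  assumes "right_module R M" "right_module R N" and f: "f \<in> rmod_hom R M N"
    and ker: "\<And>x. \<lbrakk>x \<in> carrier M; f x = \<zero>\<^bsub>N\<^esub>\<rbrakk> \<Longrightarrow> x = \<zero>\<^bsub>M\<^esub>"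
  shows "inj_on f (carrier M)"
proof (rule inj_onI)
  interpret M: rmod R M by (rule rmod.intro) fact
  interpret N: rmod R N by (rule rmod.intro) fact
  fix x y assume xy: "x \<in> carrier M" "y \<in> carrier M" "f x = f y"
  then have "f (x \<oplus>\<^bsub>M\<^esub> \<ominus>\<^bsub>M\<^esub> y) = \<zero>\<^bsub>N\<^esub>"
    using rmod_homD[OF f] rmod_hom_minus[OF assms(1,2) f] by (simp add: N.M.r_neg)
  then have "x \<oplus>\<^bsub>M\<^esub> \<ominus>\<^bsub>M\<^esub> y = \<zero>\<^bsub>M\<^esub>" using ker xy by simp
  then show "x = y" using xy by (metis M.M.minus_equality M.M.minus_minus M.M.a_inv_closed)
qed

section \<open>Linear systems with values in a reduced module\<close>

text \<open>
  Fraction-free Gaussian elimination.  Clearing denominators multiplies a solution by the pivot,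
  and reducedness prevents this from annihilating it; the scalar \<open>s\<close> accumulates the pivots.
\<close>

lemma reduced_module_system_solvable:
  fixes S :: "('a, 'c) ring_scheme" and T :: "('a, 'b) rmodule" and Rel :: "(nat \<Rightarrow> 'a) set"
  assumes S: "domain S" and T: "right_module S T"
    and reduced: "\<And>t s. \<lbrakk>t \<in> carrier T; s \<in> carrier S; (t \<cdot>\<^bsub>T\<^esub> s) \<cdot>\<^bsub>T\<^esub> s = \<zero>\<^bsub>T\<^esub>\<rbrakk> \<Longrightarrow> t \<cdot>\<^bsub>T\<^esub> s = \<zero>\<^bsub>T\<^esub>"
    and "\<And>r i. r \<in> Rel \<Longrightarrow> r i \<in> carrier S"
    and "\<And>r i. \<lbrakk>r \<in> Rel; n \<le> i\<rbrakk> \<Longrightarrow> r i = \<zero>\<^bsub>S\<^esub>"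
    and "\<And>r p a b. \<lbrakk>r \<in> Rel; p \<in> Rel; a \<in> carrier S; b \<in> carrier S\<rbrakk> \<Longrightarrow>
      (\<lambda>i. r i \<otimes>\<^bsub>S\<^esub> a \<ominus>\<^bsub>S\<^esub> p i \<otimes>\<^bsub>S\<^esub> b) \<in> Rel"
    and "\<exists>i<n. \<forall>a\<in>carrier S. a \<noteq> \<zero>\<^bsub>S\<^esub> \<longrightarrow> (\<lambda>j. if j = i then a else \<zero>\<^bsub>S\<^esub>) \<notin> Rel"
    and t0: "t0 \<in> carrier T" and "s \<in> carrier S" "t0 \<cdot>\<^bsub>T\<^esub> s \<noteq> \<zero>\<^bsub>T\<^esub>"
  shows "\<exists>t. (\<forall>i<n. t i \<in> carrier T) \<and>
    (\<forall>r\<in>Rel. finsum T (\<lambda>i. t i \<cdot>\<^bsub>T\<^esub> r i) {..<n} = \<zero>\<^bsub>T\<^esub>) \<and> (\<exists>i<n. t i \<cdot>\<^bsub>T\<^esub> s \<noteq> \<zero>\<^bsub>T\<^esub>)"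
  using assms(4-7,9,10)
proof (induction n arbitrary: Rel s)
  case 0
  then show ?case by simp
next
  case (Suc n)
  interpret S: domain S by fact
  interpret T: rmod S T by (rule rmod.intro) fact
  note entry = Suc.prems(1) and supp = Suc.prems(2) and closed = Suc.prems(3)
    and s = Suc.prems(5,6)
  show ?case
  proof (cases "\<forall>r\<in>Rel. (t0 \<cdot>\<^bsub>T\<^esub> s) \<cdot>\<^bsub>T\<^esub> r n = \<zero>\<^bsub>T\<^esub>")
    case True
    \<comment> \<open>The last unknown gets \<open>t0\<close> times \<open>s\<close> rather than
      \<open>t0\<close>, since only the former is known to be annihilated by all last coefficients.
      Reducedness then keeps its further multiple by \<open>s\<close> nonzero.\<close>
    define t where "t = (\<lambda>i. if i = n then t0 \<cdot>\<^bsub>T\<^esub> s else \<zero>\<^bsub>T\<^esub>)"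
    have t: "t i \<in> carrier T" for i using t0 s by (simp add: t_def)
    have "finsum T (\<lambda>i. t i \<cdot>\<^bsub>T\<^esub> r i) {..<Suc n} = \<zero>\<^bsub>T\<^esub>" if "r \<in> Rel" for r
    proof -
      have "t i \<cdot>\<^bsub>T\<^esub> r i = \<zero>\<^bsub>T\<^esub>" for i
        using True that entry[OF that] by (simp add: t_def)
      then show ?thesis by simp
    qed
    moreover have "t n \<cdot>\<^bsub>T\<^esub> s \<noteq> \<zero>\<^bsub>T\<^esub>" using reduced[OF t0] s by (auto simp: t_def)
    ultimately show ?thesis using t by blast
  next
    case False
    then obtain p where p: "p \<in> Rel" "(t0 \<cdot>\<^bsub>T\<^esub> s) \<cdot>\<^bsub>T\<^esub> p n \<noteq> \<zero>\<^bsub>T\<^esub>" by blast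
    define Rel0 where "Rel0 = {r \<in> Rel. r n = \<zero>\<^bsub>S\<^esub>}"
    have pn: "p n \<in> carrier S" "p n \<noteq> \<zero>\<^bsub>S\<^esub>" using p entry[OF p(1)] t0 s by auto
    \<comment> \<open>Properness passes to the relations without last entry: if each of the first
      \<open>n\<close> unit vectors had a nonzero multiple among them, the other entries of the
      pivot relation \<open>p\<close> could be cleared, which leaves a nonzero multiple of the last
      unit vector, against the properness of \<open>Rel\<close>.\<close>
    have proper0: "\<exists>i<n. \<forall>a\<in>carrier S. a \<noteq> \<zero>\<^bsub>S\<^esub> \<longrightarrow> (\<lambda>j. if j = i then a else \<zero>\<^bsub>S\<^esub>) \<notin> Rel0"
    proof (rule ccontr)
      assume "\<not> ?thesis"
      then have units: "\<exists>a\<in>carrier S. a \<noteq> \<zero>\<^bsub>S\<^esub> \<and> (\<lambda>j. if j = i then a else \<zero>\<^bsub>S\<^esub>) \<in> Rel"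
        if "i < n" for i using that by (auto simp: Rel0_def)
      \<comment> \<open>Starting from \<open>p\<close>, entry \<open>k\<close> is cleared with a
        multiple of the unit vector at \<open>k\<close>. The last entry is only multiplied by
        nonzero scalars, so it survives in a domain.\<close>
      have "\<exists>r\<in>Rel. r n \<noteq> \<zero>\<^bsub>S\<^esub> \<and> (\<forall>i<k. r i = \<zero>\<^bsub>S\<^esub>)" if "k \<le> n" for k
        using that
      proof (induction k)
        case 0
        then show ?case using p(1) pn by blast
      next
        case (Suc k)
        then obtain r where r: "r \<in> Rel" "r n \<noteq> \<zero>\<^bsub>S\<^esub>" "\<forall>i<k. r i = \<zero>\<^bsub>S\<^esub>" by auto
        obtain a where a: "a \<in> carrier S" "a \<noteq> \<zero>\<^bsub>S\<^esub>" "(\<lambda>j. if j = k then a else \<zero>\<^bsub>S\<^esub>) \<in> Rel"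
          using units[of k] Suc.prems by auto
        note rS = entry[OF r(1)]
        let ?r = "\<lambda>i. r i \<otimes>\<^bsub>S\<^esub> a \<ominus>\<^bsub>S\<^esub> (if i = k then a else \<zero>\<^bsub>S\<^esub>) \<otimes>\<^bsub>S\<^esub> r k"
        have "?r \<in> Rel" using closed[OF r(1) a(3) a(1) rS] .
        moreover have "?r n \<noteq> \<zero>\<^bsub>S\<^esub>"
        proof -
          have "?r n = r n \<otimes>\<^bsub>S\<^esub> a" using Suc.prems a(1) rS by (simp add: S.minus_eq)
          then show ?thesis using S.integral[of "r n" a] a(1,2) rS r(2) by auto
        qed
        moreover have "?r k = \<zero>\<^bsub>S\<^esub>"
          using a(1) rS S.m_comm[of a "r k"] by (simp add: S.minus_eq S.r_neg)
        then have "\<forall>i<Suc k. ?r i = \<zero>\<^bsub>S\<^esub>"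
          using r(3) a rS by (auto simp: less_Suc_eq S.minus_eq)
        ultimately show ?case by (intro bexI[of _ ?r] conjI)
      qed
      from this[OF order.refl] obtain r where r: "r \<in> Rel" "r n \<noteq> \<zero>\<^bsub>S\<^esub>" "\<forall>i<n. r i = \<zero>\<^bsub>S\<^esub>" by blast
      have "r = (\<lambda>j. if j = n then r n else \<zero>\<^bsub>S\<^esub>)"
      proof
        fix j show "r j = (if j = n then r n else \<zero>\<^bsub>S\<^esub>)"
          using r(3) supp[OF r(1), of j] by (cases j n rule: linorder_cases) auto
      qed
      then have "\<exists>a\<in>carrier S. a \<noteq> \<zero>\<^bsub>S\<^esub> \<and> (\<lambda>j. if j = i then a else \<zero>\<^bsub>S\<^esub>) \<in> Rel"
        if "i < Suc n" for i
        using that units[of i] r(1,2) entry[OF r(1), of n] by (cases "i = n") auto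
      then show False using Suc.prems(4) by blast
    qed
    have closed0: "(\<lambda>i. r i \<otimes>\<^bsub>S\<^esub> a \<ominus>\<^bsub>S\<^esub> q i \<otimes>\<^bsub>S\<^esub> b) \<in> Rel0"
      if "r \<in> Rel0" "q \<in> Rel0" "a \<in> carrier S" "b \<in> carrier S" for r q a b
      using closed that by (simp add: Rel0_def S.minus_eq)
    have supp0: "r i = \<zero>\<^bsub>S\<^esub>" if "r \<in> Rel0" "n \<le> i" for r i
      using that supp[of r i] by (cases "i = n") (auto simp: Rel0_def)
    have entry0: "r i \<in> carrier S" if "r \<in> Rel0" for r i
      using entry that by (simp add: Rel0_def)
    have s0: "s \<otimes>\<^bsub>S\<^esub> p n \<in> carrier S" using s(1) pn(1) by simp
    \<comment> \<open>The smaller system is solved with \<open>s\<close> multiplied by the pivot, so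
      that its solution can afford to be multiplied by \<open>p n\<close> afterwards.\<close>
    have nz0: "t0 \<cdot>\<^bsub>T\<^esub> (s \<otimes>\<^bsub>S\<^esub> p n) \<noteq> \<zero>\<^bsub>T\<^esub>"
      using p(2) t0 s(1) pn by (simp add: T.rsmult_assoc)
    have "\<exists>t. (\<forall>i<n. t i \<in> carrier T) \<and>
        (\<forall>r\<in>Rel0. finsum T (\<lambda>i. t i \<cdot>\<^bsub>T\<^esub> r i) {..<n} = \<zero>\<^bsub>T\<^esub>) \<and>
        (\<exists>i<n. t i \<cdot>\<^bsub>T\<^esub> (s \<otimes>\<^bsub>S\<^esub> p n) \<noteq> \<zero>\<^bsub>T\<^esub>)"
      by (rule Suc.IH[of Rel0]) (fact entry0 supp0 closed0 proper0 s0 nz0)+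
    then obtain t where t: "\<And>i. i < n \<Longrightarrow> t i \<in> carrier T"
        "\<And>r. r \<in> Rel0 \<Longrightarrow> finsum T (\<lambda>i. t i \<cdot>\<^bsub>T\<^esub> r i) {..<n} = \<zero>\<^bsub>T\<^esub>"
        "\<exists>i<n. t i \<cdot>\<^bsub>T\<^esub> (s \<otimes>\<^bsub>S\<^esub> p n) \<noteq> \<zero>\<^bsub>T\<^esub>"
      by blast
    define y where "y = finsum T (\<lambda>i. t i \<cdot>\<^bsub>T\<^esub> p i) {..<n}"
    note pS = entry[OF p(1)]
    have y: "y \<in> carrier T" using t(1) pS by (auto simp: y_def intro!: T.M.finsum_closed)
    \<comment> \<open>Back substitution: scaling the old unknowns by \<open>p n\<close> makes the
      relation \<open>p\<close> solvable for the last one without division, with solution the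
      negative of \<open>y\<close>.\<close>
    define u where "u i = (if i < n then t i \<cdot>\<^bsub>T\<^esub> p n else \<ominus>\<^bsub>T\<^esub> y)" for i
    have "u i \<in> carrier T" for i using t(1) pn y by (simp add: u_def)
    moreover have "finsum T (\<lambda>i. u i \<cdot>\<^bsub>T\<^esub> r i) {..<Suc n} = \<zero>\<^bsub>T\<^esub>" if r: "r \<in> Rel" for r
    proof -
      note rS = entry[OF r]
      \<comment> \<open>This combination of \<open>r\<close> with the pivot relation has last entry
        zero, so \<open>t\<close> solves it. Rewriting its terms gives exactly the relation
        \<open>r\<close> for \<open>u\<close>.\<close>
      have "(\<lambda>i. r i \<otimes>\<^bsub>S\<^esub> p n \<ominus>\<^bsub>S\<^esub> p i \<otimes>\<^bsub>S\<^esub> r n) \<in> Rel0"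
        using closed[OF r p(1) pn(1) rS] rS pS S.m_comm[of "p n" "r n"]
        by (simp add: Rel0_def S.minus_eq S.r_neg)
      from t(2)[OF this]
      have "\<zero>\<^bsub>T\<^esub> = finsum T (\<lambda>i. t i \<cdot>\<^bsub>T\<^esub> (r i \<otimes>\<^bsub>S\<^esub> p n \<ominus>\<^bsub>S\<^esub> p i \<otimes>\<^bsub>S\<^esub> r n)) {..<n}" by simp
      also have "\<dots> = finsum T (\<lambda>i. u i \<cdot>\<^bsub>T\<^esub> r i \<oplus>\<^bsub>T\<^esub> (t i \<cdot>\<^bsub>T\<^esub> p i) \<cdot>\<^bsub>T\<^esub> (\<ominus>\<^bsub>S\<^esub> r n)) {..<n}"
      proof (rule T.M.finsum_cong')
        fix i assume i: "i \<in> {..<n}"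
        have "t i \<cdot>\<^bsub>T\<^esub> (r i \<otimes>\<^bsub>S\<^esub> p n \<ominus>\<^bsub>S\<^esub> p i \<otimes>\<^bsub>S\<^esub> r n)
            = t i \<cdot>\<^bsub>T\<^esub> (p n \<otimes>\<^bsub>S\<^esub> r i \<oplus>\<^bsub>S\<^esub> p i \<otimes>\<^bsub>S\<^esub> (\<ominus>\<^bsub>S\<^esub> r n))"
          using rS pS S.m_comm[of "p n" "r i"] by (simp add: S.minus_eq S.r_minus)
        also have "\<dots> = u i \<cdot>\<^bsub>T\<^esub> r i \<oplus>\<^bsub>T\<^esub> (t i \<cdot>\<^bsub>T\<^esub> p i) \<cdot>\<^bsub>T\<^esub> (\<ominus>\<^bsub>S\<^esub> r n)"
          using rS pS t(1) i by (simp add: u_def T.rsmult_r_distr T.rsmult_assoc)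
        finally show "t i \<cdot>\<^bsub>T\<^esub> (r i \<otimes>\<^bsub>S\<^esub> p n \<ominus>\<^bsub>S\<^esub> p i \<otimes>\<^bsub>S\<^esub> r n) = \<dots>" .
      qed (use rS pS t(1) pn y in \<open>auto simp: u_def\<close>)
      also have "\<dots> = finsum T (\<lambda>i. u i \<cdot>\<^bsub>T\<^esub> r i) {..<n} \<oplus>\<^bsub>T\<^esub> y \<cdot>\<^bsub>T\<^esub> (\<ominus>\<^bsub>S\<^esub> r n)"
        using rS pS t(1) pn y
        by (subst T.M.finsum_addf) (auto simp: u_def y_def intro!: arg_cong2[of _ _ _ _ "add T"] T.finsum_rsmult[symmetric])
      also have "y \<cdot>\<^bsub>T\<^esub> (\<ominus>\<^bsub>S\<^esub> r n) = u n \<cdot>\<^bsub>T\<^esub> r n"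
        using rS y by (simp add: u_def T.rsmult_minus_left T.rsmult_minus_right)
      finally show ?thesis
        using \<open>\<And>i. u i \<in> carrier T\<close> rS
        by (simp add: lessThan_Suc Pi_def T.M.a_comm[of "u n \<cdot>\<^bsub>T\<^esub> r n"] T.M.finsum_closed)
    qed
    \<comment> \<open>By commutativity \<open>u i\<close> times \<open>s\<close> is
      \<open>t i\<close> times the enlarged scalar, which the induction hypothesis keeps
      nonzero.\<close>
    moreover obtain i where i: "i < n" "t i \<cdot>\<^bsub>T\<^esub> (s \<otimes>\<^bsub>S\<^esub> p n) \<noteq> \<zero>\<^bsub>T\<^esub>" using t(3) by blast
    then have "u i \<cdot>\<^bsub>T\<^esub> s \<noteq> \<zero>\<^bsub>T\<^esub>"
      using t(1)[of i] pn(1) s(1) T.rsmult_assoc[of "t i" "p n" s] S.m_comm[of s "p n"]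
      by (simp add: u_def)
    then have "\<exists>i<Suc n. u i \<cdot>\<^bsub>T\<^esub> s \<noteq> \<zero>\<^bsub>T\<^esub>" using i by (meson less_SucI)
    ultimately show ?thesis by blast
  qed
qed

section \<open>Copies and quotients in a prescribed type\<close>

text \<open>One construction for two purposes: for injective \<open>p\<close> it is a copy of
  \<open>M\<close> in the type \<open>'u\<close>, and for \<open>p\<close> constant exactly on the
  cosets of a submodule it is the quotient. The operations are computed on chosen preimages.\<close>

definition image_module :: "('a, 'b) rmodule \<Rightarrow> ('b \<Rightarrow> 'u) \<Rightarrow> ('a, 'u) rmodule" where
  "image_module M p = (let s = inv_into (carrier M) p in
     \<lparr>carrier = p ` carrier M, mult = undefined, one = undefined, zero = p \<zero>\<^bsub>M\<^esub>,
      add = (\<lambda>u v. p (s u \<oplus>\<^bsub>M\<^esub> s v)), rsmult = (\<lambda>u r. p (s u \<cdot>\<^bsub>M\<^esub> r))\<rparr>)"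

text \<open>The fibres of \<open>p\<close> form a congruence, so the operations of
  \<open>image_module M p\<close> do not depend on the chosen preimages.\<close>

definition module_congruence ::
    "('a, 'c) ring_scheme \<Rightarrow> ('a, 'b) rmodule \<Rightarrow> ('b \<Rightarrow> 'u) \<Rightarrow> bool" where
  "module_congruence R M p \<longleftrightarrow>
     (\<forall>x\<in>carrier M. \<forall>x'\<in>carrier M. p x = p x' \<longrightarrow>
        (\<forall>y\<in>carrier M. \<forall>y'\<in>carrier M. p y = p y' \<longrightarrow> p (x \<oplus>\<^bsub>M\<^esub> y) = p (x' \<oplus>\<^bsub>M\<^esub> y')) \<and>
        (\<forall>r\<in>carrier R. p (x \<cdot>\<^bsub>M\<^esub> r) = p (x' \<cdot>\<^bsub>M\<^esub> r)))"

lemma module_congruence_inj: "inj_on p (carrier M) \<Longrightarrow> module_congruence R M p"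
  by (auto simp: module_congruence_def dest: inj_onD)

lemma module_congruenceD:
  assumes "module_congruence R M p" "x \<in> carrier M" "x' \<in> carrier M" "p x = p x'"
  shows "\<lbrakk>y \<in> carrier M; y' \<in> carrier M; p y = p y'\<rbrakk> \<Longrightarrow> p (x \<oplus>\<^bsub>M\<^esub> y) = p (x' \<oplus>\<^bsub>M\<^esub> y')"
    "r \<in> carrier R \<Longrightarrow> p (x \<cdot>\<^bsub>M\<^esub> r) = p (x' \<cdot>\<^bsub>M\<^esub> r)"
  using assms unfolding module_congruence_def by blast+

lemma image_module_simps:
  assumes "module_congruence R M p"
  shows "carrier (image_module M p) = p ` carrier M"
    "zero (image_module M p) = p \<zero>\<^bsub>M\<^esub>"
    "\<lbrakk>x \<in> carrier M; y \<in> carrier M\<rbrakk> \<Longrightarrow> p x \<oplus>\<^bsub>image_module M p\<^esub> p y = p (x \<oplus>\<^bsub>M\<^esub> y)"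
    "\<lbrakk>x \<in> carrier M; r \<in> carrier R\<rbrakk> \<Longrightarrow> p x \<cdot>\<^bsub>image_module M p\<^esub> r = p (x \<cdot>\<^bsub>M\<^esub> r)"
proof -
  have s: "inv_into (carrier M) p (p x) \<in> carrier M" "p (inv_into (carrier M) p (p x)) = p x"
    if "x \<in> carrier M" for x
    using that by (simp_all add: inv_into_into f_inv_into_f)
  show "\<lbrakk>x \<in> carrier M; y \<in> carrier M\<rbrakk> \<Longrightarrow> p x \<oplus>\<^bsub>image_module M p\<^esub> p y = p (x \<oplus>\<^bsub>M\<^esub> y)"
    using module_congruenceD(1)[OF assms s(1)[of x] _ s(2)[of x] s(1)[of y] _ s(2)[of y]]
    by (simp add: image_module_def Let_def)
  show "\<lbrakk>x \<in> carrier M; r \<in> carrier R\<rbrakk> \<Longrightarrow> p x \<cdot>\<^bsub>image_module M p\<^esub> r = p (x \<cdot>\<^bsub>M\<^esub> r)"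
    using module_congruenceD(2)[OF assms s(1)[of x] _ s(2)[of x]]
    by (simp add: image_module_def Let_def)
qed (simp_all add: image_module_def Let_def)

lemma right_module_image_module:
  assumes "right_module R M" and p: "module_congruence R M p"
  shows "right_module R (image_module M p)"
proof -
  interpret M: rmod R M by (rule rmod.intro) fact
  note simps = image_module_simps[OF p]
  have ag: "abelian_group (image_module M p)"
  proof (rule abelian_groupI, goal_cases)
    case (3 x y z)
    then obtain a b c where "a \<in> carrier M" "b \<in> carrier M" "c \<in> carrier M" "x = p a" "y = p b" "z = p c"
      by (auto simp: simps)
    then show ?case by (simp add: simps M.M.a_assoc)
  next
    case (4 x y)
    then obtain a b where "a \<in> carrier M" "b \<in> carrier M" "x = p a" "y = p b"
      by (auto simp: simps)
    then show ?case using M.M.a_comm[of a b] by (simp add: simps)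
  next
    case (5 x)
    then obtain a where "a \<in> carrier M" "x = p a" by (auto simp: simps)
    then show ?case by (simp add: simps)
  next
    case (6 x)
    then obtain a where "a \<in> carrier M" "x = p a" by (auto simp: simps)
    then show ?case
      using M.M.l_neg[of a] by (intro bexI[of _ "p (\<ominus>\<^bsub>M\<^esub> a)"]) (simp_all add: simps)
  qed (auto simp: simps)
  show ?thesis
    using ag by (rule right_moduleI[OF M.R.ring_axioms])
      (auto simp: simps M.rsmult_r_distr M.rsmult_l_distr M.rsmult_assoc)
qed

lemma image_module_hom:
  assumes "right_module R M" and p: "module_congruence R M p"
  shows "(\<lambda>x\<in>carrier M. p x) \<in> rmod_hom R M (image_module M p)"
proof -
  interpret M: rmod R M by (rule rmod.intro) fact
  show ?thesis by (rule rmod_homI) (auto simp: image_module_simps[OF p])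
qed

text \<open>The universal property of a quotient. Applied to an injective \<open>p\<close> it moves
  a homomorphism from \<open>M\<close> to the copy of \<open>M\<close>.\<close>

lemma rmod_hom_factor_image:
  assumes "right_module R M" "right_module R N" and p: "module_congruence R M p"
    and f: "f \<in> rmod_hom R M N"
    and ker: "\<And>x y. \<lbrakk>x \<in> carrier M; y \<in> carrier M; p x = p y\<rbrakk> \<Longrightarrow> f x = f y"
  shows "\<exists>g\<in>rmod_hom R (image_module M p) N. \<forall>x\<in>carrier M. g (p x) = f x"
proof -
  interpret M: rmod R M by (rule rmod.intro) fact
  define g where "g = (\<lambda>u\<in>p ` carrier M. f (inv_into (carrier M) p u))"
  have g: "g (p x) = f x" if "x \<in> carrier M" for x
  proof -
    have "inv_into (carrier M) p (p x) \<in> carrier M" "p (inv_into (carrier M) p (p x)) = p x"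
      using that by (auto intro: inv_into_into f_inv_into_f)
    then show ?thesis using ker[of "inv_into (carrier M) p (p x)" x] that by (simp add: g_def)
  qed
  have "g \<in> rmod_hom R (image_module M p) N"
  proof (rule rmod_homI)
    have "g \<in> extensional (p ` carrier M)" by (simp add: g_def)
    then show "g \<in> carrier (image_module M p) \<rightarrow>\<^sub>E carrier N"
      using g rmod_homD(2)[OF f] by (auto simp: image_module_simps[OF p] PiE_def)
  qed (auto simp: image_module_simps[OF p] g rmod_homD[OF f])
  then show ?thesis using g by blast
qed

text \<open>Cosets are sets and do not live in \<open>'u\<close>, but representatives do:
  \<open>p\<close> picks one element from each coset and embeds it by \<open>j\<close>. So a
  quotient fits into the universe as soon as the module does.\<close>

lemma quotient_congruence:
  fixes M :: "('a, 'b) rmodule" and j :: "'b \<Rightarrow> 'u"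
  assumes "right_module R M" and N: "rsubmodule R M N" and j: "inj_on j (carrier M)"
  shows "\<exists>p. module_congruence R M p \<and> p ` carrier M \<subseteq> j ` carrier M \<and>
    (\<forall>x\<in>carrier M. p x = p \<zero>\<^bsub>M\<^esub> \<longleftrightarrow> x \<in> N)"
proof -
  interpret M: rmod R M by (rule rmod.intro) fact
  note D = rsubmoduleD[OF N]
  define E where "E x = {y \<in> carrier M. y \<ominus>\<^bsub>M\<^esub> x \<in> N}" for x
  have mem: "x \<in> E x" if "x \<in> carrier M" for x
    using that D(2) by (simp add: E_def M.M.r_neg M.M.minus_eq)
  have sub: "E x \<subseteq> E y" if "x \<in> carrier M" "y \<in> carrier M" "x \<ominus>\<^bsub>M\<^esub> y \<in> N" for x y
  proof
    fix z assume z: "z \<in> E x"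
    then have "(z \<ominus>\<^bsub>M\<^esub> x) \<oplus>\<^bsub>M\<^esub> (x \<ominus>\<^bsub>M\<^esub> y) \<in> N" using that(3) D(3) by (simp add: E_def)
    moreover have "(z \<ominus>\<^bsub>M\<^esub> x) \<oplus>\<^bsub>M\<^esub> (x \<ominus>\<^bsub>M\<^esub> y) = z \<ominus>\<^bsub>M\<^esub> y"
      using z that by (simp add: E_def M.M.minus_eq M.M.a_assoc M.M.r_neg2 M.M.r_neg1)
    ultimately show "z \<in> E y" using z by (simp add: E_def)
  qed
  have sym: "y \<ominus>\<^bsub>M\<^esub> x \<in> N" if "x \<in> carrier M" "y \<in> carrier M" "x \<ominus>\<^bsub>M\<^esub> y \<in> N" for x y
    using M.rsubmodule_minus[OF N that(3)] that M.M.a_comm[of y "\<ominus>\<^bsub>M\<^esub> x"]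
    by (simp add: M.M.minus_eq M.M.minus_add)
  have E_eq: "E x = E y \<longleftrightarrow> x \<ominus>\<^bsub>M\<^esub> y \<in> N" if "x \<in> carrier M" "y \<in> carrier M" for x y
  proof
    assume "E x = E y"
    then have "x \<in> E y" using mem that by blast
    then show "x \<ominus>\<^bsub>M\<^esub> y \<in> N" by (simp add: E_def)
  next
    assume "x \<ominus>\<^bsub>M\<^esub> y \<in> N"
    then show "E x = E y" using sub[of x y] sub[of y x] sym that by blast
  qed
  \<comment> \<open>The choice depends on \<open>x\<close> only through the set \<open>E x\<close>,
    hence is the same for all elements of a coset.\<close>
  define c where "c x = (SOME y. y \<in> E x)" for x
  have c: "c x \<in> E x" if "x \<in> carrier M" for x
    unfolding c_def using mem[OF that] by (rule someI)
  have cM: "c x \<in> carrier M" if "x \<in> carrier M" for x using c[OF that] by (simp add: E_def)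
  have c_eq: "c x = c y \<longleftrightarrow> x \<ominus>\<^bsub>M\<^esub> y \<in> N" if "x \<in> carrier M" "y \<in> carrier M" for x y
  proof
    assume eq: "c x = c y"
    have "E (c x) = E x" "E (c y) = E y"
      using c[OF that(1)] c[OF that(2)] E_eq[OF cM[OF that(1)] that(1)] E_eq[OF cM[OF that(2)] that(2)]
      by (simp_all add: E_def[of x] E_def[of y])
    then show "x \<ominus>\<^bsub>M\<^esub> y \<in> N" using eq E_eq[OF that] by simp
  next
    assume "x \<ominus>\<^bsub>M\<^esub> y \<in> N"
    then show "c x = c y" using E_eq[OF that] by (simp add: c_def)
  qed
  define p where "p = j \<circ> c"
  have p_eq: "p x = p y \<longleftrightarrow> x \<ominus>\<^bsub>M\<^esub> y \<in> N" if "x \<in> carrier M" "y \<in> carrier M" for x y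
    using c_eq[OF that] inj_on_eq_iff[OF j cM[OF that(1)] cM[OF that(2)]] by (simp add: p_def)
  have "module_congruence R M p"
    unfolding module_congruence_def
  proof (intro ballI impI conjI)
    fix x x' y y'
    assume xy: "x \<in> carrier M" "x' \<in> carrier M" "p x = p x'" "y \<in> carrier M" "y' \<in> carrier M" "p y = p y'"
    have "(x \<ominus>\<^bsub>M\<^esub> x') \<oplus>\<^bsub>M\<^esub> (y \<ominus>\<^bsub>M\<^esub> y') \<in> N"
      using xy p_eq[of x x'] p_eq[of y y'] by (intro D(3)) simp_all
    moreover have "(x \<ominus>\<^bsub>M\<^esub> x') \<oplus>\<^bsub>M\<^esub> (y \<ominus>\<^bsub>M\<^esub> y') = (x \<oplus>\<^bsub>M\<^esub> y) \<ominus>\<^bsub>M\<^esub> (x' \<oplus>\<^bsub>M\<^esub> y')"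
      using xy M.M.a_lcomm[of "\<ominus>\<^bsub>M\<^esub> x'" y "\<ominus>\<^bsub>M\<^esub> y'"] by (simp add: M.M.minus_eq M.M.minus_add M.M.a_assoc)
    ultimately show "p (x \<oplus>\<^bsub>M\<^esub> y) = p (x' \<oplus>\<^bsub>M\<^esub> y')"
      using xy p_eq[of "x \<oplus>\<^bsub>M\<^esub> y" "x' \<oplus>\<^bsub>M\<^esub> y'"] by simp
  next
    fix x x' r assume x: "x \<in> carrier M" "x' \<in> carrier M" "p x = p x'" "r \<in> carrier R"
    have "(x \<ominus>\<^bsub>M\<^esub> x') \<cdot>\<^bsub>M\<^esub> r \<in> N" using x p_eq[of x x'] by (intro D(4)) simp_all
    then have "x \<cdot>\<^bsub>M\<^esub> r \<ominus>\<^bsub>M\<^esub> x' \<cdot>\<^bsub>M\<^esub> r \<in> N"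
      using x by (simp add: M.M.minus_eq M.rsmult_l_distr M.rsmult_minus_left)
    then show "p (x \<cdot>\<^bsub>M\<^esub> r) = p (x' \<cdot>\<^bsub>M\<^esub> r)"
      using x p_eq[of "x \<cdot>\<^bsub>M\<^esub> r" "x' \<cdot>\<^bsub>M\<^esub> r"] by simp
  qed
  moreover have "p x = p \<zero>\<^bsub>M\<^esub> \<longleftrightarrow> x \<in> N" if "x \<in> carrier M" for x
  proof -
    have "\<ominus>\<^bsub>M\<^esub> \<zero>\<^bsub>M\<^esub> = \<zero>\<^bsub>M\<^esub>" by (rule M.M.minus_equality) simp_all
    then have "x \<ominus>\<^bsub>M\<^esub> \<zero>\<^bsub>M\<^esub> = x" using M.M.r_zero[OF that] unfolding a_minus_def by (rule ssubst)
    then show ?thesis using p_eq[OF that M.M.zero_closed] by simp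
  qed
  moreover have "p ` carrier M \<subseteq> j ` carrier M" using cM by (auto simp: p_def)
  ultimately show ?thesis by blast
qed


section \<open>Equivalences of module categories\<close>

lemma rmod_iso_inverse:
  assumes "right_module R X" and f: "f \<in> rmod_iso R X Y"
  shows "\<exists>g\<in>rmod_hom R Y X. (\<forall>x\<in>carrier X. g (f x) = x) \<and> (\<forall>y\<in>carrier Y. f (g y) = y)"
proof -
  interpret X: rmod R X by (rule rmod.intro) fact
  have hom: "f \<in> rmod_hom R X Y" and bij: "bij_betw f (carrier X) (carrier Y)"
    using f by (auto simp: rmod_iso_def)
  define g where "g = (\<lambda>y\<in>carrier Y. inv_into (carrier X) f y)"
  have gf: "g (f x) = x" if "x \<in> carrier X" for x
    using that bij bij_betw_inv_into_left[OF bij] rmod_homD(2)[OF hom] by (simp add: g_def)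
  have gX: "g y \<in> carrier X" and fg: "f (g y) = y" if "y \<in> carrier Y" for y
    using that bij_betw_inv_into_right[OF bij that] inv_into_into[of y f "carrier X"] bij
    by (auto simp: g_def bij_betw_def)
  have "g \<in> rmod_hom R Y X"
  proof (rule rmod_homI)
    show "g \<in> carrier Y \<rightarrow>\<^sub>E carrier X" using gX by (auto simp: g_def)
    show "g (x \<oplus>\<^bsub>Y\<^esub> y) = g x \<oplus>\<^bsub>X\<^esub> g y" if "x \<in> carrier Y" "y \<in> carrier Y" for x y
      using gf[of "g x \<oplus>\<^bsub>X\<^esub> g y"] gX fg that rmod_homD(3)[OF hom, of "g x" "g y"] by simp
    show "g (x \<cdot>\<^bsub>Y\<^esub> r) = g x \<cdot>\<^bsub>X\<^esub> r" if "x \<in> carrier Y" "r \<in> carrier R" for x r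
      using gf[of "g x \<cdot>\<^bsub>X\<^esub> r"] gX fg that rmod_homD(4)[OF hom, of "g x" r] by simp
  qed
  then show ?thesis using gf fg by blast
qed

text \<open>Naturality expresses \<open>eta Y\<close> after a map through the image of that map
  under \<open>Fm\<close>, and \<open>eta Y\<close> is injective.\<close>

lemma rmod_functor_faithful:
  assumes "rmod_functor R S Fo Fm"
    and nat: "nat_iso_id R (\<lambda>X. Go (Fo X)) (\<lambda>X Y f. Gm (Fo X) (Fo Y) (Fm X Y f)) eta"
    and X: "right_module R X" and Y: "right_module R Y"
    and f: "f \<in> rmod_hom R X Y" and g: "g \<in> rmod_hom R X Y" and eq: "Fm X Y f = Fm X Y g"
  shows "f = g"
proof (rule rmod_hom_eqI[OF f g])
  fix x assume x: "x \<in> carrier X"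
  have "compose (carrier X) (eta Y) f = compose (carrier X) (eta Y) g"
    using nat X Y f g eq by (simp add: nat_iso_id_def)
  then have "eta Y (f x) = eta Y (g x)" using x by (metis compose_eq)
  moreover have "inj_on (eta Y) (carrier Y)"
    using nat Y by (auto simp: nat_iso_id_def rmod_iso_def bij_betw_def)
  ultimately show "f x = g x"
    using rmod_homD(2)[OF f x] rmod_homD(2)[OF g x] by (auto dest: inj_onD)
qed

text \<open>The preimage \<open>k\<close> of \<open>h\<close> is the image of \<open>h\<close> under
  \<open>Gm\<close>, transported back along \<open>eta\<close>. By naturality \<open>Gm\<close> does
  not distinguish \<open>h\<close> from the image of \<open>k\<close>, and \<open>Gm\<close> is
  faithful because of \<open>eps\<close>.\<close>

lemma rmod_functor_full:
  assumes F: "rmod_functor R S Fo Fm" and G: "rmod_functor S R Go Gm"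
    and nat: "nat_iso_id R (\<lambda>X. Go (Fo X)) (\<lambda>X Y f. Gm (Fo X) (Fo Y) (Fm X Y f)) eta"
    and nat': "nat_iso_id S (\<lambda>X. Fo (Go X)) (\<lambda>X Y f. Fm (Go X) (Go Y) (Gm X Y f)) eps"
    and X: "right_module R X" and Y: "right_module R Y"
    and h: "h \<in> rmod_hom S (Fo X) (Fo Y)"
  shows "\<exists>k\<in>rmod_hom R X Y. Fm X Y k = h"
proof -
  note FX = rmod_functor.obj[OF F X] and FY = rmod_functor.obj[OF F Y]
  note Gh = rmod_functor.mor[OF G FX FY h]
  have etaX: "eta X \<in> rmod_iso R X (Go (Fo X))" and etaY: "eta Y \<in> rmod_iso R Y (Go (Fo Y))"
    using nat X Y by (auto simp: nat_iso_id_def)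
  then have etaX': "eta X \<in> rmod_hom R X (Go (Fo X))" by (simp add: rmod_iso_def)
  obtain g where g: "g \<in> rmod_hom R (Go (Fo Y)) Y" "\<forall>y\<in>carrier (Go (Fo Y)). eta Y (g y) = y"
    using rmod_iso_inverse[OF Y etaY] by blast
  define k where "k = compose (carrier X) g (compose (carrier X) (Gm (Fo X) (Fo Y) h) (eta X))"
  have k: "k \<in> rmod_hom R X Y"
    unfolding k_def by (rule rmod_hom_compose[OF X rmod_hom_compose[OF X etaX' Gh] g(1)])
  note Fk = rmod_functor.mor[OF F X Y k]
  note GFk = rmod_functor.mor[OF G FX FY Fk]
  have "Gm (Fo X) (Fo Y) (Fm X Y k) = Gm (Fo X) (Fo Y) h"
  proof (rule rmod_hom_eqI[OF GFk Gh])
    fix u assume "u \<in> carrier (Go (Fo X))"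
    then obtain x where x: "x \<in> carrier X" "u = eta X x"
      using etaX by (auto simp: rmod_iso_def bij_betw_def)
    have "compose (carrier X) (eta Y) k = compose (carrier X) (Gm (Fo X) (Fo Y) (Fm X Y k)) (eta X)"
      using nat X Y k by (simp add: nat_iso_id_def)
    then have "Gm (Fo X) (Fo Y) (Fm X Y k) u = eta Y (k x)"
      using x by (metis compose_eq)
    also have "\<dots> = Gm (Fo X) (Fo Y) h u"
      using x g(2) rmod_homD(2)[OF Gh] rmod_homD(2)[OF etaX' x(1)] by (simp add: k_def compose_def)
    finally show "Gm (Fo X) (Fo Y) (Fm X Y k) u = Gm (Fo X) (Fo Y) h u" .
  qed
  then have "Fm X Y k = h"
    using rmod_functor_faithful[OF G nat' FX FY Fk h] by simp
  then show ?thesis using k by blast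
qed

text \<open>Functors are not assumed additive, so preservation of zero maps comes from fullness: the
  zero map of \<open>Fo X\<close> is the image of some \<open>k\<close>, and composing the zero map
  from \<open>X\<close> to \<open>Y\<close> with \<open>k\<close> changes nothing, while its image
  becomes zero.\<close>

lemma rmod_functor_zero:
  assumes F: "rmod_functor R S Fo Fm"
    and full: "\<And>h. h \<in> rmod_hom S (Fo X) (Fo X) \<Longrightarrow> \<exists>k\<in>rmod_hom R X X. Fm X X k = h"
    and X: "right_module R X" and Y: "right_module R Y"
  shows "Fm X Y (\<lambda>x\<in>carrier X. \<zero>\<^bsub>Y\<^esub>) = (\<lambda>x\<in>carrier (Fo X). \<zero>\<^bsub>Fo Y\<^esub>)"
proof -
  note FX = rmod_functor.obj[OF F X] and FY = rmod_functor.obj[OF F Y]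
  obtain k where k: "k \<in> rmod_hom R X X" "Fm X X k = (\<lambda>x\<in>carrier (Fo X). \<zero>\<^bsub>Fo X\<^esub>)"
    using full[OF rmod_hom_zero_map[OF FX FX]] by blast
  note z = rmod_hom_zero_map[OF X Y]
  have "(\<lambda>x\<in>carrier X. \<zero>\<^bsub>Y\<^esub>) = compose (carrier X) (\<lambda>x\<in>carrier X. \<zero>\<^bsub>Y\<^esub>) k"
    using rmod_homD(2)[OF k(1)] by (auto simp: compose_def fun_eq_iff)
  then have "Fm X Y (\<lambda>x\<in>carrier X. \<zero>\<^bsub>Y\<^esub>) =
      compose (carrier (Fo X)) (Fm X Y (\<lambda>x\<in>carrier X. \<zero>\<^bsub>Y\<^esub>)) (Fm X X k)"
    using rmod_functor.comp[OF F X X Y k(1) z] by simp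
  then show ?thesis
    using rmod_hom_zero[OF FX FY rmod_functor.mor[OF F X Y z]] k(2)
    by (simp add: compose_def cong: restrict_cong)
qed

section \<open>The generator given by a Morita equivalence with a commutative domain\<close>

text \<open>The family \<open>f\<close>, \<open>q\<close> exhibits \<open>R\<close> as a direct summand of \<open>Q\<^sup>L\<close>.\<close>

locale comm_end_generator = rmod R Q
  for R :: "('a, 'c) ring_scheme" (structure) and Q :: "('a, 'b) rmodule" (structure) +
  fixes f :: "nat \<Rightarrow> 'b \<Rightarrow> 'a" and q :: "nat \<Rightarrow> 'b" and L :: nat
  assumes f_hom: "i < L \<Longrightarrow> f i \<in> rmod_hom R Q (reg_rmodule R)"
    and q_closed: "i < L \<Longrightarrow> q i \<in> carrier Q"
    and trace_one: "finsum R (\<lambda>i. f i (q i)) {..<L} = \<one>\<^bsub>R\<^esub>"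
    and end_comm: "\<lbrakk>d \<in> rmod_hom R Q Q; e \<in> rmod_hom R Q Q; x \<in> carrier Q\<rbrakk> \<Longrightarrow> d (e x) = e (d x)"
    and end_integral: "\<lbrakk>d \<in> rmod_hom R Q Q; e \<in> rmod_hom R Q Q; \<And>x. x \<in> carrier Q \<Longrightarrow> d (e x) = \<zero>\<^bsub>Q\<^esub>\<rbrakk> \<Longrightarrow>
      (\<forall>x\<in>carrier Q. d x = \<zero>\<^bsub>Q\<^esub>) \<or> (\<forall>x\<in>carrier Q. e x = \<zero>\<^bsub>Q\<^esub>)"
    and Q_nonzero: "carrier Q \<noteq> {\<zero>\<^bsub>Q\<^esub>}"

text \<open>An endomorphism of the right regular module is determined by the image of one, hence is
  a left multiplication. This is how commutativity and integrality of \<open>S\<close> reach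
  endomorphism rings.\<close>

lemma image_module_reg_end:
  assumes S: "ring S" and j: "inj_on j (carrier S)"
    and k: "k \<in> rmod_hom S (image_module (reg_rmodule S) j) (image_module (reg_rmodule S) j)"
  shows "\<exists>a\<in>carrier S. \<forall>s\<in>carrier S. k (j s) = j (a \<otimes>\<^bsub>S\<^esub> s)"
proof -
  interpret S: ring S by fact
  have c: "module_congruence S (reg_rmodule S) j" using j by (simp add: module_congruence_inj)
  note simps = image_module_simps[OF c, simplified]
  have "k (j \<one>\<^bsub>S\<^esub>) \<in> j ` carrier S" using rmod_homD(2)[OF k, of "j \<one>\<^bsub>S\<^esub>"] by (simp add: simps)
  then obtain a where a: "a \<in> carrier S" "k (j \<one>\<^bsub>S\<^esub>) = j a" by blast
  have "k (j s) = j (a \<otimes>\<^bsub>S\<^esub> s)" if "s \<in> carrier S" for s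
    using rmod_homD(4)[OF k, of "j \<one>\<^bsub>S\<^esub>" s] a that simps(4)[of "\<one>\<^bsub>S\<^esub>" s] simps(4)[of a s]
    by (simp add: simps(1))
  then show ?thesis using a(1) by blast
qed

text \<open>\<open>Tr\<close> is the trace of \<open>Q\<close> in \<open>R\<close>. It is spelled
  out as sums over initial segments so that membership of one yields literally the data
  \<open>f\<close>, \<open>q\<close>, \<open>L\<close> of \<open>comm_end_generator\<close>.\<close>

lemma trace_ideal:
  assumes "right_module R Q"
  defines "Tr \<equiv> {r. \<exists>(L::nat) f q. (\<forall>i<L. f i \<in> rmod_hom R Q (reg_rmodule R) \<and> q i \<in> carrier Q) \<and>
    r = finsum R (\<lambda>i. f i (q i)) {..<L}}"
  shows "right_ideal R Tr"
    and "\<lbrakk>g \<in> rmod_hom R Q (reg_rmodule R); x \<in> carrier Q\<rbrakk> \<Longrightarrow> g x \<in> Tr"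
proof -
  interpret Q: rmod R Q by (rule rmod.intro) fact
  interpret reg: rmod R "reg_rmodule R" by (rule rmod.intro[OF right_module_reg[OF Q.R.ring_axioms]])
  have zero: "\<zero>\<^bsub>R\<^esub> \<in> Tr" unfolding Tr_def by (rule CollectI, rule exI[of _ 0]) simp
  \<comment> \<open>A further term is appended at the free index \<open>L\<close>; sums of two
    members are then built term by term.\<close>
  have step: "r \<oplus>\<^bsub>R\<^esub> g x \<in> Tr"
    if r: "r \<in> Tr" and g: "g \<in> rmod_hom R Q (reg_rmodule R)" and x: "x \<in> carrier Q" for r g x
  proof -
    obtain L f q where fq: "\<forall>i<(L::nat). f i \<in> rmod_hom R Q (reg_rmodule R) \<and> q i \<in> carrier Q"
      and r: "r = finsum R (\<lambda>i. f i (q i)) {..<L}" using r unfolding Tr_def by blast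
    have cl: "f i (q i) \<in> carrier R" if "i < L" for i
      using fq that rmod_homD(2)[of "f i" R Q "reg_rmodule R" "q i"] by simp
    have gx: "g x \<in> carrier R" using rmod_homD(2)[OF g x] by simp
    have "finsum R (\<lambda>i. (f(L := g)) i ((q(L := x)) i)) {..<L} = r"
      unfolding r by (rule Q.R.finsum_cong') (auto simp: cl)
    then have "r \<oplus>\<^bsub>R\<^esub> g x = finsum R (\<lambda>i. (f(L := g)) i ((q(L := x)) i)) {..<Suc L}"
      using cl gx r Q.R.a_comm[of r "g x"] Q.R.finsum_closed[of "\<lambda>i. f i (q i)" "{..<L}"]
      by (simp add: lessThan_Suc Pi_def)
    then show ?thesis unfolding Tr_def using fq g x
      by (intro CollectI exI[of _ "Suc L"] exI[of _ "f(L := g)"] exI[of _ "q(L := x)"])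
        (auto simp: less_Suc_eq)
  qed
  have TrR: "Tr \<subseteq> carrier R"
  proof
    fix r assume "r \<in> Tr"
    then obtain L f q where fq: "\<forall>i<(L::nat). f i \<in> rmod_hom R Q (reg_rmodule R) \<and> q i \<in> carrier Q"
      and r: "r = finsum R (\<lambda>i. f i (q i)) {..<L}" unfolding Tr_def by blast
    have "f i (q i) \<in> carrier R" if "i < L" for i
      using fq that rmod_homD(2)[of "f i" R Q "reg_rmodule R" "q i"] by simp
    then show "r \<in> carrier R" unfolding r by (intro Q.R.finsum_closed) auto
  qed
  show "right_ideal R Tr"
  proof (rule reg.rsubmoduleI)
    show "Tr \<subseteq> carrier (reg_rmodule R)" "\<zero>\<^bsub>reg_rmodule R\<^esub> \<in> Tr" using TrR zero by simp_all
  next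
    fix x y assume x: "x \<in> Tr" and y: "y \<in> Tr"
    obtain L f q where fq: "\<forall>i<(L::nat). f i \<in> rmod_hom R Q (reg_rmodule R) \<and> q i \<in> carrier Q"
      and r: "y = finsum R (\<lambda>i. f i (q i)) {..<L}" using y unfolding Tr_def by blast
    have cl: "f i (q i) \<in> carrier R" if "i < L" for i
      using fq that rmod_homD(2)[of "f i" R Q "reg_rmodule R" "q i"] by simp
    have "x \<oplus>\<^bsub>R\<^esub> finsum R (\<lambda>i. f i (q i)) {..<K} \<in> Tr" if "K \<le> L" for K
      using that
    proof (induction K)
      case 0
      then show ?case using x TrR by (simp add: subset_iff)
    next
      case (Suc K)
      have fin: "finsum R (\<lambda>i. f i (q i)) {..<K} \<in> carrier R"
        using Suc.prems cl by (intro Q.R.finsum_closed) auto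
      have "x \<oplus>\<^bsub>R\<^esub> finsum R (\<lambda>i. f i (q i)) {..<Suc K} = (x \<oplus>\<^bsub>R\<^esub> finsum R (\<lambda>i. f i (q i)) {..<K}) \<oplus>\<^bsub>R\<^esub> f K (q K)"
        using x TrR fin Suc.prems cl Q.R.a_comm[OF fin, of "f K (q K)"]
        by (simp add: lessThan_Suc Pi_def subset_iff Q.R.a_assoc)
      then show ?case using step[of _ "f K" "q K"] Suc fq by simp
    qed
    then show "x \<oplus>\<^bsub>reg_rmodule R\<^esub> y \<in> Tr" using r by simp
  next
    fix x s assume x: "x \<in> Tr" and s: "s \<in> carrier R"
    obtain L f q where fq: "\<forall>i<(L::nat). f i \<in> rmod_hom R Q (reg_rmodule R) \<and> q i \<in> carrier Q"
      and r: "x = finsum R (\<lambda>i. f i (q i)) {..<L}" using x unfolding Tr_def by blast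
    have cl: "f i (q i) \<in> carrier R" "f i (q i \<cdot>\<^bsub>Q\<^esub> s) = f i (q i) \<otimes>\<^bsub>R\<^esub> s" if "i < L" for i
      using fq that s rmod_homD(2,4)[of "f i" R Q "reg_rmodule R" "q i"] by simp_all
    have "x \<otimes>\<^bsub>R\<^esub> s = finsum R (\<lambda>i. f i (q i) \<otimes>\<^bsub>R\<^esub> s) {..<L}"
      unfolding r by (rule Q.R.finsum_ldistr) (use cl s in auto)
    also have "\<dots> = finsum R (\<lambda>i. f i (q i \<cdot>\<^bsub>Q\<^esub> s)) {..<L}"
      using cl s by (intro Q.R.finsum_cong') auto
    finally have "x \<otimes>\<^bsub>R\<^esub> s \<in> Tr" unfolding Tr_def using fq s
      by (intro CollectI exI[of _ L] exI[of _ f] exI[of _ "\<lambda>i. q i \<cdot>\<^bsub>Q\<^esub> s"]) auto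
    then show "x \<cdot>\<^bsub>reg_rmodule R\<^esub> s \<in> Tr" by simp
  qed
  show "g x \<in> Tr" if "g \<in> rmod_hom R Q (reg_rmodule R)" "x \<in> carrier Q"
    using step[OF zero that] rmod_homD(2)[OF that] by simp
qed

text \<open>\<open>Q\<close> corresponds to the regular module of \<open>S\<close>. Its
  endomorphisms are those of \<open>S\<close>, and it generates because the regular module does:
  elements of a module over \<open>S\<close> are detected by maps from \<open>S\<close>.\<close>

lemma morita_equivalent_comm_end_generator:
  fixes R :: "('a, 'c) ring_scheme" and S :: "('b, 'd) ring_scheme"
  assumes R: "ring R" and S: "domain S" and eq: "morita_equivalent TYPE('u) R S"
  shows "\<exists>(Q :: ('a, 'u) rmodule) f q L. comm_end_generator R Q f q L"
proof -
  interpret R: ring R by fact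
  interpret S: domain S by fact
  have S': "ring S" by (rule S.ring_axioms)
  from eq obtain Fo :: "('a, 'u) rmodule \<Rightarrow> ('b, 'u) rmodule" and Fm
      and Go :: "('b, 'u) rmodule \<Rightarrow> ('a, 'u) rmodule" and Gm eta eps where
    F: "rmod_functor R S Fo Fm" and G: "rmod_functor S R Go Gm" and
    eta: "nat_iso_id R (\<lambda>X. Go (Fo X)) (\<lambda>X Y f. Gm (Fo X) (Fo Y) (Fm X Y f)) eta" and
    eps: "nat_iso_id S (\<lambda>X. Fo (Go X)) (\<lambda>X Y f. Fm (Go X) (Go Y) (Gm X Y f)) eps"
    unfolding morita_equivalent_def by blast
  obtain jR :: "'a \<Rightarrow> 'u" where jR: "inj_on jR (carrier R)"
    using eq unfolding morita_equivalent_def lepoll_def by blast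
  obtain jS :: "'b \<Rightarrow> 'u" where jS: "inj_on jS (carrier S)"
    using eq unfolding morita_equivalent_def lepoll_def by blast
  \<comment> \<open>The regular module of \<open>S\<close> has carrier type \<open>'b\<close>; the
    functors need a copy inside \<open>'u\<close>.\<close>
  define P where "P = image_module (reg_rmodule S) jS"
  have cS: "module_congruence S (reg_rmodule S) jS" using jS by (simp add: module_congruence_inj)
  have P: "right_module S P"
    unfolding P_def by (rule right_module_image_module[OF right_module_reg[OF S'] cS])
  note Psimps = image_module_simps[OF cS, folded P_def, simplified]
  define Q where "Q = Go P"
  have Q: "right_module R Q" unfolding Q_def by (rule rmod_functor.obj[OF G P])
  interpret Q: rmod R Q by (rule rmod.intro) fact
  have P_end: "\<exists>a\<in>carrier S. \<forall>s\<in>carrier S. k (jS s) = jS (a \<otimes>\<^bsub>S\<^esub> s)" if "k \<in> rmod_hom S P P" for k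
    using image_module_reg_end[OF S' jS] that by (simp add: P_def)
  have Gfull: "\<exists>k\<in>rmod_hom S P P. Gm P P k = e" if "e \<in> rmod_hom R Q Q" for e
    using rmod_functor_full[OF G F eps eta P P] that by (simp add: Q_def)
  have Gzero: "Gm P P (\<lambda>x\<in>carrier P. \<zero>\<^bsub>P\<^esub>) = (\<lambda>x\<in>carrier Q. \<zero>\<^bsub>Q\<^esub>)"
    unfolding Q_def by (rule rmod_functor_zero[OF G rmod_functor_full[OF G F eps eta P P] P P])
  have Gcomp: "Gm P P (compose (carrier P) l k) = compose (carrier Q) (Gm P P l) (Gm P P k)"
    if "k \<in> rmod_hom S P P" "l \<in> rmod_hom S P P" for k l
    unfolding Q_def by (rule rmod_functor.comp[OF G P P P that])
  have Gfaith: "k = l" if "k \<in> rmod_hom S P P" "l \<in> rmod_hom S P P" "Gm P P k = Gm P P l" for k l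
    using rmod_functor_faithful[OF G, where Go = Fo and Gm = Fm and eta = eps] eps P that by blast
  \<comment> \<open>By fullness both endomorphisms of \<open>Q\<close> come from left
    multiplications of the commutative ring \<open>S\<close>, and composites are preserved.\<close>
  have comm: "d (e x) = e (d x)"
    if de: "d \<in> rmod_hom R Q Q" "e \<in> rmod_hom R Q Q" and x: "x \<in> carrier Q" for d e x
  proof -
    obtain k l where kl: "k \<in> rmod_hom S P P" "Gm P P k = d" "l \<in> rmod_hom S P P" "Gm P P l = e"
      using Gfull de by meson
    obtain a b where ab: "a \<in> carrier S" "\<forall>s\<in>carrier S. k (jS s) = jS (a \<otimes>\<^bsub>S\<^esub> s)"
      "b \<in> carrier S" "\<forall>s\<in>carrier S. l (jS s) = jS (b \<otimes>\<^bsub>S\<^esub> s)"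
      using P_end kl(1,3) by meson
    have "l (k u) = k (l u)" if u: "u \<in> carrier P" for u
    proof -
      obtain s where "s \<in> carrier S" "u = jS s" using u Psimps(1) by auto
      then show ?thesis using ab S.m_lcomm[of a b s] by simp
    qed
    then have "compose (carrier P) l k = compose (carrier P) k l"
      unfolding compose_def by (rule restrict_ext)
    then have "compose (carrier Q) e d = compose (carrier Q) d e"
      using Gcomp[of k l] Gcomp[of l k] kl by simp
    then show ?thesis using x by (metis compose_eq)
  qed
  have integral: "(\<forall>x\<in>carrier Q. d x = \<zero>\<^bsub>Q\<^esub>) \<or> (\<forall>x\<in>carrier Q. e x = \<zero>\<^bsub>Q\<^esub>)"
    if de: "d \<in> rmod_hom R Q Q" "e \<in> rmod_hom R Q Q" and zero: "\<And>x. x \<in> carrier Q \<Longrightarrow> d (e x) = \<zero>\<^bsub>Q\<^esub>" for d e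
  proof -
    obtain k l where kl: "k \<in> rmod_hom S P P" "Gm P P k = d" "l \<in> rmod_hom S P P" "Gm P P l = e"
      using Gfull de by meson
    obtain a b where ab: "a \<in> carrier S" "\<forall>s\<in>carrier S. k (jS s) = jS (a \<otimes>\<^bsub>S\<^esub> s)"
      "b \<in> carrier S" "\<forall>s\<in>carrier S. l (jS s) = jS (b \<otimes>\<^bsub>S\<^esub> s)"
      using P_end kl(1,3) by meson
    have "compose (carrier Q) d e = (\<lambda>x\<in>carrier Q. \<zero>\<^bsub>Q\<^esub>)"
      using zero by (auto simp: compose_def fun_eq_iff)
    then have "Gm P P (compose (carrier P) k l) = Gm P P (\<lambda>x\<in>carrier P. \<zero>\<^bsub>P\<^esub>)"
      using Gcomp[of l k] kl Gzero by simp
    then have "compose (carrier P) k l = (\<lambda>x\<in>carrier P. \<zero>\<^bsub>P\<^esub>)"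
      by (rule Gfaith[OF rmod_hom_compose[OF P kl(3,1)] rmod_hom_zero_map[OF P P]])
    then have "k (l (jS \<one>\<^bsub>S\<^esub>)) = \<zero>\<^bsub>P\<^esub>"
      by (metis (no_types, lifting) Psimps(1) S.one_closed compose_eq image_eqI restrict_apply')
    then have "jS (a \<otimes>\<^bsub>S\<^esub> b) = jS \<zero>\<^bsub>S\<^esub>" using ab Psimps(2) by simp
    then have "a \<otimes>\<^bsub>S\<^esub> b = \<zero>\<^bsub>S\<^esub>" using inj_onD[OF jS, of "a \<otimes>\<^bsub>S\<^esub> b" "\<zero>\<^bsub>S\<^esub>"] ab(1,3) by simp
    then have "a = \<zero>\<^bsub>S\<^esub> \<or> b = \<zero>\<^bsub>S\<^esub>" using S.integral ab(1,3) by blast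
    moreover have "\<forall>x\<in>carrier Q. h x = \<zero>\<^bsub>Q\<^esub>"
      if "m \<in> rmod_hom S P P" "Gm P P m = h" "\<forall>s\<in>carrier S. m (jS s) = jS (\<zero>\<^bsub>S\<^esub> \<otimes>\<^bsub>S\<^esub> s)" for m h
    proof -
      have "m = (\<lambda>x\<in>carrier P. \<zero>\<^bsub>P\<^esub>)"
        by (rule rmod_hom_eqI[OF that(1) rmod_hom_zero_map[OF P P]]) (use that(3) in \<open>auto simp: Psimps\<close>)
      then have "h = (\<lambda>x\<in>carrier Q. \<zero>\<^bsub>Q\<^esub>)" using Gzero that(2) by simp
      then show ?thesis by simp
    qed
    ultimately show ?thesis using kl ab by blast
  qed
  \<comment> \<open>If \<open>Q\<close> were zero, identity and zero map of \<open>P\<close> would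
    have the same image under the faithful functor, so one would equal zero in
    \<open>S\<close>.\<close>
  have nonzero: "carrier Q \<noteq> {\<zero>\<^bsub>Q\<^esub>}"
  proof
    assume "carrier Q = {\<zero>\<^bsub>Q\<^esub>}"
    then have "(\<lambda>x\<in>carrier Q. x) = (\<lambda>x\<in>carrier Q. \<zero>\<^bsub>Q\<^esub>)" by auto
    then have "Gm P P (\<lambda>x\<in>carrier P. x) = Gm P P (\<lambda>x\<in>carrier P. \<zero>\<^bsub>P\<^esub>)"
      using rmod_functor.ident[OF G P] Gzero by (simp add: Q_def)
    then have "(\<lambda>x\<in>carrier P. x) = (\<lambda>x\<in>carrier P. \<zero>\<^bsub>P\<^esub>)"
      by (rule Gfaith[OF rmod_hom_id[OF P] rmod_hom_zero_map[OF P P]])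
    then have "jS \<one>\<^bsub>S\<^esub> = jS \<zero>\<^bsub>S\<^esub>"
      by (metis (no_types, lifting) Psimps(1,2) S.one_closed image_eqI restrict_apply')
    then show False using inj_onD[OF jS, of "\<one>\<^bsub>S\<^esub>" "\<zero>\<^bsub>S\<^esub>"] by simp
  qed
  define Tr where "Tr = {r. \<exists>(L::nat) f q. (\<forall>i<L. f i \<in> rmod_hom R Q (reg_rmodule R) \<and> q i \<in> carrier Q) \<and>
    r = finsum R (\<lambda>i. f i (q i)) {..<L}}"
  note Tr = trace_ideal[OF Q, folded Tr_def]
  note regR = right_module_reg[OF R]
  have "\<one>\<^bsub>R\<^esub> \<in> Tr"
  proof (rule ccontr)
    \<comment> \<open>If the trace is proper, the projection of \<open>R\<close> onto its quotient
      by \<open>Tr\<close> is nonzero, yet it kills the image of every map from \<open>Q\<close> to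
      \<open>R\<close>. Transported to \<open>S\<close>, a nonzero map would be invisible to all
      maps from the regular module, which is impossible. \<open>A\<close> and \<open>B\<close> below
      are \<open>R\<close> and the quotient, realised in \<open>'u\<close>.\<close>
    assume one: "\<one>\<^bsub>R\<^esub> \<notin> Tr"
    have cR: "module_congruence R (reg_rmodule R) jR" using jR by (simp add: module_congruence_inj)
    obtain p :: "'a \<Rightarrow> 'u" where p: "module_congruence R (reg_rmodule R) p"
      and p0: "\<And>x. x \<in> carrier R \<Longrightarrow> p x = p \<zero>\<^bsub>R\<^esub> \<longleftrightarrow> x \<in> Tr"
      using quotient_congruence[OF regR Tr(1), of jR] jR by auto
    define A where "A = image_module (reg_rmodule R) jR"
    define B where "B = image_module (reg_rmodule R) p"
    have A: "right_module R A" and B: "right_module R B"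
      unfolding A_def B_def by (rule right_module_image_module[OF regR], fact)+
    note Asimps = image_module_simps[OF cR, folded A_def, simplified]
    note Bsimps = image_module_simps[OF p, folded B_def, simplified]
    have "\<exists>g\<in>rmod_hom R A B. \<forall>x\<in>carrier (reg_rmodule R). g (jR x) = (\<lambda>x\<in>carrier (reg_rmodule R). p x) x"
      unfolding A_def
      by (rule rmod_hom_factor_image[OF regR B cR image_module_hom[OF regR p, folded B_def]])
        (use jR in \<open>auto dest: inj_onD\<close>)
    then obtain pi where pi: "pi \<in> rmod_hom R A B" "\<And>x. x \<in> carrier R \<Longrightarrow> pi (jR x) = p x" by auto
    \<comment> \<open>The identification \<open>un\<close> of the copy \<open>A\<close> with
      \<open>R\<close> itself, needed because the trace is defined by maps into
      \<open>R\<close>.\<close>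
    have "\<exists>g\<in>rmod_hom R A (reg_rmodule R). \<forall>x\<in>carrier (reg_rmodule R). g (jR x) = (\<lambda>x\<in>carrier (reg_rmodule R). x) x"
      unfolding A_def
      by (rule rmod_hom_factor_image[OF regR regR cR rmod_hom_id[OF regR]])
        (use jR in \<open>auto dest: inj_onD\<close>)
    then obtain un where un: "un \<in> rmod_hom R A (reg_rmodule R)" "\<And>x. x \<in> carrier R \<Longrightarrow> un (jR x) = x" by auto
    note zero = rmod_hom_zero_map[OF A B]
    note FA = rmod_functor.obj[OF F A] and FB = rmod_functor.obj[OF F B] and FQ = rmod_functor.obj[OF F Q]
    interpret FA: rmod S "Fo A" by (rule rmod.intro) fact
    have "pi (jR \<one>\<^bsub>R\<^esub>) \<noteq> \<zero>\<^bsub>B\<^esub>" using pi(2) p0 one Bsimps(2) by simp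
    then have "pi \<noteq> (\<lambda>x\<in>carrier A. \<zero>\<^bsub>B\<^esub>)" by (auto simp: Asimps)
    then have "Fm A B pi \<noteq> Fm A B (\<lambda>x\<in>carrier A. \<zero>\<^bsub>B\<^esub>)"
      using rmod_functor_faithful[OF F eta A B pi(1) zero] by blast
    \<comment> \<open>Faithfulness provides an element at which the images of the projection and of
      the zero map differ.\<close>
    then obtain y where y: "y \<in> carrier (Fo A)" "Fm A B pi y \<noteq> Fm A B (\<lambda>x\<in>carrier A. \<zero>\<^bsub>B\<^esub>) y"
      using rmod_hom_eqI[OF rmod_functor.mor[OF F A B pi(1)] rmod_functor.mor[OF F A B zero]] by blast
    \<comment> \<open>The regular module is free on one, so one can be sent to
      \<open>y\<close>.\<close>
    have "\<exists>g\<in>rmod_hom S P (Fo A). \<forall>s\<in>carrier (reg_rmodule S). g (jS s) = (\<lambda>s\<in>carrier S. y \<cdot>\<^bsub>Fo A\<^esub> s) s"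
      unfolding P_def
      by (rule rmod_hom_factor_image[OF right_module_reg[OF S'] FA cS FA.rmod_hom_element[OF y(1)]])
        (use jS in \<open>auto dest: inj_onD\<close>)
    then obtain g where g: "g \<in> rmod_hom S P (Fo A)" "g (jS \<one>\<^bsub>S\<^esub>) = y" using y(1) by auto
    have "eps P \<in> rmod_iso S P (Fo Q)" using eps P by (simp add: nat_iso_id_def Q_def)
    from rmod_iso_inverse[OF P this] obtain e where e: "e \<in> rmod_hom S (Fo Q) P"
      "\<And>x. x \<in> carrier P \<Longrightarrow> e (eps P x) = x" by blast
    have epsP: "eps P \<in> rmod_hom S P (Fo Q)" using eps P by (simp add: nat_iso_id_def Q_def rmod_iso_def)
    \<comment> \<open>Fullness turns the map that hits \<open>y\<close> into a map from
      \<open>Q\<close> to \<open>A\<close>, whose composite with the projection is zero.\<close>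
    obtain h where h: "h \<in> rmod_hom R Q A" "Fm Q A h = compose (carrier (Fo Q)) g e"
      using rmod_functor_full[OF F G eta eps Q A rmod_hom_compose[OF FQ e(1) g(1)]] by blast
    have "pi (h x) = \<zero>\<^bsub>B\<^esub>" if x: "x \<in> carrier Q" for x
    proof -
      have "h x \<in> jR ` carrier R" using rmod_homD(2)[OF h(1) x] by (simp add: Asimps)
      then obtain r where r: "r \<in> carrier R" "h x = jR r" by blast
      have "compose (carrier Q) un h x \<in> Tr"
        by (rule Tr(2)[OF rmod_hom_compose[OF Q h(1) un(1)] x])
      then have "r \<in> Tr" using x r un(2) by (simp add: compose_def)
      then show ?thesis using r pi(2) p0 Bsimps(2) by simp
    qed
    then have "compose (carrier Q) pi h = compose (carrier Q) (\<lambda>x\<in>carrier A. \<zero>\<^bsub>B\<^esub>) h"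
      using rmod_homD(2)[OF h(1)] by (auto simp: compose_def fun_eq_iff)
    then have *: "compose (carrier (Fo Q)) (Fm A B pi) (Fm Q A h) =
        compose (carrier (Fo Q)) (Fm A B (\<lambda>x\<in>carrier A. \<zero>\<^bsub>B\<^esub>)) (Fm Q A h)"
      using rmod_functor.comp[OF F Q A B h(1) pi(1)] rmod_functor.comp[OF F Q A B h(1) zero] by simp
    \<comment> \<open>The element of \<open>Fo Q\<close> that corresponds to one under
      \<open>eps\<close>; the image of \<open>h\<close> sends it to \<open>y\<close>, where the two
      maps were chosen to differ.\<close>
    define w where "w = eps P (jS \<one>\<^bsub>S\<^esub>)"
    have one: "jS \<one>\<^bsub>S\<^esub> \<in> carrier P" by (simp add: Psimps)
    have w: "w \<in> carrier (Fo Q)" unfolding w_def by (rule rmod_homD(2)[OF epsP one])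
    have "Fm Q A h w = y" using h(2) w e(2)[OF one] g(2) by (simp add: compose_def w_def)
    then show False using fun_cong[OF *, of w] w y(2) by (simp add: compose_def)
  qed
  then obtain L f q where "\<forall>i<(L::nat). f i \<in> rmod_hom R Q (reg_rmodule R) \<and> q i \<in> carrier Q"
    "finsum R (\<lambda>i. f i (q i)) {..<L} = \<one>\<^bsub>R\<^esub>" unfolding Tr_def by auto
  then have "comm_end_generator R Q f q L"
    using comm integral nonzero by unfold_locales auto
  then show ?thesis by blast
qed

section \<open>The centre as a ring of scalars\<close>

definition ring_center :: "('a, 'c) ring_scheme \<Rightarrow> 'a set" where
  "ring_center R = {z \<in> carrier R. \<forall>r\<in>carrier R. z \<otimes>\<^bsub>R\<^esub> r = r \<otimes>\<^bsub>R\<^esub> z}"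

text \<open>Central denominators commute with all scalars of \<open>R\<close>, so this is a
  submodule over the noncommutative ring once the centre is a domain.\<close>

definition center_torsion :: "('a, 'c) ring_scheme \<Rightarrow> ('a, 'b) rmodule \<Rightarrow> 'b set" where
  "center_torsion R M = {x \<in> carrier M. \<exists>z\<in>ring_center R. z \<noteq> \<zero>\<^bsub>R\<^esub> \<and> x \<cdot>\<^bsub>M\<^esub> z = \<zero>\<^bsub>M\<^esub>}"

lemma ring_centerD:
  assumes "z \<in> ring_center R"
  shows "z \<in> carrier R" "r \<in> carrier R \<Longrightarrow> z \<otimes>\<^bsub>R\<^esub> r = r \<otimes>\<^bsub>R\<^esub> z"
  using assms by (auto simp: ring_center_def)

lemma (in ring) subcring_ring_center: "subcring (ring_center R) R"
proof (rule subcringI)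
  have zc: "z \<in> carrier R" if "z \<in> ring_center R" for z using that by (rule ring_centerD)
  show "subring (ring_center R) R"
  proof (rule subringI)
    show "\<ominus> h \<in> ring_center R" if "h \<in> ring_center R" for h
      using zc[OF that] ring_centerD(2)[OF that] by (simp add: ring_center_def l_minus r_minus)
    show "h \<otimes> k \<in> ring_center R" if hk: "h \<in> ring_center R" "k \<in> ring_center R" for h k
    proof -
      have "(h \<otimes> k) \<otimes> r = r \<otimes> (h \<otimes> k)" if r: "r \<in> carrier R" for r
      proof -
        have "(h \<otimes> k) \<otimes> r = h \<otimes> (r \<otimes> k)"
          using zc[OF hk(1)] zc[OF hk(2)] ring_centerD(2)[OF hk(2) r] r by (simp add: m_assoc)
        also have "\<dots> = (r \<otimes> h) \<otimes> k"
          using zc[OF hk(1)] zc[OF hk(2)] ring_centerD(2)[OF hk(1) r] r by (simp add: m_assoc[symmetric])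
        finally show ?thesis using zc[OF hk(1)] zc[OF hk(2)] r by (simp add: m_assoc)
      qed
      then show ?thesis using zc[OF hk(1)] zc[OF hk(2)] by (simp add: ring_center_def)
    qed
    show "h \<oplus> k \<in> ring_center R" if hk: "h \<in> ring_center R" "k \<in> ring_center R" for h k
      using zc[OF hk(1)] zc[OF hk(2)] ring_centerD(2)[OF hk(1)] ring_centerD(2)[OF hk(2)]
      by (simp add: ring_center_def l_distr r_distr)
    show "ring_center R \<subseteq> carrier R" using zc by blast
    show "\<one> \<in> ring_center R" by (simp add: ring_center_def)
  qed
  show "h \<otimes> k = k \<otimes> h" if "h \<in> ring_center R" "k \<in> ring_center R" for h k
    using ring_centerD(2)[OF that(1) zc[OF that(2)]] .
qed

lemma (in rmod) rmod_hom_center_scaling: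
  assumes z: "z \<in> ring_center R"
  shows "(\<lambda>x\<in>carrier M. x \<cdot>\<^bsub>M\<^esub> z) \<in> rmod_hom R M M"
  using ring_centerD[OF z]
  by (intro rmod_homI) (auto simp: rsmult_l_distr rsmult_assoc[symmetric])

lemma (in rmod) right_module_center: "right_module (R\<lparr>carrier := ring_center R\<rparr>) M"
proof (rule right_moduleI)
  have "subring (ring_center R) R"
    using R.subcring_ring_center by (simp add: subcring_def)
  then show "ring (R\<lparr>carrier := ring_center R\<rparr>)"
    by (rule R.subring_is_ring)
  show "abelian_group M" by unfold_locales
qed (simp_all add: ring_centerD(1) rsmult_r_distr rsmult_l_distr rsmult_assoc)

context comm_end_generator
begin

section \<open>Consequences of the trace identity\<close>

lemma f_closed [simp]: "\<lbrakk>l < L; x \<in> carrier Q\<rbrakk> \<Longrightarrow> f l x \<in> carrier R"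
  using rmod_homD(2)[OF f_hom, of l x] by simp

lemma f_rsmult: "\<lbrakk>l < L; x \<in> carrier Q; r \<in> carrier R\<rbrakk> \<Longrightarrow> f l (x \<cdot>\<^bsub>Q\<^esub> r) = f l x \<otimes>\<^bsub>R\<^esub> r"
  using rmod_homD(4)[OF f_hom, of l x r] by simp

lemma trace_expansion:
  fixes M :: "('a, 'm) rmodule"
  assumes "right_module R M" "m \<in> carrier M"
  shows "finsum M (\<lambda>l. m \<cdot>\<^bsub>M\<^esub> f l (q l)) {..<L} = m"
proof -
  interpret M: rmod R M by (rule rmod.intro) fact
  have "finsum M (\<lambda>l. m \<cdot>\<^bsub>M\<^esub> f l (q l)) {..<L} = m \<cdot>\<^bsub>M\<^esub> finsum R (\<lambda>l. f l (q l)) {..<L}"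
    using assms(2) by (intro M.rsmult_finsum[symmetric]) (auto simp: q_closed)
  then show ?thesis using assms(2) trace_one by simp
qed

text \<open>By the trace identity \<open>m\<close> is the sum of its multiples by
  \<open>f l (q l)\<close>. This is the test for zero used below: it introduces factors
  \<open>f l x\<close>, which convert into central scalars.\<close>

lemma annihilates_traces_imp_zero:
  fixes M :: "('a, 'm) rmodule"
  assumes "right_module R M" "m \<in> carrier M"
    and "\<And>l x. \<lbrakk>l < L; x \<in> carrier Q\<rbrakk> \<Longrightarrow> m \<cdot>\<^bsub>M\<^esub> f l x = \<zero>\<^bsub>M\<^esub>"
  shows "m = \<zero>\<^bsub>M\<^esub>"
proof -
  interpret M: rmod R M by (rule rmod.intro) fact
  have "finsum M (\<lambda>l. m \<cdot>\<^bsub>M\<^esub> f l (q l)) {..<L} = finsum M (\<lambda>l. \<zero>\<^bsub>M\<^esub>) {..<L}"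
    using assms(3) by (intro M.M.finsum_cong') (auto simp: q_closed)
  then show ?thesis using trace_expansion[OF assms(1,2)] by simp
qed

text \<open>Since \<open>f l\<close> is linear, \<open>f l (q l)\<close> times \<open>r\<close> is
  the value of \<open>f l\<close> at \<open>q l\<close> times \<open>r\<close>, which is zero;
  summing over \<open>l\<close> gives \<open>r\<close>.\<close>

lemma Q_faithful:
  assumes r: "r \<in> carrier R" and zero: "\<And>x. x \<in> carrier Q \<Longrightarrow> x \<cdot>\<^bsub>Q\<^esub> r = \<zero>\<^bsub>Q\<^esub>"
  shows "r = \<zero>\<^bsub>R\<^esub>"
proof -
  have "f l (q l) \<otimes>\<^bsub>R\<^esub> r = \<zero>\<^bsub>R\<^esub>" if "l < L" for l
    using f_rsmult[OF that q_closed[OF that] r] zero[OF q_closed[OF that]]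
      rmod_hom_zero[OF right_module_axioms right_module_reg[OF R.ring_axioms] f_hom[OF that]] by simp
  then have "finsum R (\<lambda>l. f l (q l) \<otimes>\<^bsub>R\<^esub> r) {..<L} = finsum R (\<lambda>l. \<zero>\<^bsub>R\<^esub>) {..<L}"
    by (intro R.finsum_cong') auto
  moreover have "finsum R (\<lambda>l. f l (q l)) {..<L} \<otimes>\<^bsub>R\<^esub> r = finsum R (\<lambda>l. f l (q l) \<otimes>\<^bsub>R\<^esub> r) {..<L}"
    using r by (intro R.finsum_ldistr) (auto simp: q_closed)
  ultimately show ?thesis using trace_one r by simp
qed

text \<open>For fixed \<open>x\<close>, the map from \<open>y\<close> to \<open>x\<close> times
  \<open>f l y\<close> is an endomorphism, hence commutes with \<open>e\<close>. Evaluated at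
  \<open>q l\<close> and summed over \<open>l\<close>, this shows that \<open>e x\<close> is
  \<open>x\<close> times the scalar \<open>z\<close> below. Linearity of \<open>e\<close> makes
  \<open>z\<close> commute with every \<open>r\<close> in its action on \<open>Q\<close>, and
  \<open>Q\<close> is faithful.\<close>

lemma endomorphism_eq_center_scaling:
  assumes e: "e \<in> rmod_hom R Q Q"
  shows "\<exists>z\<in>ring_center R. \<forall>x\<in>carrier Q. e x = x \<cdot>\<^bsub>Q\<^esub> z"
proof -
  define z where "z = finsum R (\<lambda>l. f l (e (q l))) {..<L}"
  have eq: "e (q l) \<in> carrier Q" if "l < L" for l using rmod_homD(2)[OF e q_closed[OF that]] .
  have zR: "z \<in> carrier R" unfolding z_def using eq by (intro R.finsum_closed) auto
  have ez: "e x = x \<cdot>\<^bsub>Q\<^esub> z" if x: "x \<in> carrier Q" for x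
  proof -
    have k: "(\<lambda>y\<in>carrier Q. x \<cdot>\<^bsub>Q\<^esub> f l y) \<in> rmod_hom R Q Q" if "l < L" for l
      by (rule rmod_hom_element_comp[OF x f_hom[OF that] right_module_axioms])
    have "x \<cdot>\<^bsub>Q\<^esub> z = finsum Q (\<lambda>l. x \<cdot>\<^bsub>Q\<^esub> f l (e (q l))) {..<L}"
      unfolding z_def using eq x by (intro rsmult_finsum) auto
    also have "\<dots> = finsum Q (\<lambda>l. e (x \<cdot>\<^bsub>Q\<^esub> f l (q l))) {..<L}"
      using end_comm[OF k e] q_closed eq x rmod_homD(2)[OF e] by (intro M.finsum_cong') auto
    also have "\<dots> = e (finsum Q (\<lambda>l. x \<cdot>\<^bsub>Q\<^esub> f l (q l)) {..<L})"
      by (rule rmod_hom_finsum[OF right_module_axioms right_module_axioms e, symmetric])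
        (auto simp: x q_closed)
    finally show ?thesis using trace_expansion[OF right_module_axioms x] by simp
  qed
  have "z \<otimes>\<^bsub>R\<^esub> r = r \<otimes>\<^bsub>R\<^esub> z" if r: "r \<in> carrier R" for r
  proof -
    have "(z \<otimes>\<^bsub>R\<^esub> r) \<ominus>\<^bsub>R\<^esub> (r \<otimes>\<^bsub>R\<^esub> z) = \<zero>\<^bsub>R\<^esub>"
    proof (rule Q_faithful)
      fix x assume x: "x \<in> carrier Q"
      have "x \<cdot>\<^bsub>Q\<^esub> (z \<otimes>\<^bsub>R\<^esub> r) = x \<cdot>\<^bsub>Q\<^esub> (r \<otimes>\<^bsub>R\<^esub> z)"
        using rmod_homD(4)[OF e x r] ez[OF x] ez[of "x \<cdot>\<^bsub>Q\<^esub> r"] x r zR by (simp add: rsmult_assoc)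
      then show "x \<cdot>\<^bsub>Q\<^esub> ((z \<otimes>\<^bsub>R\<^esub> r) \<ominus>\<^bsub>R\<^esub> (r \<otimes>\<^bsub>R\<^esub> z)) = \<zero>\<^bsub>Q\<^esub>"
        using x r zR by (simp add: R.minus_eq rsmult_r_distr rsmult_minus_right M.r_neg)
    qed (use r zR in auto)
    then show ?thesis using r zR by (metis R.r_right_minus_eq R.m_closed)
  qed
  then show ?thesis using zR ez by (auto simp: ring_center_def)
qed

text \<open>Central scalings are endomorphisms of \<open>Q\<close>; if the product of two vanishes,
  so does one of them, and \<open>Q\<close> is faithful.\<close>

lemma center_integral:
  assumes z: "z \<in> ring_center R" and w: "w \<in> ring_center R" and zw: "z \<otimes>\<^bsub>R\<^esub> w = \<zero>\<^bsub>R\<^esub>"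
  shows "z = \<zero>\<^bsub>R\<^esub> \<or> w = \<zero>\<^bsub>R\<^esub>"
proof -
  note zR = ring_centerD(1)[OF z] and wR = ring_centerD(1)[OF w]
  have "(\<forall>x\<in>carrier Q. (\<lambda>x\<in>carrier Q. x \<cdot>\<^bsub>Q\<^esub> w) x = \<zero>\<^bsub>Q\<^esub>) \<or>
      (\<forall>x\<in>carrier Q. (\<lambda>x\<in>carrier Q. x \<cdot>\<^bsub>Q\<^esub> z) x = \<zero>\<^bsub>Q\<^esub>)"
    by (rule end_integral[OF rmod_hom_center_scaling[OF w] rmod_hom_center_scaling[OF z]])
      (use zR wR zw in \<open>simp add: rsmult_assoc[symmetric]\<close>)
  then show ?thesis using Q_faithful[OF zR] Q_faithful[OF wR] by auto
qed

lemma one_neq_zero: "\<one>\<^bsub>R\<^esub> \<noteq> \<zero>\<^bsub>R\<^esub>"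
proof
  assume eq: "\<one>\<^bsub>R\<^esub> = \<zero>\<^bsub>R\<^esub>"
  have "x = \<zero>\<^bsub>Q\<^esub>" if "x \<in> carrier Q" for x
    using rsmult_one[OF that] rsmult_zero_right[OF that] by (simp add: eq)
  then show False using Q_nonzero M.zero_closed by blast
qed

lemma domain_center: "domain (R\<lparr>carrier := ring_center R\<rparr>)"
proof -
  have "subdomain (ring_center R) R"
    by (rule R.subdomainI[OF R.subcring_ring_center]) (use one_neq_zero center_integral in auto)
  then show ?thesis by (rule R.subdomain_is_domain)
qed

lemma center_mult_nonzero:
  assumes "z \<in> ring_center R" "w \<in> ring_center R" "z \<noteq> \<zero>\<^bsub>R\<^esub>" "w \<noteq> \<zero>\<^bsub>R\<^esub>"
  shows "z \<otimes>\<^bsub>R\<^esub> w \<in> ring_center R" "z \<otimes>\<^bsub>R\<^esub> w \<noteq> \<zero>\<^bsub>R\<^esub>"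
  using assms center_integral[of z w] R.subcring_ring_center subcringE(6)[of "ring_center R" R] by auto

text \<open>The conversion from elements of \<open>Q\<close> to central scalars: \<open>w\<close>
  depends on \<open>x\<close> and \<open>l\<close>, but not on \<open>y\<close>.\<close>

lemma trace_scaling:
  assumes x: "x \<in> carrier Q" and l: "l < L"
  shows "\<exists>w\<in>ring_center R. \<forall>y\<in>carrier Q. x \<cdot>\<^bsub>Q\<^esub> f l y = y \<cdot>\<^bsub>Q\<^esub> w"
  using endomorphism_eq_center_scaling[OF rmod_hom_element_comp[OF x f_hom[OF l] right_module_axioms]]
  by auto

lemma trace_scaling_nonzero:
  assumes x: "x \<in> carrier Q" "x \<noteq> \<zero>\<^bsub>Q\<^esub>"
  shows "\<exists>l<L. \<exists>w\<in>ring_center R. w \<noteq> \<zero>\<^bsub>R\<^esub> \<and> (\<forall>y\<in>carrier Q. x \<cdot>\<^bsub>Q\<^esub> f l y = y \<cdot>\<^bsub>Q\<^esub> w)"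
proof -
  obtain l y where l: "l < L" and y: "y \<in> carrier Q" "x \<cdot>\<^bsub>Q\<^esub> f l y \<noteq> \<zero>\<^bsub>Q\<^esub>"
    using annihilates_traces_imp_zero[OF right_module_axioms x(1)] x(2) by blast
  obtain w where w: "w \<in> ring_center R" "\<forall>y\<in>carrier Q. x \<cdot>\<^bsub>Q\<^esub> f l y = y \<cdot>\<^bsub>Q\<^esub> w"
    using trace_scaling[OF x(1) l] by blast
  then have "w \<noteq> \<zero>\<^bsub>R\<^esub>" using y by auto
  then show ?thesis using w l by blast
qed

section \<open>Torsion with respect to the centre\<close>

lemma rsmult_center_swap:
  fixes M :: "('a, 'm) rmodule"
  assumes "right_module R M" "m \<in> carrier M" "z \<in> ring_center R" "r \<in> carrier R"
  shows "(m \<cdot>\<^bsub>M\<^esub> r) \<cdot>\<^bsub>M\<^esub> z = (m \<cdot>\<^bsub>M\<^esub> z) \<cdot>\<^bsub>M\<^esub> r"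
proof -
  interpret M: rmod R M by (rule rmod.intro) fact
  show ?thesis
    using assms(2,4) ring_centerD[OF assms(3)] by (simp add: M.rsmult_assoc[symmetric])
qed

text \<open>If \<open>z\<close> kills a nonzero \<open>x\<close> with scalar \<open>w\<close>, then
  \<open>y\<close> times \<open>w\<close> times \<open>z\<close> is \<open>x\<close> times
  \<open>f l y\<close> times \<open>z\<close>, which is zero for all \<open>y\<close>. So the
  product of \<open>w\<close> and \<open>z\<close> is zero, although both factors are not.\<close>

lemma Q_torsion_free: "center_torsion R Q = {\<zero>\<^bsub>Q\<^esub>}"
proof -
  have "x = \<zero>\<^bsub>Q\<^esub>" if x: "x \<in> carrier Q" and z: "z \<in> ring_center R" "z \<noteq> \<zero>\<^bsub>R\<^esub>" "x \<cdot>\<^bsub>Q\<^esub> z = \<zero>\<^bsub>Q\<^esub>" for x z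
  proof (rule ccontr)
    assume "x \<noteq> \<zero>\<^bsub>Q\<^esub>"
    then obtain l w where l: "l < L" and w: "w \<in> ring_center R" "w \<noteq> \<zero>\<^bsub>R\<^esub>"
      "\<forall>y\<in>carrier Q. x \<cdot>\<^bsub>Q\<^esub> f l y = y \<cdot>\<^bsub>Q\<^esub> w" using trace_scaling_nonzero[OF x] by blast
    have "y \<cdot>\<^bsub>Q\<^esub> (w \<otimes>\<^bsub>R\<^esub> z) = \<zero>\<^bsub>Q\<^esub>" if y: "y \<in> carrier Q" for y
    proof -
      have "y \<cdot>\<^bsub>Q\<^esub> (w \<otimes>\<^bsub>R\<^esub> z) = (x \<cdot>\<^bsub>Q\<^esub> f l y) \<cdot>\<^bsub>Q\<^esub> z"
        using w(3) y ring_centerD(1)[OF w(1)] ring_centerD(1)[OF z(1)] by (simp add: rsmult_assoc)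
      then show ?thesis
        using rsmult_center_swap[OF right_module_axioms x z(1) f_closed[OF l y]] z(3) l y by simp
    qed
    then show False
      using Q_faithful[of "w \<otimes>\<^bsub>R\<^esub> z"] center_mult_nonzero[OF w(1) z(1) w(2) z(2)]
        ring_centerD(1)[of "w \<otimes>\<^bsub>R\<^esub> z" R]
      by auto
  qed
  moreover have "\<one>\<^bsub>R\<^esub> \<in> ring_center R" by (simp add: ring_center_def)
  ultimately show ?thesis using one_neq_zero by (auto simp: center_torsion_def)
qed

lemma torsion_freeD:
  fixes M :: "('a, 'm) rmodule"
  assumes "center_torsion R M = {\<zero>\<^bsub>M\<^esub>}" "m \<in> carrier M" "z \<in> ring_center R" "z \<noteq> \<zero>\<^bsub>R\<^esub>" "m \<cdot>\<^bsub>M\<^esub> z = \<zero>\<^bsub>M\<^esub>"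
  shows "m = \<zero>\<^bsub>M\<^esub>"
  using assms by (auto simp: center_torsion_def)

text \<open>Every \<open>x\<close> in \<open>Q\<close> gives a torsion element \<open>x\<close>
  times \<open>r\<close> of \<open>Q\<close>, which is zero; faithfulness finishes.\<close>

lemma reg_torsion_free: 
  assumes r: "r \<in> carrier R" and z: "z \<in> ring_center R" "z \<noteq> \<zero>\<^bsub>R\<^esub>" "r \<otimes>\<^bsub>R\<^esub> z = \<zero>\<^bsub>R\<^esub>"
  shows "r = \<zero>\<^bsub>R\<^esub>"
proof (rule Q_faithful[OF r])
  fix x assume x: "x \<in> carrier Q"
  show "x \<cdot>\<^bsub>Q\<^esub> r = \<zero>\<^bsub>Q\<^esub>"
    by (rule torsion_freeD[OF Q_torsion_free _ z(1,2)])
      (use x r z(3) ring_centerD(1)[OF z(1)] in \<open>simp_all add: rsmult_assoc[symmetric]\<close>)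
qed

lemma rsubmodule_center_torsion:
  fixes M :: "('a, 'm) rmodule"
  assumes "right_module R M"
  shows "rsubmodule R M (center_torsion R M)"
proof -
  interpret M: rmod R M by (rule rmod.intro) fact
  show ?thesis
  proof (rule M.rsubmoduleI)
    show "center_torsion R M \<subseteq> carrier M" by (auto simp: center_torsion_def)
    have "\<one>\<^bsub>R\<^esub> \<in> ring_center R" by (simp add: ring_center_def)
    then show "\<zero>\<^bsub>M\<^esub> \<in> center_torsion R M" using one_neq_zero by (auto simp: center_torsion_def)
  next
    fix x y assume "x \<in> center_torsion R M" "y \<in> center_torsion R M"
    then obtain z w where z: "x \<in> carrier M" "z \<in> ring_center R" "z \<noteq> \<zero>\<^bsub>R\<^esub>" "x \<cdot>\<^bsub>M\<^esub> z = \<zero>\<^bsub>M\<^esub>"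
      and w: "y \<in> carrier M" "w \<in> ring_center R" "w \<noteq> \<zero>\<^bsub>R\<^esub>" "y \<cdot>\<^bsub>M\<^esub> w = \<zero>\<^bsub>M\<^esub>"
      by (auto simp: center_torsion_def)
    note zR = ring_centerD(1)[OF z(2)] and wR = ring_centerD(1)[OF w(2)]
    have "y \<cdot>\<^bsub>M\<^esub> (z \<otimes>\<^bsub>R\<^esub> w) = \<zero>\<^bsub>M\<^esub>"
      using rsmult_center_swap[OF assms w(1,2) zR] w(1,4) zR wR by (simp add: M.rsmult_assoc)
    then have "(x \<oplus>\<^bsub>M\<^esub> y) \<cdot>\<^bsub>M\<^esub> (z \<otimes>\<^bsub>R\<^esub> w) = \<zero>\<^bsub>M\<^esub>"
      using z(1,4) w(1) zR wR by (simp add: M.rsmult_l_distr M.rsmult_assoc)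
    then show "x \<oplus>\<^bsub>M\<^esub> y \<in> center_torsion R M"
      using center_mult_nonzero[OF z(2) w(2) z(3) w(3)] z(1) w(1) by (auto simp: center_torsion_def)
  next
    fix x r assume "x \<in> center_torsion R M" and r: "r \<in> carrier R"
    then obtain z where z: "x \<in> carrier M" "z \<in> ring_center R" "z \<noteq> \<zero>\<^bsub>R\<^esub>" "x \<cdot>\<^bsub>M\<^esub> z = \<zero>\<^bsub>M\<^esub>"
      by (auto simp: center_torsion_def)
    then have "(x \<cdot>\<^bsub>M\<^esub> r) \<cdot>\<^bsub>M\<^esub> z = \<zero>\<^bsub>M\<^esub>" using rsmult_center_swap[OF assms z(1,2) r] r by simp
    then show "x \<cdot>\<^bsub>M\<^esub> r \<in> center_torsion R M" using z r by (auto simp: center_torsion_def)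
  qed
qed

lemma center_torsionI:
  fixes M :: "('a, 'm) rmodule"
  assumes "right_module R M" "m \<in> carrier M" "z \<in> ring_center R" "z \<noteq> \<zero>\<^bsub>R\<^esub>" "m \<cdot>\<^bsub>M\<^esub> z \<in> center_torsion R M"
  shows "m \<in> center_torsion R M"
proof -
  interpret M: rmod R M by (rule rmod.intro) fact
  obtain w where w: "w \<in> ring_center R" "w \<noteq> \<zero>\<^bsub>R\<^esub>" "(m \<cdot>\<^bsub>M\<^esub> z) \<cdot>\<^bsub>M\<^esub> w = \<zero>\<^bsub>M\<^esub>"
    using assms(5) by (auto simp: center_torsion_def)
  then have "m \<cdot>\<^bsub>M\<^esub> (z \<otimes>\<^bsub>R\<^esub> w) = \<zero>\<^bsub>M\<^esub>"
    using assms(2) ring_centerD(1)[OF assms(3)] ring_centerD(1)[OF w(1)] by (simp add: M.rsmult_assoc)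
  then show ?thesis
    using center_mult_nonzero[OF assms(3) w(1) assms(4) w(2)] assms(2) by (auto simp: center_torsion_def)
qed

text \<open>If the central \<open>z\<close> kills \<open>x\<close>, it moves any nonzero element
  \<open>a\<close> of a right ideal into the annihilator of \<open>x\<close>: the product of
  \<open>a\<close> and \<open>z\<close> stays in the ideal and is nonzero because \<open>R\<close>
  is torsion-free.\<close>

lemma center_torsion_imp_torsion:
  fixes M :: "('a, 'm) rmodule"
  assumes "right_module R M" "center_torsion R M = carrier M"
  shows "torsion_rmodule R M"
  unfolding torsion_rmodule_def essential_submodule_def
proof (intro ballI conjI allI impI)
  interpret M: rmod R M by (rule rmod.intro) fact
  interpret reg: rmod R "reg_rmodule R" by (rule rmod.intro[OF right_module_reg[OF R.ring_axioms]])
  fix x assume x: "x \<in> carrier M"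
  have "right_ann R M x = rmod_ker (reg_rmodule R) M (\<lambda>r\<in>carrier R. x \<cdot>\<^bsub>M\<^esub> r)"
    by (auto simp: right_ann_def rmod_ker_def)
  then show "right_ideal R (right_ann R M x)"
    using rsubmodule_ker[OF reg.right_module_axioms assms(1) M.rmod_hom_element[OF x]] by simp
  fix A assume A: "right_ideal R A \<and> A \<noteq> {\<zero>\<^bsub>reg_rmodule R\<^esub>}"
  then obtain a where a: "a \<in> A" "a \<noteq> \<zero>\<^bsub>R\<^esub>" using rsubmoduleD(2)[of R "reg_rmodule R" A] by auto
  then have aR: "a \<in> carrier R" using rsubmoduleD(1)[of R "reg_rmodule R" A] A by auto
  obtain z where z: "z \<in> ring_center R" "z \<noteq> \<zero>\<^bsub>R\<^esub>" "x \<cdot>\<^bsub>M\<^esub> z = \<zero>\<^bsub>M\<^esub>"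
    using x assms(2) by (auto simp: center_torsion_def)
  note zR = ring_centerD(1)[OF z(1)]
  have "a \<otimes>\<^bsub>R\<^esub> z \<in> A" using A a rsubmoduleD(4)[of R "reg_rmodule R" A a z] zR by simp
  moreover have "a \<otimes>\<^bsub>R\<^esub> z \<in> right_ann R M x"
    using rsmult_center_swap[OF assms(1) x z(1) aR] z(3) aR zR x by (simp add: right_ann_def M.rsmult_assoc)
  moreover have "a \<otimes>\<^bsub>R\<^esub> z \<noteq> \<zero>\<^bsub>R\<^esub>" using reg_torsion_free[OF aR z(1,2)] a(2) by blast
  ultimately show "right_ann R M x \<inter> A \<noteq> {\<zero>\<^bsub>reg_rmodule R\<^esub>}" by auto
qed

text \<open>\<open>Q\<close> behaves like a module of rank one. For a nonzero \<open>x\<close> in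
  the kernel, \<open>y\<close> times a nonzero central \<open>w\<close> is \<open>x\<close> times
  \<open>f l y\<close>, so \<open>h y\<close> would be torsion.\<close>

lemma hom_to_torsion_free_inj:
  fixes M :: "('a, 'm) rmodule"
  assumes M: "right_module R M" and tf: "center_torsion R M = {\<zero>\<^bsub>M\<^esub>}"
    and h: "h \<in> rmod_hom R Q M" and nz: "y \<in> carrier Q" "h y \<noteq> \<zero>\<^bsub>M\<^esub>"
    and x: "x \<in> carrier Q" "h x = \<zero>\<^bsub>M\<^esub>"
  shows "x = \<zero>\<^bsub>Q\<^esub>"
proof (rule ccontr)
  interpret M: rmod R M by (rule rmod.intro) fact
  assume "x \<noteq> \<zero>\<^bsub>Q\<^esub>"
  then obtain l w where l: "l < L" and w: "w \<in> ring_center R" "w \<noteq> \<zero>\<^bsub>R\<^esub>"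
    "\<forall>y\<in>carrier Q. x \<cdot>\<^bsub>Q\<^esub> f l y = y \<cdot>\<^bsub>Q\<^esub> w" using trace_scaling_nonzero[OF x(1)] by blast
  note wR = ring_centerD(1)[OF w(1)]
  have "h y \<cdot>\<^bsub>M\<^esub> w = h (x \<cdot>\<^bsub>Q\<^esub> f l y)" using rmod_homD(4)[OF h nz(1) wR] w(3) nz(1) by simp
  also have "\<dots> = \<zero>\<^bsub>M\<^esub>" using rmod_homD(4)[OF h x(1) f_closed[OF l nz(1)]] x(2) l nz(1) by simp
  finally show False using torsion_freeD[OF tf rmod_homD(2)[OF h nz(1)] w(1,2)] nz(2) by blast
qed

end

section \<open>Homomorphisms out of finitely generated modules\<close>

lemma (in rmod) right_module_power: "right_module R (rmod_dsum I (\<lambda>_. M))"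
proof (rule right_moduleI)
  show "abelian_group (rmod_dsum I (\<lambda>_. M))"
  proof (rule abelian_groupI, goal_cases)
    case (3 x y z)
    then show ?case
      by (auto simp: rmod_dsum_def PiE_iff M.a_assoc intro!: restrict_ext)
  next
    case (4 x y)
    have "x i \<oplus>\<^bsub>M\<^esub> y i = y i \<oplus>\<^bsub>M\<^esub> x i" if "i \<in> I" for i
      using 4 that by (intro M.a_comm) (auto simp: rmod_dsum_def)
    then show ?case by (auto simp: rmod_dsum_def fun_eq_iff restrict_def)
  next
    case (5 x)
    have "(\<lambda>i\<in>I. \<zero>\<^bsub>M\<^esub> \<oplus>\<^bsub>M\<^esub> x i) = x"
      using 5 by (intro extensionalityI[where A = I]) (auto simp: rmod_dsum_def PiE_iff)
    then show ?case by (simp add: rmod_dsum_def cong: restrict_cong)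
  next
    case (6 x)
    have "(\<lambda>i\<in>I. \<ominus>\<^bsub>M\<^esub> x i) \<in> carrier (rmod_dsum I (\<lambda>_. M))"
      using 6 by (auto simp: rmod_dsum_def)
    moreover have "\<ominus>\<^bsub>M\<^esub> x i \<oplus>\<^bsub>M\<^esub> x i = \<zero>\<^bsub>M\<^esub>" if "i \<in> I" for i
      using 6 that by (intro M.l_neg) (auto simp: rmod_dsum_def)
    then have "(\<lambda>i\<in>I. \<ominus>\<^bsub>M\<^esub> x i) \<oplus>\<^bsub>rmod_dsum I (\<lambda>_. M)\<^esub> x = \<zero>\<^bsub>rmod_dsum I (\<lambda>_. M)\<^esub>"
      by (auto simp: rmod_dsum_def fun_eq_iff restrict_def)
    ultimately show ?case by blast
  qed (auto simp: rmod_dsum_def PiE_iff)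
  show "ring R" by (rule R.ring_axioms)
  show "x \<cdot>\<^bsub>rmod_dsum I (\<lambda>_. M)\<^esub> \<one>\<^bsub>R\<^esub> = x" if x: "x \<in> carrier (rmod_dsum I (\<lambda>_. M))" for x
  proof -
    have "(\<lambda>i\<in>I. x i \<cdot>\<^bsub>M\<^esub> \<one>\<^bsub>R\<^esub>) = x"
      using x by (intro extensionalityI[where A = I]) (auto simp: rmod_dsum_def PiE_iff)
    then show ?thesis by (simp add: rmod_dsum_def)
  qed
qed (auto simp: rmod_dsum_def PiE_iff rsmult_r_distr rsmult_l_distr rsmult_assoc intro!: restrict_ext)

lemma rmod_hom_from_power:
  assumes Q: "right_module R Q" and M: "right_module R M" and I: "finite I"
    and V: "\<And>i. i \<in> I \<Longrightarrow> V i \<in> rmod_hom R Q M"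
  shows "(\<lambda>x\<in>carrier (rmod_dsum I (\<lambda>_. Q)). finsum M (\<lambda>i. V i (x i)) I)
    \<in> rmod_hom R (rmod_dsum I (\<lambda>_. Q)) M"
proof -
  interpret M: rmod R M by (rule rmod.intro) fact
  interpret Q: rmod R Q by (rule rmod.intro) fact
  interpret P: rmod R "rmod_dsum I (\<lambda>_. Q)" by (rule rmod.intro[OF Q.right_module_power])
  have mem: "x i \<in> carrier Q" "V i (x i) \<in> carrier M"
    if "x \<in> carrier (rmod_dsum I (\<lambda>_. Q))" "i \<in> I" for x i
  proof -
    show "x i \<in> carrier Q" using that by (auto simp: rmod_dsum_def)
    then show "V i (x i) \<in> carrier M" by (rule rmod_homD(2)[OF V[OF that(2)]])
  qed
  show ?thesis
  proof (rule rmod_homI)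
    show "(\<lambda>x\<in>carrier (rmod_dsum I (\<lambda>_. Q)). finsum M (\<lambda>i. V i (x i)) I)
        \<in> carrier (rmod_dsum I (\<lambda>_. Q)) \<rightarrow>\<^sub>E carrier M"
      using mem by (auto intro!: M.M.finsum_closed)
  next
    fix x y assume x: "x \<in> carrier (rmod_dsum I (\<lambda>_. Q))" and y: "y \<in> carrier (rmod_dsum I (\<lambda>_. Q))"
    have "finsum M (\<lambda>i. V i ((x \<oplus>\<^bsub>rmod_dsum I (\<lambda>_. Q)\<^esub> y) i)) I = finsum M (\<lambda>i. V i (x i) \<oplus>\<^bsub>M\<^esub> V i (y i)) I"
    proof (rule M.M.finsum_cong')
      fix i assume i: "i \<in> I"
      show "V i ((x \<oplus>\<^bsub>rmod_dsum I (\<lambda>_. Q)\<^esub> y) i) = V i (x i) \<oplus>\<^bsub>M\<^esub> V i (y i)"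
        using rmod_homD(3)[OF V[OF i] mem(1)[OF x i] mem(1)[OF y i]] i by (simp add: rmod_dsum_def)
    qed (use mem[OF x] mem[OF y] in auto)
    also have "\<dots> = finsum M (\<lambda>i. V i (x i)) I \<oplus>\<^bsub>M\<^esub> finsum M (\<lambda>i. V i (y i)) I"
      using mem[OF x] mem[OF y] by (intro M.M.finsum_addf) auto
    finally show "(\<lambda>x\<in>carrier (rmod_dsum I (\<lambda>_. Q)). finsum M (\<lambda>i. V i (x i)) I) (x \<oplus>\<^bsub>rmod_dsum I (\<lambda>_. Q)\<^esub> y) =
      (\<lambda>x\<in>carrier (rmod_dsum I (\<lambda>_. Q)). finsum M (\<lambda>i. V i (x i)) I) x \<oplus>\<^bsub>M\<^esub>
      (\<lambda>x\<in>carrier (rmod_dsum I (\<lambda>_. Q)). finsum M (\<lambda>i. V i (x i)) I) y"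
      using x y by simp
  next
    fix x r assume x: "x \<in> carrier (rmod_dsum I (\<lambda>_. Q))" and r: "r \<in> carrier R"
    have "finsum M (\<lambda>i. V i ((x \<cdot>\<^bsub>rmod_dsum I (\<lambda>_. Q)\<^esub> r) i)) I = finsum M (\<lambda>i. V i (x i) \<cdot>\<^bsub>M\<^esub> r) I"
    proof (rule M.M.finsum_cong')
      fix i assume i: "i \<in> I"
      show "V i ((x \<cdot>\<^bsub>rmod_dsum I (\<lambda>_. Q)\<^esub> r) i) = V i (x i) \<cdot>\<^bsub>M\<^esub> r"
        using rmod_homD(4)[OF V[OF i] mem(1)[OF x i] r] i by (simp add: rmod_dsum_def)
    qed (use mem[OF x] r in auto)
    also have "\<dots> = finsum M (\<lambda>i. V i (x i)) I \<cdot>\<^bsub>M\<^esub> r"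
      using mem[OF x] r I by (intro M.finsum_rsmult[symmetric]) auto
    finally show "(\<lambda>x\<in>carrier (rmod_dsum I (\<lambda>_. Q)). finsum M (\<lambda>i. V i (x i)) I) (x \<cdot>\<^bsub>rmod_dsum I (\<lambda>_. Q)\<^esub> r) =
      (\<lambda>x\<in>carrier (rmod_dsum I (\<lambda>_. Q)). finsum M (\<lambda>i. V i (x i)) I) x \<cdot>\<^bsub>M\<^esub> r"
      using x r by simp
  qed
qed

lemma rmod_hom_factor_surj:
  assumes X: "right_module R X" and M: "right_module R M" and T: "right_module R T"
    and H: "H \<in> rmod_hom R X M" "H ` carrier X = carrier M" and G: "G \<in> rmod_hom R X T"
    and ker: "\<And>x. \<lbrakk>x \<in> carrier X; H x = \<zero>\<^bsub>M\<^esub>\<rbrakk> \<Longrightarrow> G x = \<zero>\<^bsub>T\<^esub>"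
  shows "\<exists>g\<in>rmod_hom R M T. \<forall>x\<in>carrier X. g (H x) = G x"
proof -
  interpret X: rmod R X by (rule rmod.intro) fact
  interpret M: rmod R M by (rule rmod.intro) fact
  interpret T: rmod R T by (rule rmod.intro) fact
  note Hx = rmod_homD(2)[OF H(1)] and Gx = rmod_homD(2)[OF G]
  have wd: "G x = G y" if x: "x \<in> carrier X" and y: "y \<in> carrier X" and eq: "H x = H y" for x y
  proof -
    have "H (x \<oplus>\<^bsub>X\<^esub> \<ominus>\<^bsub>X\<^esub> y) = \<zero>\<^bsub>M\<^esub>"
      using rmod_homD(3)[OF H(1) x, of "\<ominus>\<^bsub>X\<^esub> y"] rmod_hom_minus[OF X M H(1) y] y eq Hx[OF y]
      by (simp add: M.M.r_neg)
    then have "G (x \<oplus>\<^bsub>X\<^esub> \<ominus>\<^bsub>X\<^esub> y) = \<zero>\<^bsub>T\<^esub>" using ker x y by simp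
    then have "G x \<oplus>\<^bsub>T\<^esub> \<ominus>\<^bsub>T\<^esub> G y = \<zero>\<^bsub>T\<^esub>"
      using rmod_homD(3)[OF G x, of "\<ominus>\<^bsub>X\<^esub> y"] rmod_hom_minus[OF X T G y] y by simp
    then show ?thesis using T.M.minus_equality[of "G x" "\<ominus>\<^bsub>T\<^esub> G y"] Gx[OF x] Gx[OF y] by simp
  qed
  define g where "g = (\<lambda>m\<in>carrier M. G (inv_into (carrier X) H m))"
  have g: "g (H x) = G x" if x: "x \<in> carrier X" for x
  proof -
    have "inv_into (carrier X) H (H x) \<in> carrier X" "H (inv_into (carrier X) H (H x)) = H x"
      using x by (simp_all add: inv_into_into f_inv_into_f)
    then have "G (inv_into (carrier X) H (H x)) = G x" by (rule wd[OF _ x])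
    then show ?thesis using Hx[OF x] by (simp add: g_def)
  qed
  have rep: "\<exists>x\<in>carrier X. m = H x" if "m \<in> carrier M" for m using that H(2) by blast
  have "g \<in> rmod_hom R M T"
  proof (rule rmod_homI)
    show "g \<in> carrier M \<rightarrow>\<^sub>E carrier T"
    proof (rule PiE_I)
      show "g m \<in> carrier T" if "m \<in> carrier M" for m using rep[OF that] g Gx by auto
    qed (simp add: g_def)
    show "g (m \<oplus>\<^bsub>M\<^esub> n) = g m \<oplus>\<^bsub>T\<^esub> g n" if mn: "m \<in> carrier M" "n \<in> carrier M" for m n
    proof -
      obtain x y where xy: "x \<in> carrier X" "m = H x" "y \<in> carrier X" "n = H y" using rep mn by meson
      then show ?thesis
        using g[of "x \<oplus>\<^bsub>X\<^esub> y"] g[of x] g[of y] rmod_homD(3)[OF H(1), of x y] rmod_homD(3)[OF G, of x y] by simp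
    qed
    show "g (m \<cdot>\<^bsub>M\<^esub> r) = g m \<cdot>\<^bsub>T\<^esub> r" if mr: "m \<in> carrier M" "r \<in> carrier R" for m r
    proof -
      obtain x where x: "x \<in> carrier X" "m = H x" using rep mr by meson
      then show ?thesis
        using g[of "x \<cdot>\<^bsub>X\<^esub> r"] g[of x] rmod_homD(4)[OF H(1), of x r] rmod_homD(4)[OF G, of x r] mr(2) by simp
    qed
  qed
  then show ?thesis using g by blast
qed

context comm_end_generator
begin

text \<open>Each generator \<open>a\<close> is the sum of \<open>a\<close> times
  \<open>f l (q l)\<close>, so it lies in the sum of the images of the maps from \<open>x\<close> to
  \<open>a\<close> times \<open>f l x\<close>. These are finitely many maps from
  \<open>Q\<close>.\<close>

lemma fin_gen_power_surj:
  fixes M :: "('a, 'm) rmodule"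
  assumes M: "right_module R M" and fg: "fin_gen R M"
  shows "\<exists>(n::nat) V. (\<forall>i<n. V i \<in> rmod_hom R Q M) \<and>
    (\<lambda>x\<in>carrier (rmod_dsum {..<n} (\<lambda>_. Q)). finsum M (\<lambda>i. V i (x i)) {..<n}) `
      carrier (rmod_dsum {..<n} (\<lambda>_. Q)) = carrier M"
proof -
  interpret M: rmod R M by (rule rmod.intro) fact
  obtain A where A: "finite A" "A \<subseteq> carrier M" "\<Inter> {N. rsubmodule R M N \<and> A \<subseteq> N} = carrier M"
    using fg by (auto simp: fin_gen_def)
  define W where "W = (\<lambda>(a, l). (\<lambda>x\<in>carrier Q. a \<cdot>\<^bsub>M\<^esub> f l x)) ` (A \<times> {..<L})"
  have "finite W" using A(1) by (simp add: W_def)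
  \<comment> \<open>The maps are numbered by an initial segment of the naturals, the index set of
    the elimination lemma.\<close>
  then obtain n and V :: "nat \<Rightarrow> _" where V: "W = V ` {i. i < n}"
    using finite_imp_nat_seg_image_inj_on by blast
  have W_hom: "W \<subseteq> rmod_hom R Q M"
    using M.rmod_hom_element_comp[OF _ f_hom right_module_axioms] A(2) by (auto simp: W_def)
  then have V_hom: "V i \<in> rmod_hom R Q M" if "i < n" for i using V that by blast
  let ?P = "rmod_dsum {..<n} (\<lambda>_. Q)"
  let ?H = "\<lambda>x\<in>carrier ?P. finsum M (\<lambda>i. V i (x i)) {..<n}"
  have H: "?H \<in> rmod_hom R ?P M"
    by (rule rmod_hom_from_power[OF right_module_axioms M]) (simp_all add: V_hom)
  interpret P: rmod R ?P by (rule rmod.intro[OF right_module_power])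
  have N: "rsubmodule R M (?H ` carrier ?P)"
    by (rule rsubmodule_image[OF right_module_power M H P.rsubmodule_carrier])
  have single: "V j y \<in> ?H ` carrier ?P" if j: "j < n" and y: "y \<in> carrier Q" for j y
  proof -
    let ?x = "\<lambda>i\<in>{..<n}. if i = j then y else \<zero>\<^bsub>Q\<^esub>"
    have x: "?x \<in> carrier ?P" using y by (auto simp: rmod_dsum_def)
    have "finsum M (\<lambda>i. V i (?x i)) {..<n} = finsum M (\<lambda>i. if j = i then V i y else \<zero>\<^bsub>M\<^esub>) {..<n}"
      using rmod_homD(2)[OF V_hom y] rmod_hom_zero[OF right_module_axioms M V_hom]
      by (intro M.M.finsum_cong') auto
    also have "\<dots> = V j y"
      using rmod_homD(2)[OF V_hom y] j by (intro M.M.finsum_singleton) auto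
    finally have "?H ?x = V j y" using x by simp
    then show ?thesis by (rule image_eqI[OF sym x])
  qed
  have "A \<subseteq> ?H ` carrier ?P"
  proof
    fix a assume a: "a \<in> A"
    have "a \<cdot>\<^bsub>M\<^esub> f l (q l) \<in> ?H ` carrier ?P" if l: "l < L" for l
    proof -
      have "(\<lambda>x\<in>carrier Q. a \<cdot>\<^bsub>M\<^esub> f l x) \<in> W" using a l by (auto simp: W_def)
      then obtain j where "j < n" "V j = (\<lambda>x\<in>carrier Q. a \<cdot>\<^bsub>M\<^esub> f l x)" using V by auto
      then show ?thesis using single[of j "q l"] q_closed[OF l] by simp
    qed
    then have "finsum M (\<lambda>l. a \<cdot>\<^bsub>M\<^esub> f l (q l)) {..<L} \<in> ?H ` carrier ?P"
      by (intro M.rsubmodule_finsum[OF N]) auto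
    moreover have "a \<in> carrier M" using a A(2) by blast
    ultimately show "a \<in> ?H ` carrier ?P" by (simp only: trace_expansion[OF M])
  qed
  then have "carrier M \<subseteq> ?H ` carrier ?P" using N A(3) by blast
  then have "?H ` carrier ?P = carrier M" using rsubmoduleD(1)[OF N] by blast
  then show ?thesis using V_hom by blast
qed

text \<open>A power of \<open>Q\<close> maps onto \<open>M\<close>. On its copy with index
  \<open>i\<close> the candidate for \<open>g\<close> sends \<open>y\<close> to \<open>t i\<close>
  times \<open>f l y\<close>. It factors through \<open>M\<close> as soon as the \<open>t i\<close>
  satisfy all relations with central coefficients between the \<open>V i\<close>, so the problem
  becomes a linear system over the centre. \<open>T\<close> has a type of its own, since it is
  instantiated both with the torsion part of \<open>M\<close> and with \<open>Q\<close>.\<close>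

lemma exists_hom_to_reduced:
  fixes M :: "('a, 'm) rmodule" and T :: "('a, 't) rmodule"
  assumes M: "right_module R M" and fg: "fin_gen R M" and nt: "center_torsion R M \<noteq> carrier M"
    and T: "right_module R T" and t0: "t0 \<in> carrier T" "t0 \<noteq> \<zero>\<^bsub>T\<^esub>"
    and reduced: "\<And>t z. \<lbrakk>t \<in> carrier T; z \<in> ring_center R; (t \<cdot>\<^bsub>T\<^esub> z) \<cdot>\<^bsub>T\<^esub> z = \<zero>\<^bsub>T\<^esub>\<rbrakk> \<Longrightarrow> t \<cdot>\<^bsub>T\<^esub> z = \<zero>\<^bsub>T\<^esub>"
  shows "\<exists>g\<in>rmod_hom R M T. (\<exists>m\<in>carrier M. g m \<noteq> \<zero>\<^bsub>T\<^esub>) \<and> (\<forall>m\<in>center_torsion R M. g m = \<zero>\<^bsub>T\<^esub>)"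
proof -
  let ?Z = "R\<lparr>carrier := ring_center R\<rparr>"
  interpret M: rmod R M by (rule rmod.intro) fact
  interpret T: rmod R T by (rule rmod.intro) fact
  interpret Z: domain ?Z by (rule domain_center)
  interpret MZ: rmod ?Z M by (rule rmod.intro[OF M.right_module_center])
  interpret TZ: rmod ?Z T by (rule rmod.intro[OF T.right_module_center])
  have zR: "z \<in> carrier R" if "z \<in> ring_center R" for z using that by (rule ring_centerD)
  have one_c: "\<one>\<^bsub>R\<^esub> \<in> ring_center R" by (simp add: ring_center_def)
  note tor = rsubmodule_center_torsion[OF M]
  obtain n :: nat and V where V: "\<And>i. i < n \<Longrightarrow> V i \<in> rmod_hom R Q M"
    and surj: "(\<lambda>x\<in>carrier (rmod_dsum {..<n} (\<lambda>_. Q)). finsum M (\<lambda>i. V i (x i)) {..<n}) `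
      carrier (rmod_dsum {..<n} (\<lambda>_. Q)) = carrier M"
    using fin_gen_power_surj[OF M fg] by blast
  let ?P = "rmod_dsum {..<n} (\<lambda>_. Q)"
  let ?H = "\<lambda>x\<in>carrier ?P. finsum M (\<lambda>i. V i (x i)) {..<n}"
  have H: "?H \<in> rmod_hom R ?P M"
    by (rule rmod_hom_from_power[OF right_module_axioms M]) (simp_all add: V)
  have Vc: "V i y \<in> carrier M" if "i < n" "y \<in> carrier Q" for i y by (rule rmod_homD(2)[OF V[OF that(1)] that(2)])
  \<comment> \<open>Relations are taken modulo torsion, which forces the resulting map to vanish on
    the torsion part. They hold uniformly in \<open>y\<close>: the combination of the maps
    \<open>V i\<close>, not of some values, is torsion-valued.\<close>
  define Rel where "Rel = {r. (\<forall>i. r i \<in> ring_center R) \<and> (\<forall>i\<ge>n. r i = \<zero>\<^bsub>R\<^esub>) \<and>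
    (\<forall>y\<in>carrier Q. finsum M (\<lambda>i. V i y \<cdot>\<^bsub>M\<^esub> r i) {..<n} \<in> center_torsion R M)}"
  have "\<exists>t. (\<forall>i<n. t i \<in> carrier T) \<and>
    (\<forall>r\<in>Rel. finsum T (\<lambda>i. t i \<cdot>\<^bsub>T\<^esub> r i) {..<n} = \<zero>\<^bsub>T\<^esub>) \<and> (\<exists>i<n. t i \<cdot>\<^bsub>T\<^esub> \<one>\<^bsub>?Z\<^esub> \<noteq> \<zero>\<^bsub>T\<^esub>)"
  proof (rule reduced_module_system_solvable[OF Z.domain_axioms TZ.right_module_axioms, of Rel n t0])
    show "t \<cdot>\<^bsub>T\<^esub> s = \<zero>\<^bsub>T\<^esub>" if "t \<in> carrier T" "s \<in> carrier ?Z" "(t \<cdot>\<^bsub>T\<^esub> s) \<cdot>\<^bsub>T\<^esub> s = \<zero>\<^bsub>T\<^esub>" for t s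
      using reduced[of t s] that by simp
    show "r i \<in> carrier ?Z" if "r \<in> Rel" for r i using that by (simp add: Rel_def)
    show "r i = \<zero>\<^bsub>?Z\<^esub>" if "r \<in> Rel" "n \<le> i" for r i using that by (simp add: Rel_def)
    show "(\<lambda>i. r i \<otimes>\<^bsub>?Z\<^esub> a \<ominus>\<^bsub>?Z\<^esub> p i \<otimes>\<^bsub>?Z\<^esub> b) \<in> Rel"
      if rp: "r \<in> Rel" "p \<in> Rel" and ab: "a \<in> carrier ?Z" "b \<in> carrier ?Z" for r p a b
    proof -
      have rZ: "r i \<in> carrier ?Z" and pZ: "p i \<in> carrier ?Z" for i using rp by (simp_all add: Rel_def)
      have cl: "r i \<otimes>\<^bsub>?Z\<^esub> a \<ominus>\<^bsub>?Z\<^esub> p i \<otimes>\<^bsub>?Z\<^esub> b \<in> carrier ?Z" for i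
        by (intro Z.minus_closed Z.m_closed rZ pZ ab)
      have supp: "r i \<otimes>\<^bsub>?Z\<^esub> a \<ominus>\<^bsub>?Z\<^esub> p i \<otimes>\<^bsub>?Z\<^esub> b = \<zero>\<^bsub>?Z\<^esub>" if "n \<le> i" for i
      proof -
        have "r i = \<zero>\<^bsub>?Z\<^esub>" "p i = \<zero>\<^bsub>?Z\<^esub>" using rp that by (simp_all add: Rel_def)
        then show ?thesis using Z.l_null[OF ab(1)] Z.l_null[OF ab(2)] Z.r_neg[OF Z.zero_closed]
          by (simp only: a_minus_def)
      qed
      have "finsum M (\<lambda>i. V i y \<cdot>\<^bsub>M\<^esub> (r i \<otimes>\<^bsub>?Z\<^esub> a \<ominus>\<^bsub>?Z\<^esub> p i \<otimes>\<^bsub>?Z\<^esub> b)) {..<n} \<in> center_torsion R M"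
        if y: "y \<in> carrier Q" for y
      proof -
        have b': "\<ominus>\<^bsub>?Z\<^esub> b \<in> carrier ?Z" using ab by (rule_tac Z.a_inv_closed)
        have "V i y \<cdot>\<^bsub>M\<^esub> (r i \<otimes>\<^bsub>?Z\<^esub> a \<ominus>\<^bsub>?Z\<^esub> p i \<otimes>\<^bsub>?Z\<^esub> b)
            = (V i y \<cdot>\<^bsub>M\<^esub> r i) \<cdot>\<^bsub>M\<^esub> a \<oplus>\<^bsub>M\<^esub> (V i y \<cdot>\<^bsub>M\<^esub> p i) \<cdot>\<^bsub>M\<^esub> (\<ominus>\<^bsub>?Z\<^esub> b)" if "i < n" for i
        proof -
          have "r i \<otimes>\<^bsub>?Z\<^esub> a \<ominus>\<^bsub>?Z\<^esub> p i \<otimes>\<^bsub>?Z\<^esub> b = r i \<otimes>\<^bsub>?Z\<^esub> a \<oplus>\<^bsub>?Z\<^esub> p i \<otimes>\<^bsub>?Z\<^esub> (\<ominus>\<^bsub>?Z\<^esub> b)"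
            using Z.r_minus[OF pZ ab(2), of i] by (simp only: a_minus_def)
          then show ?thesis
            using MZ.rsmult_r_distr[OF Vc[OF that y] Z.m_closed[OF rZ ab(1)] Z.m_closed[OF pZ b'], of i i]
              MZ.rsmult_assoc[OF Vc[OF that y] rZ ab(1), of i] MZ.rsmult_assoc[OF Vc[OF that y] pZ b', of i]
            by (simp only:)
        qed
        then have "finsum M (\<lambda>i. V i y \<cdot>\<^bsub>M\<^esub> (r i \<otimes>\<^bsub>?Z\<^esub> a \<ominus>\<^bsub>?Z\<^esub> p i \<otimes>\<^bsub>?Z\<^esub> b)) {..<n}
          = finsum M (\<lambda>i. (V i y \<cdot>\<^bsub>M\<^esub> r i) \<cdot>\<^bsub>M\<^esub> a \<oplus>\<^bsub>M\<^esub> (V i y \<cdot>\<^bsub>M\<^esub> p i) \<cdot>\<^bsub>M\<^esub> (\<ominus>\<^bsub>?Z\<^esub> b)) {..<n}"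
          using Vc[OF _ y] rZ pZ ab b' by (intro M.M.finsum_cong') (auto intro!: M.M.a_closed MZ.rsmult_closed)
        also have "\<dots> = finsum M (\<lambda>i. (V i y \<cdot>\<^bsub>M\<^esub> r i) \<cdot>\<^bsub>M\<^esub> a) {..<n} \<oplus>\<^bsub>M\<^esub>
            finsum M (\<lambda>i. (V i y \<cdot>\<^bsub>M\<^esub> p i) \<cdot>\<^bsub>M\<^esub> (\<ominus>\<^bsub>?Z\<^esub> b)) {..<n}"
          using Vc[OF _ y] rZ pZ ab b' by (intro M.M.finsum_addf) (auto intro!: MZ.rsmult_closed)
        also have "finsum M (\<lambda>i. (V i y \<cdot>\<^bsub>M\<^esub> r i) \<cdot>\<^bsub>M\<^esub> a) {..<n} = finsum M (\<lambda>i. V i y \<cdot>\<^bsub>M\<^esub> r i) {..<n} \<cdot>\<^bsub>M\<^esub> a"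
          using Vc[OF _ y] rZ ab by (intro MZ.finsum_rsmult[symmetric]) (auto intro!: MZ.rsmult_closed)
        also have "finsum M (\<lambda>i. (V i y \<cdot>\<^bsub>M\<^esub> p i) \<cdot>\<^bsub>M\<^esub> (\<ominus>\<^bsub>?Z\<^esub> b)) {..<n} = finsum M (\<lambda>i. V i y \<cdot>\<^bsub>M\<^esub> p i) {..<n} \<cdot>\<^bsub>M\<^esub> (\<ominus>\<^bsub>?Z\<^esub> b)"
          using Vc[OF _ y] pZ b' by (intro MZ.finsum_rsmult[symmetric]) (auto intro!: MZ.rsmult_closed)
        finally show ?thesis
          using rp y ab b' zR by (auto simp: Rel_def intro!: rsubmoduleD(3,4)[OF tor])
      qed
      then show ?thesis using cl supp by (simp add: Rel_def)
    qed
    show "\<exists>i<n. \<forall>a\<in>carrier ?Z. a \<noteq> \<zero>\<^bsub>?Z\<^esub> \<longrightarrow> (\<lambda>j. if j = i then a else \<zero>\<^bsub>?Z\<^esub>) \<notin> Rel"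
    proof (rule ccontr)
      have zero_eq: "\<zero>\<^bsub>?Z\<^esub> = \<zero>\<^bsub>R\<^esub>" by simp
      \<comment> \<open>If a nonzero multiple of each unit vector were a relation, every
        \<open>V i\<close> would take torsion values, because an element with a torsion multiple is
        torsion, and \<open>M\<close> would be torsion.\<close>
      assume "\<not> ?thesis"
      then have ex: "\<exists>a\<in>ring_center R. a \<noteq> \<zero>\<^bsub>R\<^esub> \<and> (\<lambda>j. if j = i then a else \<zero>\<^bsub>R\<^esub>) \<in> Rel" if "i < n" for i
        using that unfolding zero_eq by auto
      have "V i y \<in> center_torsion R M" if i: "i < n" and y: "y \<in> carrier Q" for i y
      proof -
        obtain a where a: "a \<in> ring_center R" "a \<noteq> \<zero>\<^bsub>R\<^esub>" "(\<lambda>j. if j = i then a else \<zero>\<^bsub>R\<^esub>) \<in> Rel"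
          using ex[OF i] by blast
        have "finsum M (\<lambda>j. V j y \<cdot>\<^bsub>M\<^esub> (if j = i then a else \<zero>\<^bsub>R\<^esub>)) {..<n} =
            finsum M (\<lambda>j. if i = j then V j y \<cdot>\<^bsub>M\<^esub> a else \<zero>\<^bsub>M\<^esub>) {..<n}"
          using Vc[OF _ y] zR[OF a(1)] by (intro M.M.finsum_cong') auto
        also have "\<dots> = V i y \<cdot>\<^bsub>M\<^esub> a"
          using Vc[OF _ y] zR[OF a(1)] i by (intro M.M.finsum_singleton) auto
        finally have "V i y \<cdot>\<^bsub>M\<^esub> a \<in> center_torsion R M" using a(3) y by (auto simp: Rel_def)
        then show ?thesis by (rule center_torsionI[OF M Vc[OF i y] a(1,2)])
      qed
      then have Vtor: "V i (x i) \<in> center_torsion R M" if "x \<in> carrier ?P" "i < n" for x i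
        using that by (auto simp: rmod_dsum_def)
      have "?H x \<in> center_torsion R M" if x: "x \<in> carrier ?P" for x
      proof -
        have "finsum M (\<lambda>i. V i (x i)) {..<n} \<in> center_torsion R M"
          by (rule M.rsubmodule_finsum[OF tor]) (use Vtor[OF x] in simp_all)
        then show ?thesis using x by simp
      qed
      then have "?H ` carrier ?P \<subseteq> center_torsion R M" by (rule image_subsetI)
      then have "carrier M \<subseteq> center_torsion R M" by (simp only: surj)
      then show False using nt rsubmoduleD(1)[OF tor] by blast
    qed
  qed (use t0 one_c in simp_all)
  then obtain t where t: "\<And>i. i < n \<Longrightarrow> t i \<in> carrier T"
    and t_rel: "\<And>r. r \<in> Rel \<Longrightarrow> finsum T (\<lambda>i. t i \<cdot>\<^bsub>T\<^esub> r i) {..<n} = \<zero>\<^bsub>T\<^esub>"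
    and t_nz: "\<exists>i<n. t i \<cdot>\<^bsub>T\<^esub> \<one>\<^bsub>?Z\<^esub> \<noteq> \<zero>\<^bsub>T\<^esub>" by blast
  obtain i0 where i0: "i0 < n" "t i0 \<noteq> \<zero>\<^bsub>T\<^esub>" using t_nz t by fastforce
  \<comment> \<open>The index \<open>l\<close> is chosen so that the nonzero solution remains
    nonzero after multiplication by some value of \<open>f l\<close>; it stays fixed for all
    \<open>U i\<close>.\<close>
  obtain l y0 where l: "l < L" and y0: "y0 \<in> carrier Q" "t i0 \<cdot>\<^bsub>T\<^esub> f l y0 \<noteq> \<zero>\<^bsub>T\<^esub>"
    using annihilates_traces_imp_zero[OF T t[OF i0(1)]] i0(2) by blast
  define U where "U i = (\<lambda>y\<in>carrier Q. t i \<cdot>\<^bsub>T\<^esub> f l y)" for i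
  have U: "U i \<in> rmod_hom R Q T" if "i < n" for i
    unfolding U_def by (rule T.rmod_hom_element_comp[OF t[OF that] f_hom[OF l] right_module_axioms])
  let ?G = "\<lambda>x\<in>carrier ?P. finsum T (\<lambda>i. U i (x i)) {..<n}"
  have G: "?G \<in> rmod_hom R ?P T"
    by (rule rmod_hom_from_power[OF right_module_axioms T]) (simp_all add: U)
  \<comment> \<open>Tested after multiplication by \<open>f j y\<close>. There \<open>x i\<close>
    times \<open>f j y\<close> becomes \<open>y\<close> times a central \<open>w i\<close>, and
    these \<open>w i\<close> form a relation because \<open>?H x\<close> is torsion. Pulling
    \<open>f l y\<close> out of the sum leaves the equation solved by \<open>t\<close>.\<close>
  have ker: "?G x = \<zero>\<^bsub>T\<^esub>" if x: "x \<in> carrier ?P" and Hx: "?H x \<in> center_torsion R M" for x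
  proof (rule annihilates_traces_imp_zero[OF T])
    have xQ: "x i \<in> carrier Q" if "i < n" for i using x that by (auto simp: rmod_dsum_def)
    show "?G x \<in> carrier T" by (rule rmod_homD(2)[OF G x])
    fix j y assume j: "j < L" and y: "y \<in> carrier Q"
    have "\<forall>i. \<exists>w\<in>ring_center R. (n \<le> i \<longrightarrow> w = \<zero>\<^bsub>R\<^esub>) \<and>
        (i < n \<longrightarrow> (\<forall>y\<in>carrier Q. x i \<cdot>\<^bsub>Q\<^esub> f j y = y \<cdot>\<^bsub>Q\<^esub> w))"
    proof
      fix i show "\<exists>w\<in>ring_center R. (n \<le> i \<longrightarrow> w = \<zero>\<^bsub>R\<^esub>) \<and>
        (i < n \<longrightarrow> (\<forall>y\<in>carrier Q. x i \<cdot>\<^bsub>Q\<^esub> f j y = y \<cdot>\<^bsub>Q\<^esub> w))"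
        using trace_scaling[OF xQ j, of i] Z.zero_closed by (cases "i < n") auto
    qed
    then obtain w where w: "\<And>i. w i \<in> ring_center R" "\<And>i. n \<le> i \<Longrightarrow> w i = \<zero>\<^bsub>R\<^esub>"
      "\<And>i y. \<lbrakk>i < n; y \<in> carrier Q\<rbrakk> \<Longrightarrow> x i \<cdot>\<^bsub>Q\<^esub> f j y = y \<cdot>\<^bsub>Q\<^esub> w i" by metis
    have "finsum M (\<lambda>i. V i y \<cdot>\<^bsub>M\<^esub> w i) {..<n} \<in> center_torsion R M" if y: "y \<in> carrier Q" for y
    proof -
      have "V i y \<cdot>\<^bsub>M\<^esub> w i = V i (x i) \<cdot>\<^bsub>M\<^esub> f j y" if i: "i < n" for i
        using rmod_homD(4)[OF V[OF i] y zR[OF w(1)], of i] w(3)[OF i y]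
          rmod_homD(4)[OF V[OF i] xQ[OF i] f_closed[OF j y]] by simp
      then have "finsum M (\<lambda>i. V i y \<cdot>\<^bsub>M\<^esub> w i) {..<n} = finsum M (\<lambda>i. V i (x i) \<cdot>\<^bsub>M\<^esub> f j y) {..<n}"
        using Vc xQ j y by (intro M.M.finsum_cong') auto
      also have "\<dots> = ?H x \<cdot>\<^bsub>M\<^esub> f j y"
        using x Vc xQ j y by (simp, intro M.finsum_rsmult[symmetric]) auto
      finally show ?thesis using rsubmoduleD(4)[OF tor Hx f_closed[OF j y]] by simp
    qed
    then have "w \<in> Rel" using w(1,2) by (simp add: Rel_def)
    have "?G x \<cdot>\<^bsub>T\<^esub> f j y = finsum T (\<lambda>i. U i (x i) \<cdot>\<^bsub>T\<^esub> f j y) {..<n}"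
      using x rmod_homD(2)[OF U xQ] j y by (simp, intro T.finsum_rsmult) auto
    also have "\<dots> = finsum T (\<lambda>i. (t i \<cdot>\<^bsub>T\<^esub> w i) \<cdot>\<^bsub>T\<^esub> f l y) {..<n}"
    proof (rule T.M.finsum_cong')
      fix i assume "i \<in> {..<n}"
      then have i: "i < n" by simp
      have "U i (x i) \<cdot>\<^bsub>T\<^esub> f j y = U i (y \<cdot>\<^bsub>Q\<^esub> w i)"
        using rmod_homD(4)[OF U[OF i] xQ[OF i] f_closed[OF j y]] w(3)[OF i y] by simp
      also have "\<dots> = (t i \<cdot>\<^bsub>T\<^esub> f l y) \<cdot>\<^bsub>T\<^esub> w i"
        using rmod_homD(4)[OF U[OF i] y zR[OF w(1)], of i] y by (simp add: U_def)
      also have "\<dots> = (t i \<cdot>\<^bsub>T\<^esub> w i) \<cdot>\<^bsub>T\<^esub> f l y"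
        by (rule rsmult_center_swap[OF T t[OF i] w(1) f_closed[OF l y]])
      finally show "U i (x i) \<cdot>\<^bsub>T\<^esub> f j y = (t i \<cdot>\<^bsub>T\<^esub> w i) \<cdot>\<^bsub>T\<^esub> f l y" .
    qed (use t zR[OF w(1)] l y in auto)
    also have "\<dots> = finsum T (\<lambda>i. t i \<cdot>\<^bsub>T\<^esub> w i) {..<n} \<cdot>\<^bsub>T\<^esub> f l y"
      using t zR[OF w(1)] l y by (intro T.finsum_rsmult[symmetric]) auto
    finally show "?G x \<cdot>\<^bsub>T\<^esub> f j y = \<zero>\<^bsub>T\<^esub>" using t_rel[OF \<open>w \<in> Rel\<close>] l y by simp
  qed
  have "\<exists>g\<in>rmod_hom R M T. \<forall>x\<in>carrier ?P. g (?H x) = ?G x"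
    by (rule rmod_hom_factor_surj[OF right_module_power M T H surj G ker])
      (use rsubmoduleD(2)[OF tor] in auto)
  then obtain g where g: "g \<in> rmod_hom R M T" "\<And>x. x \<in> carrier ?P \<Longrightarrow> g (?H x) = ?G x" by blast
  have "g m = \<zero>\<^bsub>T\<^esub>" if m: "m \<in> center_torsion R M" for m
  proof -
    obtain x where "x \<in> carrier ?P" "m = ?H x" using m rsubmoduleD(1)[OF tor] surj by blast
    then show ?thesis using ker[of x] g(2)[of x] m by simp
  qed
  moreover have "\<exists>m\<in>carrier M. g m \<noteq> \<zero>\<^bsub>T\<^esub>"
  proof -
    \<comment> \<open>The vector with the single entry \<open>y0\<close> at \<open>i0\<close>, on
      which the map was chosen to be nonzero.\<close>
    let ?x = "\<lambda>i\<in>{..<n}. if i = i0 then y0 else \<zero>\<^bsub>Q\<^esub>"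
    have x: "?x \<in> carrier ?P" using y0 by (auto simp: rmod_dsum_def)
    have "finsum T (\<lambda>i. U i (?x i)) {..<n} = finsum T (\<lambda>i. if i0 = i then U i y0 else \<zero>\<^bsub>T\<^esub>) {..<n}"
      using rmod_homD(2)[OF U y0(1)] rmod_hom_zero[OF right_module_axioms T U]
      by (intro T.M.finsum_cong') auto
    also have "\<dots> = U i0 y0"
      using rmod_homD(2)[OF U y0(1)] i0 by (intro T.M.finsum_singleton) auto
    finally have "?G ?x = U i0 y0" by (simp only: restrict_apply'[OF x])
    moreover have "U i0 y0 \<noteq> \<zero>\<^bsub>T\<^esub>" using y0 by (simp add: U_def)
    ultimately have "?G ?x \<noteq> \<zero>\<^bsub>T\<^esub>" by (rule ssubst)
    then have "g (?H ?x) \<noteq> \<zero>\<^bsub>T\<^esub>" using g(2)[OF x] by (rule ssubst[rotated])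
    then show ?thesis by (rule bexI[OF _ rmod_homD(2)[OF H x]])
  qed
  ultimately show ?thesis using g(1) by blast
qed

end

section \<open>Baer modules\<close>

lemma rmod_hom_add:
  assumes "right_module R M" "right_module R N" and f: "f \<in> rmod_hom R M N" and g: "g \<in> rmod_hom R M N"
  shows "(\<lambda>x\<in>carrier M. f x \<oplus>\<^bsub>N\<^esub> g x) \<in> rmod_hom R M N"
proof -
  interpret M: rmod R M by (rule rmod.intro) fact
  interpret N: rmod R N by (rule rmod.intro) fact
  note f = rmod_homD(2-4)[OF f] and g = rmod_homD(2-4)[OF g]
  show ?thesis
  proof (rule rmod_homI)
    fix x y assume xy: "x \<in> carrier M" "y \<in> carrier M"
    show "(\<lambda>x\<in>carrier M. f x \<oplus>\<^bsub>N\<^esub> g x) (x \<oplus>\<^bsub>M\<^esub> y) =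
        (\<lambda>x\<in>carrier M. f x \<oplus>\<^bsub>N\<^esub> g x) x \<oplus>\<^bsub>N\<^esub> (\<lambda>x\<in>carrier M. f x \<oplus>\<^bsub>N\<^esub> g x) y"
      using xy f g N.M.a_lcomm[of "f y" "g x" "g y"] by (simp add: N.M.a_assoc)
  qed (auto simp: f g N.rsmult_l_distr)
qed

text \<open>Later arguments use summands only as retracts; the complement reappears as the elements
  \<open>m\<close> minus their projection.\<close>

lemma direct_summand_projection:
  assumes "right_module R M" and "direct_summand R M K"
  shows "\<exists>\<pi>\<in>rmod_hom R M M. \<pi> ` carrier M = K \<and> (\<forall>k\<in>K. \<pi> k = k)"
proof -
  interpret M: rmod R M by (rule rmod.intro) fact
  obtain L where K: "rsubmodule R M K" and L: "rsubmodule R M L" and KL: "K \<inter> L = {\<zero>\<^bsub>M\<^esub>}"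
    and sum: "K <+>\<^bsub>M\<^esub> L = carrier M" using assms(2) by (auto simp: direct_summand_def)
  note KD = rsubmoduleD[OF K] and LD = rsubmoduleD[OF L]
  have kM: "k \<in> carrier M" if "k \<in> K" for k using KD(1) that by blast
  have lM: "l \<in> carrier M" if "l \<in> L" for l using LD(1) that by blast
  have ex: "\<exists>k\<in>K. \<exists>l\<in>L. m = k \<oplus>\<^bsub>M\<^esub> l" if "m \<in> carrier M" for m
  proof -
    have "m \<in> K <+>\<^bsub>M\<^esub> L" using that by (simp only: sum)
    then show ?thesis by (simp add: set_add_def set_mult_def)
  qed
  have uniq: "k = k'"
    if "k \<in> K" "k' \<in> K" "l \<in> L" "l' \<in> L" and eq: "k \<oplus>\<^bsub>M\<^esub> l = k' \<oplus>\<^bsub>M\<^esub> l'" for k k' l l'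
  proof -
    have "k \<oplus>\<^bsub>M\<^esub> \<ominus>\<^bsub>M\<^esub> k' = (k \<oplus>\<^bsub>M\<^esub> l) \<oplus>\<^bsub>M\<^esub> (\<ominus>\<^bsub>M\<^esub> l \<oplus>\<^bsub>M\<^esub> \<ominus>\<^bsub>M\<^esub> k')"
      using that(1-4) kM lM by (simp add: M.M.a_assoc M.M.r_neg2)
    also have "\<dots> = (k' \<oplus>\<^bsub>M\<^esub> l') \<oplus>\<^bsub>M\<^esub> (\<ominus>\<^bsub>M\<^esub> k' \<oplus>\<^bsub>M\<^esub> \<ominus>\<^bsub>M\<^esub> l)"
      using eq that(1-4) kM lM M.M.a_comm[of "\<ominus>\<^bsub>M\<^esub> l" "\<ominus>\<^bsub>M\<^esub> k'"] by simp
    also have "\<dots> = l' \<oplus>\<^bsub>M\<^esub> \<ominus>\<^bsub>M\<^esub> l"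
      using that(1-4) kM lM M.M.a_comm[of k' l'] by (simp add: M.M.a_assoc M.M.r_neg2)
    finally have "k \<oplus>\<^bsub>M\<^esub> \<ominus>\<^bsub>M\<^esub> k' \<in> K \<inter> L"
      using KD(3)[OF that(1) M.rsubmodule_minus[OF K that(2)]] LD(3)[OF that(4) M.rsubmodule_minus[OF L that(3)]]
      by simp
    then have "k \<oplus>\<^bsub>M\<^esub> \<ominus>\<^bsub>M\<^esub> k' = \<zero>\<^bsub>M\<^esub>" using KL by blast
    then show ?thesis using M.M.minus_equality[of k "\<ominus>\<^bsub>M\<^esub> k'"] kM that(1,2) by simp
  qed
  define \<pi> where "\<pi> = (\<lambda>m\<in>carrier M. THE k. k \<in> K \<and> (\<exists>l\<in>L. m = k \<oplus>\<^bsub>M\<^esub> l))"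
  have pi: "\<pi> (k \<oplus>\<^bsub>M\<^esub> l) = k" if kl: "k \<in> K" "l \<in> L" for k l
  proof -
    have "(THE k'. k' \<in> K \<and> (\<exists>l'\<in>L. k \<oplus>\<^bsub>M\<^esub> l = k' \<oplus>\<^bsub>M\<^esub> l')) = k"
    proof (rule the_equality)
      show "k \<in> K \<and> (\<exists>l'\<in>L. k \<oplus>\<^bsub>M\<^esub> l = k \<oplus>\<^bsub>M\<^esub> l')" using kl by blast
      show "k' = k" if "k' \<in> K \<and> (\<exists>l'\<in>L. k \<oplus>\<^bsub>M\<^esub> l = k' \<oplus>\<^bsub>M\<^esub> l')" for k'
        using that uniq kl by blast
    qed
    then show ?thesis using kl kM lM by (simp add: \<pi>_def)
  qed
  have hom: "\<pi> \<in> rmod_hom R M M"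
  proof (rule rmod_homI)
    show "\<pi> \<in> carrier M \<rightarrow>\<^sub>E carrier M"
    proof (rule PiE_I)
      fix m assume "m \<in> carrier M"
      then obtain k l where "k \<in> K" "l \<in> L" "m = k \<oplus>\<^bsub>M\<^esub> l" using ex by blast
      then show "\<pi> m \<in> carrier M" using pi kM by simp
    qed (simp add: \<pi>_def)
  next
    fix x y assume "x \<in> carrier M" "y \<in> carrier M"
    then obtain k l k' l' where kl: "k \<in> K" "l \<in> L" "x = k \<oplus>\<^bsub>M\<^esub> l" "k' \<in> K" "l' \<in> L" "y = k' \<oplus>\<^bsub>M\<^esub> l'"
      using ex by meson
    have "x \<oplus>\<^bsub>M\<^esub> y = (k \<oplus>\<^bsub>M\<^esub> k') \<oplus>\<^bsub>M\<^esub> (l \<oplus>\<^bsub>M\<^esub> l')"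
      using kl kM lM M.M.a_lcomm[of l k' l'] by (simp add: M.M.a_assoc)
    then show "\<pi> (x \<oplus>\<^bsub>M\<^esub> y) = \<pi> x \<oplus>\<^bsub>M\<^esub> \<pi> y"
      using kl pi KD(3) LD(3) by simp
  next
    fix x r assume "x \<in> carrier M" and r: "r \<in> carrier R"
    then obtain k l where kl: "k \<in> K" "l \<in> L" "x = k \<oplus>\<^bsub>M\<^esub> l" using ex by meson
    then show "\<pi> (x \<cdot>\<^bsub>M\<^esub> r) = \<pi> x \<cdot>\<^bsub>M\<^esub> r"
      using pi KD(4) LD(4) r kM lM by (simp add: M.rsmult_l_distr)
  qed
  have id: "\<pi> k = k" if "k \<in> K" for k using pi[OF that LD(2)] kM[OF that] by simp
  have "\<pi> ` carrier M = K"
  proof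
    show "\<pi> ` carrier M \<subseteq> K"
    proof (rule image_subsetI)
      fix m assume "m \<in> carrier M"
      then obtain k l where "k \<in> K" "l \<in> L" "m = k \<oplus>\<^bsub>M\<^esub> l" using ex by blast
      then show "\<pi> m \<in> K" using pi by simp
    qed
    show "K \<subseteq> \<pi> ` carrier M"
    proof
      fix k assume k: "k \<in> K"
      show "k \<in> \<pi> ` carrier M" by (rule rev_image_eqI[OF kM[OF k]]) (simp add: id[OF k])
    qed
  qed
  then show ?thesis using hom id by blast
qed

lemma baer_ker_summand:
  assumes "baer_module R M" "e \<in> rmod_hom R M M"
  shows "direct_summand R M (rmod_ker M M e)"
proof -
  have "direct_summand R M (\<Inter>f\<in>{e}. rmod_ker M M f)"
    using assms unfolding baer_module_def by blast
  then show ?thesis by simp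
qed

text \<open>Endomorphisms of \<open>K\<close> become endomorphisms of \<open>M\<close> by
  composition with \<open>p\<close>, and the common kernel in \<open>M\<close> is the preimage under
  \<open>p\<close> of the one in \<open>K\<close>. A complement of the former is mapped by
  \<open>p\<close> onto a complement of the latter.\<close>

lemma baer_module_retract:
  assumes M: "right_module R M" and baer: "baer_module R M" and K: "rsubmodule R M K"
    and p: "p \<in> rmod_hom R M M" "p ` carrier M = K" "\<And>k. k \<in> K \<Longrightarrow> p k = k"
  shows "baer_module R (submod M K)"
  unfolding baer_module_def
proof (intro allI impI)
  interpret M: rmod R M by (rule rmod.intro) fact
  note KD = rsubmoduleD[OF K]
  have KM: "right_module R (submod M K)" by (rule M.right_module_submod[OF K])
  interpret K: rmod R "submod M K" by (rule rmod.intro) fact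
  have p': "p \<in> rmod_hom R M (submod M K)"
    using p(1,2) KD(1) by (simp add: rmod_hom_into_submod_iff)
  have pK: "p m \<in> K" if "m \<in> carrier M" for m using p(2) that by blast
  fix X assume X: "X \<noteq> {} \<and> X \<subseteq> rmod_hom R (submod M K) (submod M K)"
  define X' where "X' = (\<lambda>f. compose (carrier M) f p) ` X"
  have "X' \<subseteq> rmod_hom R M M"
  proof
    fix g assume "g \<in> X'"
    then obtain f where f: "f \<in> X" "g = compose (carrier M) f p" by (auto simp: X'_def)
    have "g \<in> rmod_hom R M (submod M K)" unfolding f(2) using rmod_hom_compose[OF M p'] f(1) X by blast
    then show "g \<in> rmod_hom R M M" using KD(1) by (simp add: rmod_hom_into_submod_iff)
  qed
  have ds: "direct_summand R M (\<Inter>g\<in>X'. rmod_ker M M g)"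
  proof -
    have "X' \<noteq> {}" using X by (simp add: X'_def)
    with \<open>X' \<subseteq> rmod_hom R M M\<close> show ?thesis
      using baer[unfolded baer_module_def, rule_format, of X'] by blast
  qed
  define D where "D = (\<Inter>g\<in>X'. rmod_ker M M g)"
  define D0 where "D0 = (\<Inter>f\<in>X. rmod_ker (submod M K) (submod M K) f)"
  have D0: "k \<in> D0 \<longleftrightarrow> k \<in> K \<and> (\<forall>f\<in>X. f k = \<zero>\<^bsub>M\<^esub>)" for k
    using X by (auto simp: D0_def rmod_ker_def)
  have D: "m \<in> D \<longleftrightarrow> m \<in> carrier M \<and> p m \<in> D0" for m
    using X pK by (auto simp: D_def X'_def rmod_ker_def D0 compose_def)
  obtain N where N: "rsubmodule R M N" "D \<inter> N = {\<zero>\<^bsub>M\<^esub>}" "D <+>\<^bsub>M\<^esub> N = carrier M"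
    using ds by (auto simp: direct_summand_def D_def)
  note ND = rsubmoduleD[OF N(1)]
  have pN: "rsubmodule R (submod M K) (p ` N)"
    by (rule rsubmodule_image[OF M KM p' N(1)])
  have fD: "f \<zero>\<^bsub>M\<^esub> = \<zero>\<^bsub>M\<^esub>"
    "\<And>x y. \<lbrakk>x \<in> K; y \<in> K\<rbrakk> \<Longrightarrow> f (x \<oplus>\<^bsub>M\<^esub> y) = f x \<oplus>\<^bsub>M\<^esub> f y"
    "\<And>x r. \<lbrakk>x \<in> K; r \<in> carrier R\<rbrakk> \<Longrightarrow> f (x \<cdot>\<^bsub>M\<^esub> r) = f x \<cdot>\<^bsub>M\<^esub> r" if "f \<in> X" for f
  proof -
    have f: "f \<in> rmod_hom R (submod M K) (submod M K)" using X that by blast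
    show "f \<zero>\<^bsub>M\<^esub> = \<zero>\<^bsub>M\<^esub>" using rmod_hom_zero[OF KM KM f] by simp
    show "\<lbrakk>x \<in> K; y \<in> K\<rbrakk> \<Longrightarrow> f (x \<oplus>\<^bsub>M\<^esub> y) = f x \<oplus>\<^bsub>M\<^esub> f y" for x y
      using rmod_homD(3)[OF f, of x y] by simp
    show "\<lbrakk>x \<in> K; r \<in> carrier R\<rbrakk> \<Longrightarrow> f (x \<cdot>\<^bsub>M\<^esub> r) = f x \<cdot>\<^bsub>M\<^esub> r" for x r
      using rmod_homD(4)[OF f, of x r] by simp
  qed
  have D0sub: "rsubmodule R (submod M K) D0"
  proof (rule K.rsubmoduleI)
    show "D0 \<subseteq> carrier (submod M K)" using D0 by auto
    show "\<zero>\<^bsub>submod M K\<^esub> \<in> D0" using D0 fD(1) KD(2) by simp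
    show "x \<oplus>\<^bsub>submod M K\<^esub> y \<in> D0" if "x \<in> D0" "y \<in> D0" for x y
    proof -
      have x: "x \<in> K" "\<And>f. f \<in> X \<Longrightarrow> f x = \<zero>\<^bsub>M\<^esub>" and y: "y \<in> K" "\<And>f. f \<in> X \<Longrightarrow> f y = \<zero>\<^bsub>M\<^esub>"
        using that D0 by blast+
      have "f (x \<oplus>\<^bsub>M\<^esub> y) = \<zero>\<^bsub>M\<^esub>" if "f \<in> X" for f
        by (simp only: fD(2)[OF that x(1) y(1)] x(2)[OF that] y(2)[OF that] M.M.l_zero[OF M.M.zero_closed])
      then show ?thesis using D0 KD(3)[OF x(1) y(1)] by simp
    qed
    show "x \<cdot>\<^bsub>submod M K\<^esub> r \<in> D0" if "x \<in> D0" "r \<in> carrier R" for x r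
    proof -
      have x: "x \<in> K" "\<And>f. f \<in> X \<Longrightarrow> f x = \<zero>\<^bsub>M\<^esub>" using that(1) D0 by blast+
      have "f (x \<cdot>\<^bsub>M\<^esub> r) = \<zero>\<^bsub>M\<^esub>" if "f \<in> X" for f
        by (simp only: fD(3)[OF that x(1) \<open>r \<in> carrier R\<close>] x(2)[OF that] M.rsmult_zero_left[OF \<open>r \<in> carrier R\<close>])
      then show ?thesis using D0 KD(4)[OF x(1) that(2)] by simp
    qed
  qed
  have "D0 \<inter> p ` N = {\<zero>\<^bsub>M\<^esub>}"
  proof -
    have "x = \<zero>\<^bsub>M\<^esub>" if x: "x \<in> D0" "x \<in> p ` N" for x
    proof -
      obtain n where n: "n \<in> N" "x = p n" using x(2) by blast
      have "n \<in> carrier M" using n(1) ND(1) by blast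
      then have "n \<in> D" using D x(1) n(2) by simp
      then have "n = \<zero>\<^bsub>M\<^esub>" using N(2) n(1) by blast
      then show ?thesis by (simp only: n(2) rmod_hom_zero[OF M M p(1)])
    qed
    moreover have "\<zero>\<^bsub>M\<^esub> \<in> D0 \<inter> p ` N" using rsubmoduleD(2)[OF D0sub] rsubmoduleD(2)[OF pN] by simp
    ultimately show ?thesis by blast
  qed
  moreover have "D0 <+>\<^bsub>submod M K\<^esub> (p ` N) = K"
  proof
    show "D0 <+>\<^bsub>submod M K\<^esub> (p ` N) \<subseteq> K"
      using rsubmoduleD(1)[OF D0sub] rsubmoduleD(1)[OF pN] KD(3)
      by (auto simp: set_add_def set_mult_def)
    show "K \<subseteq> D0 <+>\<^bsub>submod M K\<^esub> (p ` N)"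
    proof
      fix k assume k: "k \<in> K"
      then have "k \<in> D <+>\<^bsub>M\<^esub> N" using subsetD[OF KD(1) k] by (simp only: N(3))
      then obtain d n where dn: "d \<in> D" "n \<in> N" "k = d \<oplus>\<^bsub>M\<^esub> n" by (auto simp: set_add_def set_mult_def)
      have "d \<in> carrier M" "p d \<in> D0" using D dn(1) by simp_all
      moreover have "n \<in> carrier M" using dn(2) ND(1) by blast
      ultimately have "k = p d \<oplus>\<^bsub>M\<^esub> p n" using p(3)[OF k] dn(3) rmod_homD(3)[OF p(1), of d n] by simp
      then show "k \<in> D0 <+>\<^bsub>submod M K\<^esub> (p ` N)"
        using \<open>p d \<in> D0\<close> dn(2) by (auto simp: set_add_def set_mult_def)
    qed
  qed
  ultimately have "direct_summand R (submod M K) D0"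
    using D0sub pN by (auto simp: direct_summand_def)
  then show "direct_summand R (submod M K) (\<Inter>f\<in>X. rmod_ker (submod M K) (submod M K) f)"
    by (simp add: D0_def)
qed

lemma fin_gen_retract:
  assumes M: "right_module R M" and fg: "fin_gen R M" and K: "rsubmodule R M K"
    and p: "p \<in> rmod_hom R M M" "p ` carrier M = K"
  shows "fin_gen R (submod M K)"
proof -
  interpret M: rmod R M by (rule rmod.intro) fact
  note KD = rsubmoduleD[OF K]
  have KM: "right_module R (submod M K)" by (rule M.right_module_submod[OF K])
  have p': "p \<in> rmod_hom R M (submod M K)"
    using p KD(1) by (simp add: rmod_hom_into_submod_iff)
  obtain A where A: "finite A" "A \<subseteq> carrier M" "\<Inter> {N. rsubmodule R M N \<and> A \<subseteq> N} = carrier M"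
    using fg by (auto simp: fin_gen_def)
  have K': "rsubmodule R (submod M K) K" using M.rsubmodule_submod_iff[OF K] K by blast
  have pA: "p ` A \<subseteq> K" using p(2) A(2) by blast
  have "K \<subseteq> N" if N: "rsubmodule R (submod M K) N" "p ` A \<subseteq> N" for N
  proof -
    have "rsubmodule R M {m \<in> carrier M. p m \<in> N}" by (rule rsubmodule_vimage[OF M KM p' N(1)])
    moreover have "A \<subseteq> {m \<in> carrier M. p m \<in> N}" using A(2) N(2) by blast
    ultimately have "carrier M \<subseteq> {m \<in> carrier M. p m \<in> N}" using A(3) by blast
    then show ?thesis using p(2) by blast
  qed
  then have "\<Inter> {N. rsubmodule R (submod M K) N \<and> p ` A \<subseteq> N} = K" using K' pA by blast
  then show ?thesis unfolding fin_gen_def using A(1) pA by (intro exI[of _ "p ` A"]) simp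
qed

context comm_end_generator
begin

text \<open>Let \<open>p\<close> project onto the kernel of scaling by \<open>z\<close>. The
  hypothesis puts \<open>t\<close> times \<open>z\<close> into this kernel, so it equals its
  projection, which is \<open>p t\<close> times \<open>z\<close> and hence zero.\<close>

lemma baer_reduced:
  fixes M :: "('a, 'm) rmodule"
  assumes M: "right_module R M" and baer: "baer_module R M"
    and t: "t \<in> carrier M" and z: "z \<in> ring_center R" and zz: "(t \<cdot>\<^bsub>M\<^esub> z) \<cdot>\<^bsub>M\<^esub> z = \<zero>\<^bsub>M\<^esub>"
  shows "t \<cdot>\<^bsub>M\<^esub> z = \<zero>\<^bsub>M\<^esub>"
proof -
  interpret M: rmod R M by (rule rmod.intro) fact
  note zR = ring_centerD(1)[OF z]
  let ?e = "\<lambda>x\<in>carrier M. x \<cdot>\<^bsub>M\<^esub> z"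
  let ?K = "rmod_ker M M ?e"
  obtain p where p: "p \<in> rmod_hom R M M" "p ` carrier M = ?K" "\<forall>k\<in>?K. p k = k"
    using direct_summand_projection[OF M baer_ker_summand[OF baer M.rmod_hom_center_scaling[OF z]]] by blast
  have "p t \<in> ?K" using p(2) t by blast
  then have "p t \<cdot>\<^bsub>M\<^esub> z = \<zero>\<^bsub>M\<^esub>" by (simp add: rmod_ker_def split: if_splits)
  moreover have "t \<cdot>\<^bsub>M\<^esub> z \<in> ?K" using t zR zz by (simp add: rmod_ker_def)
  ultimately show ?thesis using p(3) rmod_homD(4)[OF p(1) t zR] by simp
qed

lemma baer_torsion_or_torsion_free:
  fixes M :: "('a, 'm) rmodule"
  assumes M: "right_module R M" and fg: "fin_gen R M" and baer: "baer_module R M"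
    and nt: "center_torsion R M \<noteq> carrier M"
  shows "center_torsion R M = {\<zero>\<^bsub>M\<^esub>}"
proof (rule ccontr)
  interpret M: rmod R M by (rule rmod.intro) fact
  note tor = rsubmodule_center_torsion[OF M]
  let ?T = "submod M (center_torsion R M)"
  assume "\<not> ?thesis"
  then obtain t0 where t0: "t0 \<in> center_torsion R M" "t0 \<noteq> \<zero>\<^bsub>M\<^esub>" using rsubmoduleD(2)[OF tor] by blast
  have "\<exists>g\<in>rmod_hom R M ?T. (\<exists>m\<in>carrier M. g m \<noteq> \<zero>\<^bsub>?T\<^esub>) \<and> (\<forall>m\<in>center_torsion R M. g m = \<zero>\<^bsub>?T\<^esub>)"
  proof (rule exists_hom_to_reduced[OF M fg nt M.right_module_submod[OF tor]])
    show "t0 \<in> carrier ?T" "t0 \<noteq> \<zero>\<^bsub>?T\<^esub>" using t0 by simp_all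
    show "t \<cdot>\<^bsub>?T\<^esub> z = \<zero>\<^bsub>?T\<^esub>"
      if "t \<in> carrier ?T" "z \<in> ring_center R" "(t \<cdot>\<^bsub>?T\<^esub> z) \<cdot>\<^bsub>?T\<^esub> z = \<zero>\<^bsub>?T\<^esub>" for t z
      using baer_reduced[OF M baer, of t z] that rsubmoduleD(1)[OF tor] by auto
  qed
  then obtain g where g': "g \<in> rmod_hom R M ?T" and nz: "\<exists>m\<in>carrier M. g m \<noteq> \<zero>\<^bsub>M\<^esub>"
    and kill: "\<forall>m\<in>center_torsion R M. g m = \<zero>\<^bsub>M\<^esub>" by auto
  have g: "g \<in> rmod_hom R M M" and gT: "g ` carrier M \<subseteq> center_torsion R M"
    using g' rsubmoduleD(1)[OF tor] by (simp_all add: rmod_hom_into_submod_iff)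
  let ?K = "rmod_ker M M g"
  obtain p where p: "p \<in> rmod_hom R M M" "p ` carrier M = ?K" "\<forall>k\<in>?K. p k = k"
    using direct_summand_projection[OF M baer_ker_summand[OF baer g]] by blast
  have "g m = \<zero>\<^bsub>M\<^esub>" if m: "m \<in> carrier M" for m
  proof -
    note pm = rmod_homD(2)[OF p(1) m]
    \<comment> \<open>The component of \<open>m\<close> in the complement of the kernel of
      \<open>g\<close>. Some nonzero \<open>z\<close> kills \<open>g d\<close>, so \<open>d\<close>
      times \<open>z\<close> lies in the kernel and equals its own projection, which is zero because
      \<open>p d\<close> is. Thus \<open>d\<close> is torsion and \<open>g\<close> kills it.\<close>
    define d where "d = m \<oplus>\<^bsub>M\<^esub> \<ominus>\<^bsub>M\<^esub> p m"
    have d: "d \<in> carrier M" using m pm by (simp add: d_def)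
    have "p m \<in> ?K" using p(2) m by blast
    then have gpm: "g (p m) = \<zero>\<^bsub>M\<^esub>" and ppm: "p (p m) = p m" using p(3) by (simp_all add: rmod_ker_def)
    have minus0: "\<ominus>\<^bsub>M\<^esub> \<zero>\<^bsub>M\<^esub> = \<zero>\<^bsub>M\<^esub>" by (rule M.M.minus_equality) simp_all
    have gd: "g d = g m"
      using rmod_homD(3)[OF g m, of "\<ominus>\<^bsub>M\<^esub> p m"] rmod_hom_minus[OF M M g pm] gpm pm m minus0
        rmod_homD(2)[OF g m] by (simp add: d_def)
    have pd: "p d = \<zero>\<^bsub>M\<^esub>"
      using rmod_homD(3)[OF p(1) m, of "\<ominus>\<^bsub>M\<^esub> p m"] rmod_hom_minus[OF M M p(1) pm] ppm pm
      by (simp add: d_def M.M.r_neg)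
    obtain z where z: "z \<in> ring_center R" "z \<noteq> \<zero>\<^bsub>R\<^esub>" "g d \<cdot>\<^bsub>M\<^esub> z = \<zero>\<^bsub>M\<^esub>"
      using gT d by (auto simp: center_torsion_def)
    note zR = ring_centerD(1)[OF z(1)]
    have "d \<cdot>\<^bsub>M\<^esub> z \<in> ?K" using z(3) rmod_homD(4)[OF g d zR] d zR by (simp add: rmod_ker_def)
    then have "d \<cdot>\<^bsub>M\<^esub> z = p (d \<cdot>\<^bsub>M\<^esub> z)" using p(3) by simp
    also have "\<dots> = \<zero>\<^bsub>M\<^esub>" using rmod_homD(4)[OF p(1) d zR] pd zR by simp
    finally have "d \<in> center_torsion R M" using d z(1,2) by (auto simp: center_torsion_def)
    then show ?thesis using kill gd by simp
  qed
  then show False using nz by blast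
qed

end

section \<open>Splitting off uniform right ideals\<close>

context comm_end_generator
begin

lemma submod_torsion_free:
  assumes "rsubmodule R M K" "center_torsion R M = {\<zero>\<^bsub>M\<^esub>}"
  shows "center_torsion R (submod M K) = {\<zero>\<^bsub>M\<^esub>}"
proof -
  have "\<one>\<^bsub>R\<^esub> \<in> ring_center R" by (simp add: ring_center_def)
  moreover have "\<zero>\<^bsub>M\<^esub> \<in> center_torsion R M" using assms(2) by simp
  then have "\<exists>z\<in>ring_center R. z \<noteq> \<zero>\<^bsub>R\<^esub> \<and> \<zero>\<^bsub>M\<^esub> \<cdot>\<^bsub>M\<^esub> z = \<zero>\<^bsub>M\<^esub>" by (simp add: center_torsion_def)
  moreover have "center_torsion R (submod M K) \<subseteq> center_torsion R M"
    using rsubmoduleD(1)[OF assms(1)] by (auto simp: center_torsion_def)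
  ultimately show ?thesis
    using assms(2) rsubmoduleD(2)[OF assms(1)] by (auto simp: center_torsion_def)
qed

text \<open>Some \<open>f l\<close> is nonzero since the trace is one, and nonzero maps from
  \<open>Q\<close> to a torsion-free module are injective.\<close>

lemma exists_embedding_in_reg:
  "\<exists>\<rho>\<in>rmod_hom R Q (reg_rmodule R). inj_on \<rho> (carrier Q)"
proof -
  interpret reg: rmod R "reg_rmodule R" by (rule rmod.intro[OF right_module_reg[OF R.ring_axioms]])
  have tf: "center_torsion R (reg_rmodule R) = {\<zero>\<^bsub>reg_rmodule R\<^esub>}"
  proof -
    have "\<one>\<^bsub>R\<^esub> \<in> ring_center R" by (simp add: ring_center_def)
    then have "\<zero>\<^bsub>R\<^esub> \<in> center_torsion R (reg_rmodule R)"
      using one_neq_zero unfolding center_torsion_def by (intro CollectI conjI bexI[of _ "\<one>\<^bsub>R\<^esub>"]) simp_all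
    moreover have "r = \<zero>\<^bsub>R\<^esub>" if r: "r \<in> center_torsion R (reg_rmodule R)" for r
    proof -
      obtain z where "r \<in> carrier R" "z \<in> ring_center R" "z \<noteq> \<zero>\<^bsub>R\<^esub>" "r \<otimes>\<^bsub>R\<^esub> z = \<zero>\<^bsub>R\<^esub>"
        using r by (auto simp: center_torsion_def)
      then show ?thesis by (rule reg_torsion_free)
    qed
    ultimately show ?thesis unfolding reg_rmodule_simps by blast
  qed
  have "\<exists>l<L. \<exists>y\<in>carrier Q. f l y \<noteq> \<zero>\<^bsub>R\<^esub>"
  proof (rule ccontr)
    assume none: "\<not> ?thesis"
    have "\<one>\<^bsub>R\<^esub> = \<zero>\<^bsub>reg_rmodule R\<^esub>"
      by (rule annihilates_traces_imp_zero[OF reg.right_module_axioms]) (use none in simp_all)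
    then show False using one_neq_zero by simp
  qed
  then obtain l y where l: "l < L" and y: "y \<in> carrier Q" "f l y \<noteq> \<zero>\<^bsub>R\<^esub>" by blast
  have "inj_on (f l) (carrier Q)"
  proof (rule rmod_hom_inj_onI[OF right_module_axioms reg.right_module_axioms f_hom[OF l]])
    show "x = \<zero>\<^bsub>Q\<^esub>" if "x \<in> carrier Q" "f l x = \<zero>\<^bsub>reg_rmodule R\<^esub>" for x
      by (rule hom_to_torsion_free_inj[OF reg.right_module_axioms tf f_hom[OF l] y(1) _ that])
        (use y(2) in simp)
  qed
  then show ?thesis using f_hom[OF l] by blast
qed

text \<open>With scalars \<open>w\<close> for \<open>x\<close> and \<open>v\<close> for
  \<open>y\<close>, the element \<open>x\<close> times \<open>v\<close> times \<open>w\<close> is a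
  multiple of \<open>x\<close>, through \<open>f l\<close> at \<open>x\<close> times
  \<open>v\<close>, and of \<open>y\<close>, through \<open>f k\<close> at \<open>x\<close> times
  \<open>w\<close>. It is nonzero because \<open>Q\<close> is torsion-free.\<close>

lemma Q_essential_elements:
  assumes x: "x \<in> carrier Q" "x \<noteq> \<zero>\<^bsub>Q\<^esub>" and y: "y \<in> carrier Q" "y \<noteq> \<zero>\<^bsub>Q\<^esub>"
  shows "\<exists>r\<in>carrier R. \<exists>s\<in>carrier R. x \<cdot>\<^bsub>Q\<^esub> r = y \<cdot>\<^bsub>Q\<^esub> s \<and> x \<cdot>\<^bsub>Q\<^esub> r \<noteq> \<zero>\<^bsub>Q\<^esub>"
proof -
  obtain l w where l: "l < L" and w: "w \<in> ring_center R" "w \<noteq> \<zero>\<^bsub>R\<^esub>"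
    "\<forall>u\<in>carrier Q. x \<cdot>\<^bsub>Q\<^esub> f l u = u \<cdot>\<^bsub>Q\<^esub> w" using trace_scaling_nonzero[OF x] by blast
  obtain k v where k: "k < L" and v: "v \<in> ring_center R" "v \<noteq> \<zero>\<^bsub>R\<^esub>"
    "\<forall>u\<in>carrier Q. y \<cdot>\<^bsub>Q\<^esub> f k u = u \<cdot>\<^bsub>Q\<^esub> v" using trace_scaling_nonzero[OF y] by blast
  note wR = ring_centerD(1)[OF w(1)] and vR = ring_centerD(1)[OF v(1)]
  have xw: "x \<cdot>\<^bsub>Q\<^esub> w \<in> carrier Q" and xv: "x \<cdot>\<^bsub>Q\<^esub> v \<in> carrier Q" using x wR vR by simp_all
  have eq: "x \<cdot>\<^bsub>Q\<^esub> f l (x \<cdot>\<^bsub>Q\<^esub> v) = y \<cdot>\<^bsub>Q\<^esub> f k (x \<cdot>\<^bsub>Q\<^esub> w)"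
    using w(3) v(3) xw xv rsmult_center_swap[OF right_module_axioms x(1) v(1) wR] by simp
  have "(x \<cdot>\<^bsub>Q\<^esub> v) \<cdot>\<^bsub>Q\<^esub> w \<noteq> \<zero>\<^bsub>Q\<^esub>"
    using torsion_freeD[OF Q_torsion_free xv w(1,2)] torsion_freeD[OF Q_torsion_free x(1) v(1,2)] x(2) by blast
  then have "x \<cdot>\<^bsub>Q\<^esub> f l (x \<cdot>\<^bsub>Q\<^esub> v) \<noteq> \<zero>\<^bsub>Q\<^esub>" using w(3) xv by simp
  with eq show ?thesis using f_closed[OF l xv] f_closed[OF k xw] by blast
qed

lemma uniform_image_in_reg:
  assumes rho: "\<rho> \<in> rmod_hom R Q (reg_rmodule R)" "inj_on \<rho> (carrier Q)"
    and J: "right_ideal R J" "J \<subseteq> \<rho> ` carrier Q" "J \<noteq> {\<zero>\<^bsub>R\<^esub>}"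
  shows "uniform_module R (right_ideal_module R J)"
  unfolding uniform_module_def
proof (intro conjI allI impI)
  interpret reg: rmod R "reg_rmodule R" by (rule rmod.intro[OF right_module_reg[OF R.ring_axioms]])
  have rho0: "\<rho> \<zero>\<^bsub>Q\<^esub> = \<zero>\<^bsub>R\<^esub>" using rmod_hom_zero[OF right_module_axioms reg.right_module_axioms rho(1)] by simp
  show "carrier (right_ideal_module R J) \<noteq> {\<zero>\<^bsub>right_ideal_module R J\<^esub>}" using J(3) by simp
  fix A B
  assume "rsubmodule R (right_ideal_module R J) A \<and> A \<noteq> {\<zero>\<^bsub>right_ideal_module R J\<^esub>} \<and>
    rsubmodule R (right_ideal_module R J) B \<and> B \<noteq> {\<zero>\<^bsub>right_ideal_module R J\<^esub>}"
  then have A: "right_ideal R A" "A \<subseteq> J" "A \<noteq> {\<zero>\<^bsub>R\<^esub>}" and B: "right_ideal R B" "B \<subseteq> J" "B \<noteq> {\<zero>\<^bsub>R\<^esub>}"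
    using reg.rsubmodule_submod_iff[OF J(1)] by auto
  obtain a where a: "a \<in> A" "a \<noteq> \<zero>\<^bsub>R\<^esub>" using A(3) rsubmoduleD(2)[OF A(1)] by auto
  obtain b where b: "b \<in> B" "b \<noteq> \<zero>\<^bsub>R\<^esub>" using B(3) rsubmoduleD(2)[OF B(1)] by auto
  obtain x where x: "x \<in> carrier Q" "a = \<rho> x" using a A(2) J(2) by blast
  obtain y where y: "y \<in> carrier Q" "b = \<rho> y" using b B(2) J(2) by blast
  have "x \<noteq> \<zero>\<^bsub>Q\<^esub>" "y \<noteq> \<zero>\<^bsub>Q\<^esub>" using a(2) b(2) x(2) y(2) rho0 by auto
  then obtain r s where rs: "r \<in> carrier R" "s \<in> carrier R" "x \<cdot>\<^bsub>Q\<^esub> r = y \<cdot>\<^bsub>Q\<^esub> s" "x \<cdot>\<^bsub>Q\<^esub> r \<noteq> \<zero>\<^bsub>Q\<^esub>"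
    using Q_essential_elements[OF x(1) _ y(1)] by blast
  have ar: "a \<otimes>\<^bsub>R\<^esub> r = \<rho> (x \<cdot>\<^bsub>Q\<^esub> r)" using rmod_homD(4)[OF rho(1) x(1) rs(1)] x(2) by simp
  have bs: "b \<otimes>\<^bsub>R\<^esub> s = \<rho> (x \<cdot>\<^bsub>Q\<^esub> r)" using rmod_homD(4)[OF rho(1) y(1) rs(2)] y(2) rs(3) by simp
  have "\<rho> (x \<cdot>\<^bsub>Q\<^esub> r) \<noteq> \<zero>\<^bsub>R\<^esub>"
    using inj_onD[OF rho(2), of "x \<cdot>\<^bsub>Q\<^esub> r" "\<zero>\<^bsub>Q\<^esub>"] rho0 x(1) rs(1,4) by auto
  moreover have "\<rho> (x \<cdot>\<^bsub>Q\<^esub> r) \<in> A" using rsubmoduleD(4)[OF A(1) a(1) rs(1)] ar by simp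
  moreover have "\<rho> (x \<cdot>\<^bsub>Q\<^esub> r) \<in> B" using rsubmoduleD(4)[OF B(1) b(1) rs(2)] bs by simp
  ultimately show "A \<inter> B \<noteq> {\<zero>\<^bsub>right_ideal_module R J\<^esub>}" by auto
qed

text \<open>Induction on the set of generating maps \<open>V i\<close>. Generation is required only
  up to a nonzero central denominator \<open>z\<close>, as eliminating one generator multiplies the
  others by a scalar. The decomposition is expressed by coordinate maps \<open>\<chi>\<close> into
  \<open>R\<close>: coordinates of the summand \<open>K\<close> extend to \<open>M\<close> by
  composition with the projection, and their images do not change.\<close>

lemma baer_uniform_coordinates:
  fixes M :: "('a, 'm) rmodule" and I :: "nat set" and V :: "nat \<Rightarrow> 'b \<Rightarrow> 'm"
  assumes "finite I" and "right_module R M" and "fin_gen R M" and "baer_module R M"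
    and "center_torsion R M = {\<zero>\<^bsub>M\<^esub>}"
    and "\<And>i. i \<in> I \<Longrightarrow> V i \<in> rmod_hom R Q M"
    and "\<And>m. m \<in> carrier M \<Longrightarrow> \<exists>z\<in>ring_center R. z \<noteq> \<zero>\<^bsub>R\<^esub> \<and>
      (\<exists>x. (\<forall>i\<in>I. x i \<in> carrier Q) \<and> m \<cdot>\<^bsub>M\<^esub> z = finsum M (\<lambda>i. V i (x i)) I)"
  shows "\<exists>(n::nat) \<chi>. (\<forall>i\<in>{1..n}. \<chi> i \<in> rmod_hom R M (reg_rmodule R) \<and>
      uniform_module R (right_ideal_module R (\<chi> i ` carrier M))) \<and>
    inj_on (\<lambda>m. \<lambda>i\<in>{1..n}. \<chi> i m) (carrier M) \<and>
    (\<forall>y\<in>(\<Pi>\<^sub>E i\<in>{1..n}. \<chi> i ` carrier M). \<exists>m\<in>carrier M. \<forall>i\<in>{1..n}. \<chi> i m = y i)"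
  using assms
proof (induction I arbitrary: M V rule: finite_psubset_induct)
  case (psubset I)
  note M = psubset.prems(1) and fg = psubset.prems(2) and baer = psubset.prems(3) and tf = psubset.prems(4)
    and V = psubset.prems(5) and gen = psubset.prems(6)
  interpret N: rmod R M by (rule rmod.intro) fact
  interpret reg: rmod R "reg_rmodule R" by (rule rmod.intro[OF right_module_reg[OF R.ring_axioms]])
  show ?case
  proof (cases "carrier M = {\<zero>\<^bsub>M\<^esub>}")
    case True
    then show ?thesis by (intro exI[of _ 0]) auto
  next
    case False
    obtain t0 where t0: "t0 \<in> carrier Q" "t0 \<noteq> \<zero>\<^bsub>Q\<^esub>" using Q_nonzero M.zero_closed by blast
    \<comment> \<open>\<open>Q\<close> is a legitimate target because torsion-freeness implies
      reducedness.\<close>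
    have "\<exists>g\<in>rmod_hom R M Q. (\<exists>m\<in>carrier M. g m \<noteq> \<zero>\<^bsub>Q\<^esub>) \<and> (\<forall>m\<in>center_torsion R M. g m = \<zero>\<^bsub>Q\<^esub>)"
    proof (rule exists_hom_to_reduced[OF M fg _ right_module_axioms t0])
      show "center_torsion R M \<noteq> carrier M" using tf False by simp
      show "t \<cdot>\<^bsub>Q\<^esub> z = \<zero>\<^bsub>Q\<^esub>"
        if t: "t \<in> carrier Q" and z: "z \<in> ring_center R" and "(t \<cdot>\<^bsub>Q\<^esub> z) \<cdot>\<^bsub>Q\<^esub> z = \<zero>\<^bsub>Q\<^esub>" for t z
      proof (cases "z = \<zero>\<^bsub>R\<^esub>")
        case False
        show ?thesis
          by (rule torsion_freeD[OF Q_torsion_free _ z False that(3)]) (use t ring_centerD(1)[OF z] in simp)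
      qed (use t in simp)
    qed
    then obtain \<phi> m0 where phi: "\<phi> \<in> rmod_hom R M Q" and m0: "m0 \<in> carrier M" "\<phi> m0 \<noteq> \<zero>\<^bsub>Q\<^esub>" by blast
    have phi0: "\<phi> \<zero>\<^bsub>M\<^esub> = \<zero>\<^bsub>Q\<^esub>" by (rule rmod_hom_zero[OF M right_module_axioms phi])
    have Vc: "V i y \<in> carrier M" if "i \<in> I" "y \<in> carrier Q" for i y
      by (rule rmod_homD(2)[OF V[OF that(1)] that(2)])
    have phi_sum: "\<phi> (finsum M (\<lambda>i. V i (x i)) I) = finsum Q (\<lambda>i. \<phi> (V i (x i))) I"
      if "\<forall>i\<in>I. x i \<in> carrier Q" for x
      using that Vc psubset.hyps by (intro rmod_hom_finsum[OF M right_module_axioms phi]) auto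
    \<comment> \<open>If \<open>\<phi>\<close> vanished on all generating maps, a nonzero central
      multiple of \<open>\<phi> m0\<close> would be zero.\<close>
    have "\<exists>i\<in>I. \<exists>y\<in>carrier Q. \<phi> (V i y) \<noteq> \<zero>\<^bsub>Q\<^esub>"
    proof (rule ccontr)
      assume none: "\<not> ?thesis"
      obtain z x where z: "z \<in> ring_center R" "z \<noteq> \<zero>\<^bsub>R\<^esub>" and x: "\<forall>i\<in>I. x i \<in> carrier Q"
        "m0 \<cdot>\<^bsub>M\<^esub> z = finsum M (\<lambda>i. V i (x i)) I" using gen[OF m0(1)] by blast
      have "finsum Q (\<lambda>i. \<phi> (V i (x i))) I = finsum Q (\<lambda>i. \<zero>\<^bsub>Q\<^esub>) I"
        using none x(1) by (intro M.finsum_cong') auto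
      then have "\<phi> m0 \<cdot>\<^bsub>Q\<^esub> z = \<zero>\<^bsub>Q\<^esub>"
        using rmod_homD(4)[OF phi m0(1) ring_centerD(1)[OF z(1)]] phi_sum[OF x(1)] x(2) by simp
      then show False using torsion_freeD[OF Q_torsion_free rmod_homD(2)[OF phi m0(1)] z] m0(2) by blast
    qed
    then obtain j y0 where j: "j \<in> I" and y0: "y0 \<in> carrier Q" "\<phi> (V j y0) \<noteq> \<zero>\<^bsub>Q\<^esub>" by blast
    \<comment> \<open>Each \<open>\<phi>\<close> after \<open>V i\<close> is an endomorphism of
      \<open>Q\<close>, hence scaling by some central \<open>c i\<close>.\<close>
    have "\<exists>c\<in>ring_center R. \<forall>y\<in>carrier Q. \<phi> (V i y) = y \<cdot>\<^bsub>Q\<^esub> c" if "i \<in> I" for i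
      using endomorphism_eq_center_scaling[OF rmod_hom_compose[OF right_module_axioms V[OF that] phi]]
      by (auto simp: compose_def)
    then obtain c where c: "\<And>i. i \<in> I \<Longrightarrow> c i \<in> ring_center R"
      and phiV: "\<And>i y. \<lbrakk>i \<in> I; y \<in> carrier Q\<rbrakk> \<Longrightarrow> \<phi> (V i y) = y \<cdot>\<^bsub>Q\<^esub> c i" by metis
    have cR: "c i \<in> carrier R" if "i \<in> I" for i by (rule ring_centerD(1)[OF c[OF that]])
    have cj: "c j \<noteq> \<zero>\<^bsub>R\<^esub>" using phiV[OF j y0(1)] y0 by auto
    define d where "d i = \<ominus>\<^bsub>R\<^esub> c i" for i
    have d: "d i \<in> ring_center R" if "i \<in> I" for i
      using c[OF that] R.subcring_ring_center subringE(5)[of "ring_center R" R] by (simp add: d_def subcring_def)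
    have dR: "d i \<in> carrier R" if "i \<in> I" for i by (rule ring_centerD(1)[OF d[OF that]])
    define K where "K = rmod_ker M Q \<phi>"
    have K: "rsubmodule R M K" unfolding K_def by (rule rsubmodule_ker[OF M right_module_axioms phi])
    note KD = rsubmoduleD[OF K]
    have memK: "m \<in> K \<longleftrightarrow> m \<in> carrier M \<and> \<phi> m = \<zero>\<^bsub>Q\<^esub>" for m by (simp add: K_def rmod_ker_def)
    have KM: "right_module R (submod M K)" by (rule N.right_module_submod[OF K])
    have V_inj: "x = \<zero>\<^bsub>Q\<^esub>" if "x \<in> carrier Q" "V j x = \<zero>\<^bsub>M\<^esub>" for x
      by (rule hom_to_torsion_free_inj[OF M tf V[OF j] y0(1) _ that]) (use y0(2) phi0 in auto)
    \<comment> \<open>The Baer condition concerns endomorphisms of \<open>M\<close>, so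
      \<open>\<phi>\<close> is followed by \<open>V j\<close>. This map is nonzero into a
      torsion-free module, hence injective, and the kernel does not change.\<close>
    have "rmod_ker M M (compose (carrier M) (V j) \<phi>) = K"
      using V_inj rmod_homD(2)[OF phi] rmod_hom_zero[OF right_module_axioms M V[OF j]]
      by (auto simp: rmod_ker_def K_def compose_def)
    then have "direct_summand R M K"
      using baer_ker_summand[OF baer rmod_hom_compose[OF M phi V[OF j]]] by simp
    then obtain p where p: "p \<in> rmod_hom R M M" "p ` carrier M = K" "\<forall>k\<in>K. p k = k"
      using direct_summand_projection[OF M] by blast
    have pid: "p k = k" if "k \<in> K" for k using p(3) that by blast
    have pK: "p m \<in> K" if "m \<in> carrier M" for m using p(2) that by blast
    have p': "p \<in> rmod_hom R M (submod M K)"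
      using p(1,2) KD(1) by (simp add: rmod_hom_into_submod_iff)
    \<comment> \<open>Cross-multiplication with the pivot \<open>c j\<close>: this combination of
      \<open>V i\<close> and \<open>V j\<close> is annihilated by \<open>\<phi>\<close>. For
      \<open>i\<close> equal to \<open>j\<close> it is zero, so one generator disappears.\<close>
    define W where "W i = (\<lambda>y\<in>carrier Q. V i y \<cdot>\<^bsub>M\<^esub> c j \<oplus>\<^bsub>M\<^esub> V j y \<cdot>\<^bsub>M\<^esub> d i)" for i
    have W: "W i \<in> rmod_hom R Q (submod M K)" if i: "i \<in> I" for i
    proof -
      note h1 = rmod_hom_compose[OF right_module_axioms V[OF i] N.rmod_hom_center_scaling[OF c[OF j]]]
      note h2 = rmod_hom_compose[OF right_module_axioms V[OF j] N.rmod_hom_center_scaling[OF d[OF i]]]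
      have "W i = (\<lambda>y\<in>carrier Q. compose (carrier Q) (\<lambda>x\<in>carrier M. x \<cdot>\<^bsub>M\<^esub> c j) (V i) y \<oplus>\<^bsub>M\<^esub>
          compose (carrier Q) (\<lambda>x\<in>carrier M. x \<cdot>\<^bsub>M\<^esub> d i) (V j) y)"
        unfolding W_def by (rule restrict_ext) (use Vc i j in \<open>simp add: compose_def\<close>)
      then have hom: "W i \<in> rmod_hom R Q M" using rmod_hom_add[OF right_module_axioms M h1 h2] by simp
      have "W i y \<in> K" if y: "y \<in> carrier Q" for y
      proof -
        have "\<phi> (W i y) = (y \<cdot>\<^bsub>Q\<^esub> c i) \<cdot>\<^bsub>Q\<^esub> c j \<oplus>\<^bsub>Q\<^esub> (y \<cdot>\<^bsub>Q\<^esub> c j) \<cdot>\<^bsub>Q\<^esub> d i"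
          using y i j Vc cR dR rmod_homD(3)[OF phi, of "V i y \<cdot>\<^bsub>M\<^esub> c j" "V j y \<cdot>\<^bsub>M\<^esub> d i"]
            rmod_homD(4)[OF phi Vc[OF i y] cR[OF j]] rmod_homD(4)[OF phi Vc[OF j y] dR[OF i]]
          by (simp add: W_def phiV)
        also have "(y \<cdot>\<^bsub>Q\<^esub> c j) \<cdot>\<^bsub>Q\<^esub> d i = \<ominus>\<^bsub>Q\<^esub> ((y \<cdot>\<^bsub>Q\<^esub> c j) \<cdot>\<^bsub>Q\<^esub> c i)"
          using y i j cR by (simp add: d_def rsmult_minus_right)
        also have "(y \<cdot>\<^bsub>Q\<^esub> c j) \<cdot>\<^bsub>Q\<^esub> c i = (y \<cdot>\<^bsub>Q\<^esub> c i) \<cdot>\<^bsub>Q\<^esub> c j"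
          by (rule rsmult_center_swap[OF right_module_axioms y c[OF i] cR[OF j]])
        finally have "\<phi> (W i y) = \<zero>\<^bsub>Q\<^esub>" using y i j cR by (simp add: M.r_neg)
        then show ?thesis using memK rmod_homD(2)[OF hom y] by simp
      qed
      then show ?thesis using hom KD(1) by (auto simp: rmod_hom_into_submod_iff)
    qed
    have Wc: "W i y \<in> K" if "i \<in> I" "y \<in> carrier Q" for i y using rmod_homD(2)[OF W that(2)] that(1) by simp
    \<comment> \<open>For \<open>k\<close> in the kernel, the sum of the \<open>W i (x i)\<close> is
      \<open>k\<close> times \<open>z\<close> times \<open>c j\<close>, up to \<open>V j\<close> of
      the sum of all \<open>x i\<close> times \<open>d i\<close>. The latter sum is the negative of
      \<open>\<phi> k\<close> times \<open>z\<close>, hence zero. The new denominator is the product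
      of \<open>z\<close> and \<open>c j\<close>.\<close>
    have genK: "\<exists>z\<in>ring_center R. z \<noteq> \<zero>\<^bsub>R\<^esub> \<and>
      (\<exists>x. (\<forall>i\<in>I - {j}. x i \<in> carrier Q) \<and> k \<cdot>\<^bsub>M\<^esub> z = finsum (submod M K) (\<lambda>i. W i (x i)) (I - {j}))"
      if k: "k \<in> K" for k
    proof -
      have kM: "k \<in> carrier M" and phik: "\<phi> k = \<zero>\<^bsub>Q\<^esub>" using k memK by simp_all
      obtain z x where z: "z \<in> ring_center R" "z \<noteq> \<zero>\<^bsub>R\<^esub>" and x: "\<forall>i\<in>I. x i \<in> carrier Q"
        "k \<cdot>\<^bsub>M\<^esub> z = finsum M (\<lambda>i. V i (x i)) I" using gen[OF kM] by blast
      note zR = ring_centerD(1)[OF z(1)]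
      have xQ: "x i \<in> carrier Q" if "i \<in> I" for i using x(1) that by blast
      have "finsum Q (\<lambda>i. x i \<cdot>\<^bsub>Q\<^esub> c i) I = finsum Q (\<lambda>i. \<phi> (V i (x i))) I"
        using xQ cR phiV by (intro M.finsum_cong') auto
      also have "\<dots> = \<phi> k \<cdot>\<^bsub>Q\<^esub> z" using phi_sum[OF x(1)] x(2) rmod_homD(4)[OF phi kM zR] by simp
      finally have sum0: "finsum Q (\<lambda>i. x i \<cdot>\<^bsub>Q\<^esub> c i) I = \<zero>\<^bsub>Q\<^esub>" using phik zR by simp
      have "finsum Q (\<lambda>i. x i \<cdot>\<^bsub>Q\<^esub> d i) I = finsum Q (\<lambda>i. (x i \<cdot>\<^bsub>Q\<^esub> c i) \<cdot>\<^bsub>Q\<^esub> (\<ominus>\<^bsub>R\<^esub> \<one>\<^bsub>R\<^esub>)) I"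
        using xQ cR by (intro M.finsum_cong') (auto simp: d_def rsmult_minus_right)
      also have "\<dots> = finsum Q (\<lambda>i. x i \<cdot>\<^bsub>Q\<^esub> c i) I \<cdot>\<^bsub>Q\<^esub> (\<ominus>\<^bsub>R\<^esub> \<one>\<^bsub>R\<^esub>)"
        using xQ cR psubset.hyps by (intro finsum_rsmult[symmetric]) auto
      finally have sumd: "finsum Q (\<lambda>i. x i \<cdot>\<^bsub>Q\<^esub> d i) I = \<zero>\<^bsub>Q\<^esub>" using sum0 by simp
      have "finsum M (\<lambda>i. W i (x i)) I = finsum M (\<lambda>i. V i (x i) \<cdot>\<^bsub>M\<^esub> c j \<oplus>\<^bsub>M\<^esub> V j (x i \<cdot>\<^bsub>Q\<^esub> d i)) I"
        using xQ Vc cR dR j rmod_homD(4)[OF V[OF j]] by (intro N.M.finsum_cong') (auto simp: W_def)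
      also have "\<dots> = finsum M (\<lambda>i. V i (x i) \<cdot>\<^bsub>M\<^esub> c j) I \<oplus>\<^bsub>M\<^esub> finsum M (\<lambda>i. V j (x i \<cdot>\<^bsub>Q\<^esub> d i)) I"
        using xQ Vc cR dR j by (intro N.M.finsum_addf) auto
      also have "finsum M (\<lambda>i. V i (x i) \<cdot>\<^bsub>M\<^esub> c j) I = (k \<cdot>\<^bsub>M\<^esub> z) \<cdot>\<^bsub>M\<^esub> c j"
        unfolding x(2) using xQ Vc cR j psubset.hyps by (intro N.finsum_rsmult[symmetric]) auto
      also have "finsum M (\<lambda>i. V j (x i \<cdot>\<^bsub>Q\<^esub> d i)) I = V j (finsum Q (\<lambda>i. x i \<cdot>\<^bsub>Q\<^esub> d i) I)"
        using xQ dR psubset.hyps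
        by (intro rmod_hom_finsum[OF right_module_axioms M V[OF j], symmetric]) auto
      also have "\<dots> = \<zero>\<^bsub>M\<^esub>" using sumd rmod_hom_zero[OF right_module_axioms M V[OF j]] by simp
      finally have "finsum M (\<lambda>i. W i (x i)) I = k \<cdot>\<^bsub>M\<^esub> (z \<otimes>\<^bsub>R\<^esub> c j)"
        using kM zR cR[OF j] by (simp add: N.rsmult_assoc)
      moreover have "finsum M (\<lambda>i. W i (x i)) I = finsum M (\<lambda>i. W i (x i)) (I - {j})"
      proof -
        have "W j (x j) = \<zero>\<^bsub>M\<^esub>"
          using xQ[OF j] Vc[OF j xQ[OF j]] cR[OF j] by (simp add: W_def d_def N.rsmult_minus_right N.M.r_neg)
        moreover have "finsum M (\<lambda>i. W i (x i)) (insert j (I - {j})) =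
            W j (x j) \<oplus>\<^bsub>M\<^esub> finsum M (\<lambda>i. W i (x i)) (I - {j})"
          using psubset.hyps Wc xQ j KD(1) by (intro N.M.finsum_insert) auto
        moreover have "finsum M (\<lambda>i. W i (x i)) (I - {j}) \<in> carrier M"
          using Wc xQ KD(1) by (intro N.M.finsum_closed) auto
        ultimately show ?thesis using j by (simp add: insert_absorb)
      qed
      moreover have "finsum M (\<lambda>i. W i (x i)) (I - {j}) = finsum (submod M K) (\<lambda>i. W i (x i)) (I - {j})"
      proof -
        \<comment> \<open>Sums in the submodule and in \<open>M\<close> are formally different; the
          inclusion homomorphism identifies them.\<close>
        have "(\<lambda>x\<in>K. x) \<in> rmod_hom R (submod M K) M"
          using KD by (intro rmod_homI) auto
        from rmod_hom_finsum[OF KM M this, of "I - {j}" "\<lambda>i. W i (x i)"]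
        have *: "(\<lambda>x\<in>K. x) (finsum (submod M K) (\<lambda>i. W i (x i)) (I - {j})) = finsum M (\<lambda>i. (\<lambda>x\<in>K. x) (W i (x i))) (I - {j})"
          using psubset.hyps Wc xQ by auto
        interpret KM: rmod R "submod M K" by (rule rmod.intro) fact
        have "finsum (submod M K) (\<lambda>i. W i (x i)) (I - {j}) \<in> carrier (submod M K)"
          using Wc xQ by (intro KM.M.finsum_closed) auto
        moreover have "finsum M (\<lambda>i. (\<lambda>x\<in>K. x) (W i (x i))) (I - {j}) = finsum M (\<lambda>i. W i (x i)) (I - {j})"
          using Wc xQ KD(1) by (intro N.M.finsum_cong') auto
        ultimately show ?thesis using * by simp
      qed
      ultimately show ?thesis
        using center_mult_nonzero[OF z(1) c[OF j] z(2) cj] xQ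
        by (intro bexI[of _ "z \<otimes>\<^bsub>R\<^esub> c j"] conjI exI[of _ x]) auto
    qed
    have carrier_K: "carrier (submod M K) = K" by simp
    have "\<exists>(n::nat) \<chi>. (\<forall>i\<in>{1..n}. \<chi> i \<in> rmod_hom R (submod M K) (reg_rmodule R) \<and>
        uniform_module R (right_ideal_module R (\<chi> i ` carrier (submod M K)))) \<and>
      inj_on (\<lambda>m. \<lambda>i\<in>{1..n}. \<chi> i m) (carrier (submod M K)) \<and>
      (\<forall>y\<in>(\<Pi>\<^sub>E i\<in>{1..n}. \<chi> i ` carrier (submod M K)). \<exists>m\<in>carrier (submod M K). \<forall>i\<in>{1..n}. \<chi> i m = y i)"
    proof (rule psubset.IH[of "I - {j}" "submod M K" W])
      show "I - {j} \<subset> I" using j by blast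
      show "right_module R (submod M K)" by fact
      show "fin_gen R (submod M K)" by (rule fin_gen_retract[OF M fg K p(1,2)])
      show "baer_module R (submod M K)" by (rule baer_module_retract[OF M baer K p(1,2) pid])
      show "center_torsion R (submod M K) = {\<zero>\<^bsub>submod M K\<^esub>}" using submod_torsion_free[OF K tf] by simp
      show "W i \<in> rmod_hom R Q (submod M K)" if "i \<in> I - {j}" for i using W that by blast
    qed (use genK in simp)
    then obtain n :: nat and \<chi> where chi: "\<And>i. i \<in> {1..n} \<Longrightarrow> \<chi> i \<in> rmod_hom R (submod M K) (reg_rmodule R)"
      and unif: "\<And>i. i \<in> {1..n} \<Longrightarrow> uniform_module R (right_ideal_module R (\<chi> i ` K))"
      and inj: "inj_on (\<lambda>m. \<lambda>i\<in>{1..n}. \<chi> i m) K"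
      and surj: "\<And>y. y \<in> (\<Pi>\<^sub>E i\<in>{1..n}. \<chi> i ` K) \<Longrightarrow> \<exists>m\<in>K. \<forall>i\<in>{1..n}. \<chi> i m = y i"
      unfolding carrier_K by blast
    obtain \<rho> where rho: "\<rho> \<in> rmod_hom R Q (reg_rmodule R)" "inj_on \<rho> (carrier Q)"
      using exists_embedding_in_reg by blast
    \<comment> \<open>The old coordinates are read off after projecting to \<open>K\<close>; the new
      one, with index \<open>Suc n\<close>, is \<open>\<phi>\<close> followed by an embedding of
      \<open>Q\<close> into \<open>R\<close>.\<close>
    define \<xi> where "\<xi> i = (if i = Suc n then compose (carrier M) \<rho> \<phi> else compose (carrier M) (\<chi> i) p)" for i
    have xi_hom: "\<xi> i \<in> rmod_hom R M (reg_rmodule R)" if "i \<in> {1..Suc n}" for i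
      using that rmod_hom_compose[OF M phi rho(1)] rmod_hom_compose[OF M p' chi[of i]] by (auto simp: \<xi>_def)
    have xi1: "\<xi> i m = \<chi> i (p m)" if "i \<in> {1..n}" "m \<in> carrier M" for i m
      using that by (simp add: \<xi>_def compose_def)
    have xi2: "\<xi> (Suc n) m = \<rho> (\<phi> m)" if "m \<in> carrier M" for m
      using that by (simp add: \<xi>_def compose_def)
    have img: "\<xi> i ` carrier M = \<chi> i ` K" if "i \<in> {1..n}" for i
      using xi1[OF that] p(2) by (auto simp: image_iff)
    have unif': "uniform_module R (right_ideal_module R (\<xi> (Suc n) ` carrier M))"
    proof (rule uniform_image_in_reg[OF rho])
      show "right_ideal R (\<xi> (Suc n) ` carrier M)"
        by (rule rsubmodule_image[OF M reg.right_module_axioms xi_hom N.rsubmodule_carrier]) simp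
      show "\<xi> (Suc n) ` carrier M \<subseteq> \<rho> ` carrier Q" using xi2 rmod_homD(2)[OF phi] by auto
      have "\<rho> (\<phi> m0) \<noteq> \<zero>\<^bsub>R\<^esub>"
        using inj_onD[OF rho(2) _ rmod_homD(2)[OF phi m0(1)] M.zero_closed] m0(2)
          rmod_hom_zero[OF right_module_axioms reg.right_module_axioms rho(1)] by auto
      then show "\<xi> (Suc n) ` carrier M \<noteq> {\<zero>\<^bsub>R\<^esub>}" using xi2[OF m0(1)] m0(1) by (metis image_eqI singletonD)
    qed
    have "\<forall>i\<in>{1..Suc n}. \<xi> i \<in> rmod_hom R M (reg_rmodule R) \<and>
        uniform_module R (right_ideal_module R (\<xi> i ` carrier M))"
    proof
      fix i assume i: "i \<in> {1..Suc n}"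
      show "\<xi> i \<in> rmod_hom R M (reg_rmodule R) \<and> uniform_module R (right_ideal_module R (\<xi> i ` carrier M))"
      proof (cases "i = Suc n")
        case False
        then have "i \<in> {1..n}" using i by auto
        then show ?thesis using xi_hom[OF i] unif img by simp
      qed (use xi_hom[OF i] unif' in simp)
    qed
    moreover have "inj_on (\<lambda>m. \<lambda>i\<in>{1..Suc n}. \<xi> i m) (carrier M)"
    proof (rule inj_onI)
      fix m m' assume m: "m \<in> carrier M" "m' \<in> carrier M"
        and "(\<lambda>i\<in>{1..Suc n}. \<xi> i m) = (\<lambda>i\<in>{1..Suc n}. \<xi> i m')"
      then have eq: "\<xi> i m = \<xi> i m'" if "i \<in> {1..Suc n}" for i
        using that by (metis restrict_apply')
      have "(\<lambda>i\<in>{1..n}. \<chi> i (p m)) = (\<lambda>i\<in>{1..n}. \<chi> i (p m'))"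
      proof (rule restrict_ext)
        fix i assume i: "i \<in> {1..n}"
        then have "i \<in> {1..Suc n}" by simp
        then show "\<chi> i (p m) = \<chi> i (p m')" using eq xi1[OF i m(1)] xi1[OF i m(2)] by metis
      qed
      then have pp: "p m = p m'" using inj_onD[OF inj] pK m by blast
      have "\<rho> (\<phi> m) = \<rho> (\<phi> m')" using eq[of "Suc n"] xi2 m by simp
      then have ph: "\<phi> m = \<phi> m'" using inj_onD[OF rho(2)] rmod_homD(2)[OF phi] m by blast
      \<comment> \<open>Equality of the last coordinates puts the difference into \<open>K\<close>,
        where it equals its projection; equality of the others makes that projection zero.\<close>
      define e where "e = m \<oplus>\<^bsub>M\<^esub> \<ominus>\<^bsub>M\<^esub> m'"
      have e: "e \<in> carrier M" using m by (simp add: e_def)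
      have "\<phi> e = \<zero>\<^bsub>Q\<^esub>"
        using rmod_homD(3)[OF phi m(1), of "\<ominus>\<^bsub>M\<^esub> m'"] rmod_hom_minus[OF M right_module_axioms phi m(2)]
          rmod_homD(2)[OF phi m(2)] m(2) ph by (simp add: e_def M.r_neg)
      then have "e = p e" using pid[of e] memK e by simp
      also have "\<dots> = \<zero>\<^bsub>M\<^esub>"
        using rmod_homD(3)[OF p(1) m(1), of "\<ominus>\<^bsub>M\<^esub> m'"] rmod_hom_minus[OF M M p(1) m(2)]
          rmod_homD(2)[OF p(1) m(2)] m(2) pp by (simp add: e_def N.M.r_neg)
      finally show "m = m'" using N.M.minus_equality[of m "\<ominus>\<^bsub>M\<^esub> m'"] m by (simp add: e_def)
    qed
    moreover have "\<exists>m\<in>carrier M. \<forall>i\<in>{1..Suc n}. \<xi> i m = y i"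
      if y: "y \<in> (\<Pi>\<^sub>E i\<in>{1..Suc n}. \<xi> i ` carrier M)" for y
    proof -
      have "restrict y {1..n} \<in> (\<Pi>\<^sub>E i\<in>{1..n}. \<chi> i ` K)"
      proof (rule restrict_PiE_iff[THEN iffD2], rule ballI)
        fix i assume i: "i \<in> {1..n}"
        then have "i \<in> {1..Suc n}" by simp
        then have "y i \<in> \<xi> i ` carrier M" using y by (rule_tac PiE_mem)
        then show "y i \<in> \<chi> i ` K" using img[OF i] by simp
      qed
      from surj[OF this] obtain k where k: "k \<in> K" "\<forall>i\<in>{1..n}. \<chi> i k = restrict y {1..n} i" by blast
      have "y (Suc n) \<in> \<xi> (Suc n) ` carrier M" by (rule PiE_mem[OF y]) simp
      then obtain m1 where m1: "m1 \<in> carrier M" "y (Suc n) = \<rho> (\<phi> m1)" using xi2 by auto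
      have kM: "k \<in> carrier M" and phik: "\<phi> k = \<zero>\<^bsub>Q\<^esub>" using k(1) memK by simp_all
      note pm1 = pK[OF m1(1)]
      have pm1M: "p m1 \<in> carrier M" and phip: "\<phi> (p m1) = \<zero>\<^bsub>Q\<^esub>" using pm1 memK by simp_all
      \<comment> \<open>The part of \<open>m1\<close> in the complement of \<open>K\<close>: it has
        the same value under \<open>\<phi>\<close> and projection zero, so adding it to
        \<open>k\<close> adjusts the last coordinate and no other.\<close>
      define e where "e = m1 \<oplus>\<^bsub>M\<^esub> \<ominus>\<^bsub>M\<^esub> p m1"
      have e: "e \<in> carrier M" using m1 pm1M by (simp add: e_def)
      have minus0: "\<ominus>\<^bsub>Q\<^esub> \<zero>\<^bsub>Q\<^esub> = \<zero>\<^bsub>Q\<^esub>" by (rule M.minus_equality) simp_all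
      have "\<phi> e = \<phi> m1"
        using rmod_homD(3)[OF phi m1(1), of "\<ominus>\<^bsub>M\<^esub> p m1"] rmod_hom_minus[OF M right_module_axioms phi pm1M]
          rmod_homD(2)[OF phi m1(1)] pm1M phip minus0 by (simp add: e_def)
      then have "\<phi> (k \<oplus>\<^bsub>M\<^esub> e) = \<phi> m1"
        using rmod_homD(3)[OF phi kM e] phik rmod_homD(2)[OF phi m1(1)] by simp
      moreover have "p e = \<zero>\<^bsub>M\<^esub>"
        using rmod_homD(3)[OF p(1) m1(1), of "\<ominus>\<^bsub>M\<^esub> p m1"] rmod_hom_minus[OF M M p(1) pm1M]
          pid[OF pm1] pm1M by (simp add: e_def N.M.r_neg)
      then have "p (k \<oplus>\<^bsub>M\<^esub> e) = k" using rmod_homD(3)[OF p(1) kM e] pid[OF k(1)] kM by simp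
      moreover have ke: "k \<oplus>\<^bsub>M\<^esub> e \<in> carrier M" using kM e by simp
      ultimately have "\<xi> i (k \<oplus>\<^bsub>M\<^esub> e) = y i" if "i \<in> {1..Suc n}" for i
        using that xi1[of i, OF _ ke] xi2[OF ke] k(2) m1(2) by (cases "i = Suc n") auto
      then show ?thesis using ke by blast
    qed
    ultimately show ?thesis by (intro exI[of _ "Suc n"] exI[of _ \<xi>] conjI) blast+
  qed
qed

lemma torsion_or_uniform_sum:
  fixes M :: "('a, 'm) rmodule"
  assumes M: "right_module R M" and fg: "fin_gen R M" and baer: "baer_module R M"
  shows "torsion_rmodule R M \<or>
    (\<exists>(n::nat) I. (\<forall>i\<in>{1..n}. right_ideal R (I i) \<and> uniform_module R (right_ideal_module R (I i))) \<and>
       rmod_iso R M (rmod_dsum {1..n} (\<lambda>i. right_ideal_module R (I i))) \<noteq> {})"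
proof (cases "center_torsion R M = carrier M")
  case True
  then show ?thesis using center_torsion_imp_torsion[OF M] by blast
next
  case False
  interpret M: rmod R M by (rule rmod.intro) fact
  interpret reg: rmod R "reg_rmodule R" by (rule rmod.intro[OF right_module_reg[OF R.ring_axioms]])
  obtain n :: nat and V where V: "\<And>i. i < n \<Longrightarrow> V i \<in> rmod_hom R Q M"
    and surj: "(\<lambda>x\<in>carrier (rmod_dsum {..<n} (\<lambda>_. Q)). finsum M (\<lambda>i. V i (x i)) {..<n}) `
      carrier (rmod_dsum {..<n} (\<lambda>_. Q)) = carrier M"
    using fin_gen_power_surj[OF M fg] by blast
  have "\<exists>(n::nat) \<chi>. (\<forall>i\<in>{1..n}. \<chi> i \<in> rmod_hom R M (reg_rmodule R) \<and>
      uniform_module R (right_ideal_module R (\<chi> i ` carrier M))) \<and>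
    inj_on (\<lambda>m. \<lambda>i\<in>{1..n}. \<chi> i m) (carrier M) \<and>
    (\<forall>y\<in>(\<Pi>\<^sub>E i\<in>{1..n}. \<chi> i ` carrier M). \<exists>m\<in>carrier M. \<forall>i\<in>{1..n}. \<chi> i m = y i)"
  proof (rule baer_uniform_coordinates[of "{..<n}" M V])
    show "center_torsion R M = {\<zero>\<^bsub>M\<^esub>}" by (rule baer_torsion_or_torsion_free[OF M fg baer False])
    fix m assume m: "m \<in> carrier M"
    then obtain x where "x \<in> carrier (rmod_dsum {..<n} (\<lambda>_. Q))" "m = finsum M (\<lambda>i. V i (x i)) {..<n}"
      using surj by auto
    moreover have "\<one>\<^bsub>R\<^esub> \<in> ring_center R" by (simp add: ring_center_def)
    ultimately show "\<exists>z\<in>ring_center R. z \<noteq> \<zero>\<^bsub>R\<^esub> \<and>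
      (\<exists>x. (\<forall>i\<in>{..<n}. x i \<in> carrier Q) \<and> m \<cdot>\<^bsub>M\<^esub> z = finsum M (\<lambda>i. V i (x i)) {..<n})"
      \<comment> \<open>The generating maps come from a surjection, so the recursion starts with
        denominator one.\<close>
      using one_neq_zero m by (intro bexI[of _ "\<one>\<^bsub>R\<^esub>"] conjI exI[of _ x]) (auto simp: rmod_dsum_def)
  qed (use M fg baer V in simp_all)
  then obtain n :: nat and \<chi> where chi: "\<And>i. i \<in> {1..n} \<Longrightarrow> \<chi> i \<in> rmod_hom R M (reg_rmodule R)"
    and unif: "\<And>i. i \<in> {1..n} \<Longrightarrow> uniform_module R (right_ideal_module R (\<chi> i ` carrier M))"
    and inj: "inj_on (\<lambda>m. \<lambda>i\<in>{1..n}. \<chi> i m) (carrier M)"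
    and surj: "\<And>y. y \<in> (\<Pi>\<^sub>E i\<in>{1..n}. \<chi> i ` carrier M) \<Longrightarrow> \<exists>m\<in>carrier M. \<forall>i\<in>{1..n}. \<chi> i m = y i" by blast
  define I where "I i = \<chi> i ` carrier M" for i
  let ?D = "rmod_dsum {1..n} (\<lambda>i. right_ideal_module R (I i))"
  let ?h = "\<lambda>m\<in>carrier M. \<lambda>i\<in>{1..n}. \<chi> i m"
  have ideal: "right_ideal R (I i)" if "i \<in> {1..n}" for i
    unfolding I_def by (rule rsubmodule_image[OF M reg.right_module_axioms chi[OF that] M.rsubmodule_carrier])
  have cD: "carrier ?D = (\<Pi>\<^sub>E i\<in>{1..n}. I i)" by (simp add: rmod_dsum_def)
  have hom: "?h \<in> rmod_hom R M ?D"
  proof (rule rmod_homI)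
    show "?h \<in> carrier M \<rightarrow>\<^sub>E carrier ?D" unfolding cD by (auto simp: I_def)
    show "?h (x \<oplus>\<^bsub>M\<^esub> y) = ?h x \<oplus>\<^bsub>?D\<^esub> ?h y" if "x \<in> carrier M" "y \<in> carrier M" for x y
      using that rmod_homD(3)[OF chi that] by (auto simp: rmod_dsum_def intro!: restrict_ext)
    show "?h (x \<cdot>\<^bsub>M\<^esub> r) = ?h x \<cdot>\<^bsub>?D\<^esub> r" if "x \<in> carrier M" "r \<in> carrier R" for x r
      using that rmod_homD(4)[OF chi that] by (auto simp: rmod_dsum_def intro!: restrict_ext)
  qed
  have "bij_betw ?h (carrier M) (carrier ?D)"
  proof (rule bij_betw_imageI)
    show "inj_on ?h (carrier M)" using inj by (simp add: inj_on_def)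
    show "?h ` carrier M = carrier ?D"
    proof
      show "?h ` carrier M \<subseteq> carrier ?D" using rmod_homD(2)[OF hom] by blast
      show "carrier ?D \<subseteq> ?h ` carrier M"
      proof
        fix y assume "y \<in> carrier ?D"
        then have "y \<in> (\<Pi>\<^sub>E i\<in>{1..n}. I i)" by (simp only: cD)
        then have y: "y \<in> (\<Pi>\<^sub>E i\<in>{1..n}. \<chi> i ` carrier M)" by (simp only: I_def)
        then obtain m where m: "m \<in> carrier M" "\<forall>i\<in>{1..n}. \<chi> i m = y i" using surj by blast
        have "(\<lambda>i\<in>{1..n}. \<chi> i m) = y"
          by (rule extensionalityI[where A = "{1..n}"]) (use y m(2) in \<open>auto simp: PiE_iff\<close>)
        then show "y \<in> ?h ` carrier M" using m(1) by (intro rev_image_eqI[OF m(1)]) simp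
      qed
    qed
  qed
  then have "rmod_iso R M ?D \<noteq> {}" using hom unfolding rmod_iso_def by blast
  moreover have "\<forall>i\<in>{1..n}. right_ideal R (I i) \<and> uniform_module R (right_ideal_module R (I i))"
    using ideal unif by (simp add: I_def)
  ultimately show ?thesis by blast
qed

end

theorem theorem3p8:
  fixes R :: "('a, 'c) ring_scheme" and S :: "('b, 'd) ring_scheme"
    and M :: "('a, 'm) rmodule"
  assumes "ring R" and "domain S" and "morita_equivalent TYPE('u) R S"
    and "right_module R M" and "fin_gen R M" and "baer_module R M"
    and "tau_dim R M < \<infinity>"
  shows "torsion_rmodule R M \<or>
    (\<exists>(n::nat) I. (\<forall>i\<in>{1..n}. right_ideal R (I i) \<and> uniform_module R (right_ideal_module R (I i))) \<and>
       rmod_iso R M (rmod_dsum {1..n} (\<lambda>i. right_ideal_module R (I i))) \<noteq> {})"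
proof -
  obtain Q :: "('a, 'u) rmodule" and f q L where "comm_end_generator R Q f q L"
    using morita_equivalent_comm_end_generator[OF assms(1-3)] by blast
  then show ?thesis by (rule comm_end_generator.torsion_or_uniform_sum[OF _ assms(4-6)])
qed

end
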